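(* Let $q>2$ be a prime power. The Hermitian Singer functional code $C_{\mathcal{L}}(\mathtt{D},\mathtt{G})$ contains a linear subcode with parameters $$\left[\,q(q^2-q+1),\ \tfrac12(q^2-q),\ q^3-2(q^2-q-1)\,\right]_{q^2}$$ (length, dimension, minimum distance), whose minimum distance exceeds the designed minimum distance $n-\deg(\mathtt{G})=q^3+1-2(q^2-q+1)$ of $C_{\mathcal{L}}(\mathtt{D},\mathtt{G})$ by $3$.
   Context: Let $q>2$ be a prime power and let $PG(2,q^6)$ have homogeneous coordinates $(X_1:X_2:X_0)$. Let $\Pi$ be the set of points $(\gamma:\gamma^{q^2+1}:1)$ with $\gamma\in\mathbb{F}_{q^6}$, $\gamma^{q^4+q^2+1}=1$, whose lines are the sections by the lines $sX_1+s^{q^2+1}X_2+X_0=0$ with $s^{q^4+q^2+1}=1$. $\Pi$ is a projective plane of order $q^2$, and there is a projectivity of $PG(2,q^6)$ mapping $\Pi$ onto $PG(2,q^2)$. The Frobenius collineation of $\Pi$, which fixes exactly the points of $\Pi$, is $\Phi_\Pi:(x_1:x_2:x_0)\mapsto(x_0^{q^2}:x_1^{q^2}:x_2^{q^2})$. A curve, divisor or rational function is "defined over $\mathbb{F}_{q^2}$" (equivalently, over $\Pi$) if it is so in the usual sense after applying a projectivity mapping $\Pi$ onto $PG(2,q^2)$. Let $\Gamma$ be the Singer subgroup: the cyclic group of order $q^2-q+1$ generated by the projectivity $(x_1:x_2:x_0)\mapsto(\beta x_1:\beta^{q}x_2:x_0)$, where $\beta$ is a primitive $(q^2-q+1)$-th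 root of unity in $\mathbb{F}_{q^6}$ (note $\beta^{q^2+1}=\beta^q$). It preserves $\Pi$ and every curve $H_t$: $tX_1X_2^q+t^{q^2+1}X_2X_0^q+X_0X_1^q=0$ with $t^{q^2+q+1}=1$. Each $H_t$ is a Hermitian curve of $\Pi$: it is non-singular of genus $\mathfrak{g}=\frac12(q^2-q)$, is defined over $\mathbb{F}_{q^2}$ (that is, in the usual sense after applying a projectivity mapping $\Pi$ onto $PG(2,q^2)$), and has exactly $q^3+1$ points in $\Pi$. These points are its $\mathbb{F}_{q^2}$-rational points. Fix $\tau$ with $\tau^{q^2+q+1}=1$. Let $G=\{P_1,\dots,P_N\}$, $N=q^2-q+1$, be the $\Gamma$-orbit of a point of $H_\tau\cap\Pi$, and put $\mathtt{G}=P_1+\cdots+P_N$. Let $D=\{Q_1,\dots,Q_n\}$ be the set of all other points of $H_\tau\cap\Pi$, so $n=q^3+1-(q^2-q+1)$, and put $\mathtt{D}=Q_1+\cdots+Q_n$. Let $\mathcal{L}(\mathtt{G})$ be the Riemann-Roch space over $\mathbb{F}_{q^2}$, i.e. the rational functions $f$ on $H_\tau$ defined over $\mathbb{F}_{q^2}$ with $f=0$ or $\mathrm{div}(f)+\mathtt{G}\succcurlyeq 0$. The Hermitian Singer functional code is $$C_{\mathcal{L}}(\mathtt{D},\mathtt{G})=\{(f(Q_1),\dots,f(Q_n)) : f\in\mathcal{L}(\mathtt{G})\}\subseteq\mathbb{F}_{q^2}^n .$$ Its designed minimum distance is $n-\deg(\mathtt{G})$. *)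

theory Defs
  imports
    "HOL-Analysis.Analysis"
    "HOL-Algebra.Algebraic_Closure_Type"
    "HOL-Number_Theory.Prime_Powers"
begin

text \<open>
  The ground field \<open>F\<^bsub>q^2\<^esub>\<close> is a finite field type \<open>'f\<close> with \<open>CARD('f) = q\<^sup>2\<close>, the geometry
  lives over its algebraic closure \<open>'f alg_closure\<close>, and \<open>F\<^bsub>q^m\<^esub>\<close> is the set of elements of
  the closure fixed by \<open>x \<mapsto> x^(q^m)\<close>; in particular \<open>GF (q^2) = range to_ac\<close>.
\<close>

definition GF :: "nat \<Rightarrow> 'k::field set" where
  "GF m = {x. x ^ m = x}"

definition primitive_root_of_unity :: "nat \<Rightarrow> 'k::field \<Rightarrow> bool" where
  "primitive_root_of_unity m b \<longleftrightarrow> m > 0 \<and> b ^ m = 1 \<and> (\<forall>j. 0 < j \<and> j < m \<longrightarrow> b ^ j \<noteq> 1)"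

text \<open>
  Points are the one-dimensional subspaces of \<open>'k^3\<close>.  The homogeneous coordinates
  \<open>(X\<^sub>1 : X\<^sub>2 : X\<^sub>0)\<close> of a vector \<open>v\<close> are \<open>v$1\<close>, \<open>v$2\<close>, \<open>v$3\<close>, in this order.
\<close>

type_synonym 'k pt = "('k ^ 3) set"

definition PG2 :: "'k::field set \<Rightarrow> 'k pt set" where
  "PG2 S = {vec.span {v} | v. v \<noteq> 0 \<and> (\<forall>i. v $ i \<in> S)}"

definition Pi_plane :: "nat \<Rightarrow> 'k::field pt set" where
  "Pi_plane q = {vec.span {vector [\<gamma>, \<gamma> ^ (q^2 + 1), 1]} | \<gamma>.
     \<gamma> \<in> GF (q^6) \<and> \<gamma> ^ (q^4 + q^2 + 1) = 1}"

text \<open>Matrices of the projectivities of \<open>PG(2,q^6)\<close> that map \<open>\<Pi>\<close> onto \<open>PG(2,q^2)\<close>.\<close>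

definition Pi_straightening :: "nat \<Rightarrow> ('k::field ^ 3 ^ 3) set" where
  "Pi_straightening q = {M. invertible M \<and> (\<forall>i j. M $ i $ j \<in> GF (q^6)) \<and>
     (\<lambda>P. ((*v) M) ` P) ` Pi_plane q = PG2 (GF (q^2))}"

definition singer :: "nat \<Rightarrow> 'k::field \<Rightarrow> 'k pt \<Rightarrow> 'k pt" where
  "singer q \<beta> P = (\<lambda>v. vector [\<beta> * v$1, \<beta>^q * v$2, v$3]) ` P"

text \<open>As the map has finite order, its nonnegative powers form the group \<open>\<Gamma>\<close>.\<close>

definition singer_orbit :: "nat \<Rightarrow> 'k::field \<Rightarrow> 'k pt \<Rightarrow> 'k pt set" where
  "singer_orbit q \<beta> P = {(singer q \<beta> ^^ k) P | k. True}"

text \<open>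
  A ternary form of degree \<open>d\<close> with coefficients in \<open>S\<close>, given as a polynomial function.  Over the
  infinite field \<open>'f alg_closure\<close> the coefficients are determined by the function.
\<close>

definition is_form :: "'k::field set \<Rightarrow> nat \<Rightarrow> ('k ^ 3 \<Rightarrow> 'k) \<Rightarrow> bool" where
  "is_form S d A \<longleftrightarrow> (\<exists>c :: nat \<Rightarrow> nat \<Rightarrow> 'k. (\<forall>i j. c i j \<in> S) \<and>
     (\<forall>v. A v = (\<Sum>i\<le>d. \<Sum>j\<le>d - i. c i j * (v$1)^i * (v$2)^j * (v$3)^(d - i - j))))"

definition curve :: "('k::field ^ 3 \<Rightarrow> 'k) \<Rightarrow> 'k pt set" where
  "curve F = {P \<in> PG2 UNIV. \<forall>v\<in>P. F v = 0}"

definition Hform :: "nat \<Rightarrow> 'k::field \<Rightarrow> 'k ^ 3 \<Rightarrow> 'k" where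
  "Hform q t v = t * v$1 * (v$2)^q + t^(q^2 + 1) * v$2 * (v$3)^q + v$3 * (v$1)^q"

text \<open>
  A rational function on the irreducible curve with point set \<open>Y\<close> (over an algebraically closed
  field) is a class of quotients \<open>A/B\<close> of forms of the same degree with \<open>B\<close> not identically zero
  on \<open>Y\<close>; \<open>A/B\<close> and \<open>A'/B'\<close> are identified if \<open>A B' - A' B\<close> vanishes on \<open>Y\<close>.
\<close>

type_synonym 'k quot = "('k ^ 3 \<Rightarrow> 'k) \<times> ('k ^ 3 \<Rightarrow> 'k)"

definition quots :: "'k::field pt set \<Rightarrow> 'k quot set" where
  "quots Y = {(A, B). (\<exists>d. is_form UNIV d A \<and> is_form UNIV d B) \<and> (\<exists>P\<in>Y. \<exists>v\<in>P. B v \<noteq> 0)}"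

definition quot_rel :: "'k::field pt set \<Rightarrow> ('k quot \<times> 'k quot) set" where
  "quot_rel Y = {((A, B), (A', B')). (A, B) \<in> quots Y \<and> (A', B') \<in> quots Y \<and>
     (\<forall>P\<in>Y. \<forall>v\<in>P. A v * B' v = A' v * B v)}"

definition rat_funs :: "'k::field pt set \<Rightarrow> 'k quot set set" where
  "rat_funs Y = quots Y // quot_rel Y"

definition rat_zero :: "'k::field pt set \<Rightarrow> 'k quot set" where
  "rat_zero Y = quot_rel Y `` {(\<lambda>_. 0, \<lambda>_. 1)}"

definition rat_mult :: "'k::field pt set \<Rightarrow> 'k quot set \<Rightarrow> 'k quot set \<Rightarrow> 'k quot set" where
  "rat_mult Y f g = quot_rel Y ``
     {(\<lambda>v. A v * A' v, \<lambda>v. B v * B' v) | A B A' B'. (A, B) \<in> f \<and> (A', B') \<in> g}"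

definition regular_at :: "'k::field quot set \<Rightarrow> 'k pt \<Rightarrow> bool" where
  "regular_at f P \<longleftrightarrow> (\<exists>(A, B)\<in>f. \<exists>v\<in>P. B v \<noteq> 0)"

definition rat_value :: "'k::field quot set \<Rightarrow> 'k pt \<Rightarrow> 'k" where
  "rat_value f P = (THE c. \<exists>(A, B)\<in>f. \<exists>v\<in>P. B v \<noteq> 0 \<and> c = A v / B v)"

definition local_ring :: "'k::field pt set \<Rightarrow> 'k pt \<Rightarrow> 'k quot set set" where
  "local_ring Y P = {f \<in> rat_funs Y. regular_at f P}"

text \<open>A generator of the maximal ideal of the local ring at \<open>P\<close>.\<close>

definition uniformizer :: "'k::field pt set \<Rightarrow> 'k pt \<Rightarrow> 'k quot set \<Rightarrow> bool" where
  "uniformizer Y P t \<longleftrightarrow> t \<in> local_ring Y P \<and>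
     {f \<in> local_ring Y P. rat_value f P = 0} = rat_mult Y t ` local_ring Y P"

text \<open>
  The order of \<open>f \<noteq> 0\<close> at a nonsingular point \<open>P\<close> is the \<open>n\<close> with \<open>f = u t^n\<close> for a
  uniformizer \<open>t\<close> and a unit \<open>u\<close> of the local ring.  To allow \<open>n < 0\<close> this is written
  \<open>t^b f = t^a u\<close> with \<open>n = a - b\<close>.
\<close>

definition ord_at :: "'k::field pt set \<Rightarrow> 'k pt \<Rightarrow> 'k quot set \<Rightarrow> int" where
  "ord_at Y P f = (THE n. \<exists>t u a b. uniformizer Y P t \<and>
     u \<in> local_ring Y P \<and> rat_value u P \<noteq> 0 \<and>
     n = int a - int b \<and> (rat_mult Y t ^^ b) f = (rat_mult Y t ^^ a) u)"

type_synonym 'k divisor = "'k pt \<Rightarrow> int"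

definition set_divisor :: "'k pt set \<Rightarrow> 'k divisor" where
  "set_divisor S = (\<lambda>P. if P \<in> S then 1 else 0)"

definition div_degree :: "'k divisor \<Rightarrow> int" where
  "div_degree E = (\<Sum>P | E P \<noteq> 0. E P)"

definition principal_divisor :: "'k::field pt set \<Rightarrow> 'k quot set \<Rightarrow> 'k divisor" where
  "principal_divisor Y f = (\<lambda>P. if P \<in> Y then ord_at Y P f else 0)"

text \<open>
  The quotient \<open>(A \<circ> M)/(B \<circ> M)\<close> on \<open>Y\<close> corresponds to \<open>A/B\<close> on the image of \<open>Y\<close> under \<open>M\<close>.
\<close>

definition defined_over_Pi :: "nat \<Rightarrow> 'k::field quot set \<Rightarrow> bool" where
  "defined_over_Pi q f \<longleftrightarrow> (\<exists>M \<in> Pi_straightening q. \<exists>A B d.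
     is_form (GF (q^2)) d A \<and> is_form (GF (q^2)) d B \<and>
     (\<lambda>v. A (M *v v), \<lambda>v. B (M *v v)) \<in> f)"

definition RR_space :: "nat \<Rightarrow> 'k::field pt set \<Rightarrow> 'k divisor \<Rightarrow> 'k quot set set" where
  "RR_space q Y E = {f \<in> rat_funs Y. defined_over_Pi q f \<and>
     (f = rat_zero Y \<or> (\<forall>P. principal_divisor Y f P + E P \<ge> 0))}"

text \<open>\<open>Q\<close> enumerates the evaluation points by the index type of the words.\<close>

definition functional_code ::
  "nat \<Rightarrow> 'f::field alg_closure pt set \<Rightarrow> ('n::finite \<Rightarrow> 'f alg_closure pt) \<Rightarrow>
   'f alg_closure divisor \<Rightarrow> ('f ^ 'n) set" where
  "functional_code q Y Q E =
     {c. \<exists>f \<in> RR_space q Y E. \<forall>i. to_ac (c $ i) = rat_value f (Q i)}"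

definition hamming_distance :: "'f ^ 'n::finite \<Rightarrow> 'f ^ 'n \<Rightarrow> nat" where
  "hamming_distance x y = card {i. x $ i \<noteq> y $ i}"

definition min_distance :: "('f::finite ^ 'n::finite) set \<Rightarrow> nat" where
  "min_distance C = Min {hamming_distance x y | x y. x \<in> C \<and> y \<in> C \<and> x \<noteq> y}"

end

theory Submission
  imports Defs
begin

text \<open>
The Singer orbit \<open>G\<close> is cut out on \<open>H\<^sub>\<tau>\<close> by a second curve of the same family.  Each Singer orbit of points of \<open>\<Pi>\<close> lies
on \<open>q + 1\<close> curves \<open>H\<^sub>t\<close>; choose one with \<open>t \<noteq> \<tau>\<close> through \<open>G\<close>.  Of the \<open>(q + 1)\<^sup>2\<close> intersections of \<open>H\<^sub>\<tau>\<close> and \<open>H\<^sub>t\<close>,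
the \<open>q\<^sup>2 - q + 1\<close> points of \<open>G\<close> count once each and the three vertices of the coordinate triangle count \<open>q\<close> times each.
The product \<open>X\<^sub>1 X\<^sub>2 X\<^sub>0\<close> vanishes to order \<open>q + 1\<close> at every vertex.  So for a form \<open>A\<close> of degree \<open>q - 2\<close> the function
\<open>f\<^sub>A = A X\<^sub>1 X\<^sub>2 X\<^sub>0 / H\<^sub>t\<close> has at worst simple poles, and these lie on \<open>G\<close>.  It is defined over \<open>\<Pi>\<close> if \<open>A\<close> is, after \<open>H\<^sub>t\<close> is
multiplied by a suitable constant.  The words of these functions form the subcode.

At a point of \<open>\<Pi>\<close> on \<open>H\<^sub>\<tau>\<close> outside \<open>G\<close> the factor \<open>X\<^sub>1 X\<^sub>2 X\<^sub>0 / H\<^sub>t\<close> is finite and nonzero, so the zeros of a word are the zeros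
of \<open>A\<close> among the evaluation points.  By Bezout there are at most \<open>(q + 1)(q - 2)\<close> of them (\<open>bezout_bound\<close>, \<open>word_zeros\<close>),
fewer than the length \<open>q(q\<^sup>2 - q + 1)\<close>.  Hence \<open>A\<close> is determined by its word, the dimension is the number
\<open>q(q - 1)/2\<close> of monomials of degree \<open>q - 2\<close>, and every nonzero word has weight at least
\<open>q(q\<^sup>2 - q + 1) - (q + 1)(q - 2) = q\<^sup>3 - 2(q\<^sup>2 - q - 1)\<close>.

Equality holds for a product of \<open>q - 2\<close> lines of \<open>\<Pi>\<close>, each meeting \<open>H\<^sub>\<tau>\<close> in \<open>q + 1\<close> points of \<open>\<Pi>\<close> outside \<open>G\<close>, no two of
which meet on \<open>H\<^sub>\<tau>\<close>.  One such line exists because the lines that are tangent or meet \<open>G\<close> fill fewer than all Singer orbits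
of lines (\<open>exists_external_secant\<close>).  Among the translates of this line under the Singer group, each one meets at most
\<open>q + 1\<close> others on \<open>H\<^sub>\<tau>\<close>, so a greedy choice produces the remaining lines (\<open>exists_disjoint_secants\<close>).

Three general facts are derived along the way for curves \<open>a X\<^sub>1 X\<^sub>2\<^sup>q + b X\<^sub>2 X\<^sub>0\<^sup>q + c X\<^sub>0 X\<^sub>1\<^sup>q = 0\<close>.  They are
irreducible, by Eisenstein's criterion in the chart \<open>X\<^sub>0 = 1\<close>.  The Bezout bound follows from a count of monomials by weight
and so avoids intersection multiplicities.  Every point has a uniformizer \<open>l/m\<close> with linear forms \<open>l, m\<close>, and
eliminating \<open>x\<close> shows that nonzero functions have finite order (\<open>ex_local_param\<close>); therefore a function that
becomes regular after multiplication by \<open>(l/m)\<^sup>n\<close> has order at least \<open>-n\<close> (\<open>ord_at_ge\<close>).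

The field of definition is handled by descent.  A matrix with conjugate rows carries the coordinatewise Frobenius map
to \<open>\<Phi>\<^sub>\<Pi>\<close>, and a form that commutes with the coordinatewise Frobenius map has its coefficients in the fixed field
(\<open>Mmat_straightens\<close>, \<open>is_form_over_GF\<close>).
\<close>

text \<open>The dollar sign is kept for components of vectors, and the unqualified names for univariate polynomials.\<close>

no_notation fps_nth (infixl \<open>$\<close> 75)
hide_const (open) up_ring.monom up_ring.coeff Module.smult Polynomials.degree Polynomials.lead_coeff
  Divisibility.irreducible Divisibility.prime

section \<open>Ternary forms\<close>

lemma is_form_monomial:
  assumes "i + j + l = d"
  shows "is_form UNIV d (\<lambda>v::'k::field^3. c * (v$1)^i * (v$2)^j * (v$3)^l)"
proof -
  define e where "e = (\<lambda>i' j'. if i' = i \<and> j' = j then c else (0::'k))"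
  have "(\<Sum>i'\<le>d. \<Sum>j'\<le>d-i'. e i' j' * (v$1)^i' * (v$2)^j' * (v$3)^(d-i'-j'))
      = c * (v$1)^i * (v$2)^j * (v$3)^l" for v :: "'k^3"
  proof -
    have "(\<Sum>i'\<le>d. \<Sum>j'\<le>d-i'. e i' j' * (v$1)^i' * (v$2)^j' * (v$3)^(d-i'-j'))
        = (\<Sum>i'\<le>d. if i' = i then (\<Sum>j'\<le>d-i. if j' = j then c * (v$1)^i * (v$2)^j * (v$3)^(d-i-j) else 0) else 0)"
      by (intro sum.cong refl) (simp add: e_def if_distribR if_distrib[of "\<lambda>x. x * _"] cong: if_cong)
    also have "\<dots> = c * (v$1)^i * (v$2)^j * (v$3)^(d-i-j)"
      using assms by (simp add: sum.delta)
    also have "d - i - j = l" using assms by simp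
    finally show ?thesis .
  qed
  thus ?thesis unfolding is_form_def by (intro exI[of _ e]) auto
qed

lemma is_form_add:
  assumes "is_form UNIV d A" "is_form UNIV d B"
  shows "is_form UNIV d (\<lambda>v::'k::field^3. A v + B v)"
proof -
  obtain c e where "\<forall>v. A v = (\<Sum>i\<le>d. \<Sum>j\<le>d - i. c i j * (v$1)^i * (v$2)^j * (v$3)^(d - i - j))"
    "\<forall>v. B v = (\<Sum>i\<le>d. \<Sum>j\<le>d - i. e i j * (v$1)^i * (v$2)^j * (v$3)^(d - i - j))"
    using assms unfolding is_form_def by blast
  thus ?thesis unfolding is_form_def
    by (intro exI[of _ "\<lambda>i j. c i j + e i j"]) (simp add: algebra_simps sum.distrib)
qed

lemma is_form_zero: "is_form UNIV d (\<lambda>v::'k::field^3. 0)"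
  using is_form_monomial[of d 0 0 d 0] by simp

lemma is_form_sum:
  assumes "\<And>x. x \<in> I \<Longrightarrow> is_form UNIV d (f x)"
  shows "is_form UNIV d (\<lambda>v::'k::field^3. \<Sum>x\<in>I. f x v)"
  using assms
  by (induction I rule: infinite_finite_induct) (auto simp: is_form_zero is_form_add)

lemma is_form_coord_mult:
  assumes "is_form UNIV d A"
  shows "is_form UNIV (Suc d) (\<lambda>v::'k::field^3. v$k * A v)"
proof -
  obtain c where c: "\<And>v. A v = (\<Sum>i\<le>d. \<Sum>j\<le>d - i. c i j * (v$1)^i * (v$2)^j * (v$3)^(d - i - j))"
    using assms unfolding is_form_def by blast
  have eq: "(\<lambda>v. v$k * A v) = (\<lambda>v. \<Sum>i\<le>d. \<Sum>j\<le>d - i. v$k * (c i j * (v$1)^i * (v$2)^j * (v$3)^(d - i - j)))"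
    by (rule ext) (simp add: c sum_distrib_left)
  have k: "k = 1 \<or> k = 2 \<or> k = 3" using exhaust_3[of k] .
  have m: "is_form UNIV (Suc d) (\<lambda>v::'k^3. v$k * (c i j * (v$1)^i * (v$2)^j * (v$3)^(d - i - j)))"
    if "i \<le> d" "j \<le> d - i" for i j
    using k is_form_monomial[of "Suc i" j "d-i-j" "Suc d" "c i j"]
      is_form_monomial[of i "Suc j" "d-i-j" "Suc d" "c i j"]
      is_form_monomial[of i j "Suc (d-i-j)" "Suc d" "c i j"] that
    by (auto simp: mult_ac)
  show ?thesis unfolding eq by (intro is_form_sum m) auto
qed

text \<open>
Induction along this rule avoids manipulating coefficient arrays: closure under products and linear substitutions, and
homogeneity, become immediate.
\<close>

lemma form_induct [consumes 1, case_names const coord add]: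
  fixes P :: "nat \<Rightarrow> ('k::field^3 \<Rightarrow> 'k) \<Rightarrow> bool"
  assumes "is_form UNIV d A"
    and const: "\<And>c. P 0 (\<lambda>_. c)"
    and coord: "\<And>d A k. is_form UNIV d A \<Longrightarrow> P d A \<Longrightarrow> P (Suc d) (\<lambda>v. v$k * A v)"
    and add: "\<And>d A B. is_form UNIV d A \<Longrightarrow> is_form UNIV d B \<Longrightarrow> P d A \<Longrightarrow> P d B \<Longrightarrow> P d (\<lambda>v. A v + B v)"
  shows "P d A"
proof -
  obtain c where c: "\<And>v. A v = (\<Sum>i\<le>d. \<Sum>j\<le>d - i. c i j * (v$1)^i * (v$2)^j * (v$3)^(d - i - j))"
    using assms(1) unfolding is_form_def by blast
  have z: "P l (\<lambda>v. e * (v$3)^l)" for l e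
  proof (induction l)
    case 0 show ?case using const[of e] by simp
  next
    case (Suc l)
    from coord[OF _ Suc, of 3] is_form_monomial[of 0 0 l l e] show ?case by (simp add: mult_ac)
  qed
  have y: "P (j + l) (\<lambda>v. e * (v$2)^j * (v$3)^l)" for j l e
  proof (induction j)
    case 0 show ?case using z by simp
  next
    case (Suc j)
    from coord[OF _ Suc, of 2] is_form_monomial[of 0 j l "j+l" e] show ?case by (simp add: mult_ac)
  qed
  have x: "P (i + j + l) (\<lambda>v. e * (v$1)^i * (v$2)^j * (v$3)^l)" for i j l e
  proof (induction i)
    case 0 show ?case using y by simp
  next
    case (Suc i)
    from coord[OF _ Suc, of 1] is_form_monomial[of i j l "i+j+l" e] show ?case by (simp add: mult_ac)
  qed
  have zero: "P d (\<lambda>_. 0)" for d using z[of d 0] by simp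
  have s: "P d (\<lambda>v. \<Sum>x\<in>I. f x v)"
    if "\<And>x. x \<in> I \<Longrightarrow> P d (f x)" "\<And>x. x \<in> I \<Longrightarrow> is_form UNIV d (f x)" for I :: "nat set" and f
    using that
    by (induction I rule: infinite_finite_induct)
       (auto simp: zero intro!: add is_form_sum)
  have m: "P d (\<lambda>v. c i j * (v$1)^i * (v$2)^j * (v$3)^(d - i - j))"
    and m': "is_form UNIV d (\<lambda>v. c i j * (v$1)^i * (v$2)^j * (v$3)^(d - i - j))"
    if "i \<le> d" "j \<le> d - i" for i j
    using x[of i j "d-i-j" "c i j"] is_form_monomial[of i j "d-i-j" d "c i j"] that by auto
  have "P d (\<lambda>v. \<Sum>i\<le>d. \<Sum>j\<le>d - i. c i j * (v$1)^i * (v$2)^j * (v$3)^(d - i - j))"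
    by (intro s is_form_sum m m') auto
  moreover have "A = (\<lambda>v. \<Sum>i\<le>d. \<Sum>j\<le>d - i. c i j * (v$1)^i * (v$2)^j * (v$3)^(d - i - j))"
    by (rule ext) (rule c)
  ultimately show ?thesis by simp
qed

lemma is_form_scale: "is_form UNIV d A \<Longrightarrow> is_form UNIV d (\<lambda>v::'k::field^3. c * A v)"
proof (induction rule: form_induct)
  case (const e)
  show ?case using is_form_monomial[of 0 0 0 0 "c * e"] by simp
next
  case (coord d A k)
  from is_form_coord_mult[OF coord(2), of k] show ?case by (simp add: mult_ac)
next
  case (add d A B)
  from is_form_add[OF add(3,4)] show ?case by (simp add: algebra_simps)
qed

lemma is_form_const: "is_form UNIV 0 (\<lambda>v::'k::field^3. c)"
  using is_form_monomial[of 0 0 0 0 c] by simp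

lemma is_form_coord: "is_form UNIV 1 (\<lambda>v::'k::field^3. v$k)"
  using is_form_coord_mult[OF is_form_const[of 1], of k] by simp

lemma is_form_mult:
  assumes "is_form UNIV d A" "is_form UNIV e B"
  shows "is_form UNIV (d + e) (\<lambda>v::'k::field^3. A v * B v)"
  using assms(1)
proof (induction rule: form_induct)
  case (const c)
  show ?case using is_form_scale[OF assms(2)] by simp
next
  case (coord d A k)
  from is_form_coord_mult[OF coord(2), of k] show ?case by (simp add: mult_ac)
next
  case (add d A B)
  from is_form_add[OF add(3,4)] show ?case by (simp add: algebra_simps)
qed

lemma is_form_mult':
  assumes "is_form UNIV d A" "is_form UNIV e B" "n = d + e"
  shows "is_form UNIV n (\<lambda>v::'k::field^3. A v * B v)"
  using is_form_mult assms by blast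

lemma is_form_power:
  assumes "is_form UNIV d A"
  shows "is_form UNIV (d * n) (\<lambda>v::'k::field^3. A v ^ n)"
proof (induction n)
  case 0 show ?case using is_form_const by simp
next
  case (Suc n)
  from is_form_mult[OF assms this] show ?case by simp
qed

lemma is_form_prod:
  assumes "\<And>x. x \<in> I \<Longrightarrow> is_form UNIV 1 (f x)" "finite I"
  shows "is_form UNIV (card I) (\<lambda>v::'k::field^3. \<Prod>x\<in>I. f x v)"
  using assms(2,1)
proof (induction I)
  case empty show ?case using is_form_const by simp
next
  case (insert x I)
  have "is_form UNIV (1 + card I) (\<lambda>v. f x v * (\<Prod>x\<in>I. f x v))"
    by (rule is_form_mult) (use insert in auto)
  thus ?case using insert by simp
qed

lemma is_form_uminus: "is_form UNIV d A \<Longrightarrow> is_form UNIV d (\<lambda>v::'k::field^3. - A v)"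
  using is_form_scale[of d A "-1"] by simp

lemma is_form_diff:
  "is_form UNIV d A \<Longrightarrow> is_form UNIV d B \<Longrightarrow> is_form UNIV d (\<lambda>v::'k::field^3. A v - B v)"
  using is_form_add[OF _ is_form_uminus] by fastforce

lemma is_form_compose:
  assumes "is_form UNIV d A" "\<And>k. is_form UNIV 1 (\<lambda>v::'k::field^3. T v $ k)"
  shows "is_form UNIV d (\<lambda>v. A (T v))"
  using assms(1)
proof (induction rule: form_induct)
  case (const c)
  show ?case by (rule is_form_const)
next
  case (coord d A k)
  from is_form_mult[OF assms(2)[of k] coord(2)] show ?case by simp
next
  case (add d A B)
  show ?case by (rule is_form_add[OF add(3,4)])
qed

lemma is_form_compose_matrix:
  "is_form UNIV d A \<Longrightarrow> is_form UNIV d (\<lambda>v. A (M *v (v::'k::field^3)))"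
proof (rule is_form_compose)
  fix k
  show "is_form UNIV 1 (\<lambda>v::'k^3. (M *v v) $ k)"
    unfolding matrix_vector_mult_def using is_form_sum[OF is_form_scale[OF is_form_coord]] by simp
qed

lemma form_homogeneous: "is_form UNIV d A \<Longrightarrow> A (c *s v) = c ^ d * A (v::'k::field^3)"
proof (induction rule: form_induct)
  case (coord d A k)
  then show ?case by (simp add: mult_ac)
qed (simp_all add: algebra_simps)

lemma infinite_UNIV_alg_closed: "infinite (UNIV :: 'k::alg_closed_field set)"
proof
  assume fin: "finite (UNIV :: 'k set)"
  define p :: "'k poly" where "p = (\<Prod>a\<in>UNIV. [:-a, 1:])"
  have "degree p = card (UNIV :: 'k set)" unfolding p_def by (subst degree_prod_eq_sum_degree) auto
  moreover have "card (UNIV :: 'k set) > 0" using fin by (simp add: card_gt_0_iff)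
  ultimately have "degree (p + 1) > 0" by (simp add: degree_add_eq_left)
  then obtain x where "poly (p + 1) x = 0" using alg_closed_imp_poly_has_root by blast
  moreover have "poly p x = 0" unfolding p_def poly_prod by (rule prod_zero) (use fin in auto)
  ultimately show False by simp
qed

text \<open>
Polynomials of the chart \<open>X\<^sub>0 = 1\<close> are taken in \<open>k[y][x]\<close>, with \<open>x\<close> outermost, because the equation of the curve has a
constant leading coefficient as a polynomial in \<open>x\<close>.
\<close>

definition eval2 :: "'k::comm_ring_1 poly poly \<Rightarrow> 'k \<Rightarrow> 'k \<Rightarrow> 'k" where
  "eval2 g x y = poly (poly g [:x:]) y"

lemma eval2_simps [simp]:
  "eval2 (f + g) x y = eval2 f x y + eval2 g x y"
  "eval2 (f - g) x y = eval2 f x y - eval2 g x y"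
  "eval2 (f * g) x y = eval2 f x y * eval2 g x y"
  "eval2 (f ^ n) x y = eval2 f x y ^ n"
  "eval2 (- f) x y = - eval2 f x y"
  "eval2 (Polynomial.smult p g) x y = poly p y * eval2 g x y"
  "eval2 (monom p n) x y = poly p y * x ^ n"
  "eval2 (pCons p g) x y = poly p y + x * eval2 g x y"
  "eval2 0 x y = 0" "eval2 1 x y = 1"
  unfolding eval2_def by (simp_all add: poly_monom poly_power)

lemma eval2_sum: "eval2 (\<Sum>i\<in>I. f i) x y = (\<Sum>i\<in>I. eval2 (f i) x y)"
  by (simp add: eval2_def poly_sum)

definition total_degree_le :: "nat \<Rightarrow> 'k::comm_ring_1 poly poly \<Rightarrow> bool" where
  "total_degree_le d g \<longleftrightarrow> (\<forall>i j. coeff (coeff g i) j \<noteq> 0 \<longrightarrow> i + j \<le> d)"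

lemma dehomogenize_coeffs:
  fixes c :: "nat \<Rightarrow> nat \<Rightarrow> 'k::field" and d :: nat
  defines "g \<equiv> (\<Sum>i\<le>d. monom (\<Sum>j\<le>d-i. monom (c i j) j) i)"
  shows "eval2 g x y = (\<Sum>i\<le>d. \<Sum>j\<le>d - i. c i j * x^i * y^j)"
    and "coeff (coeff g i) j = (if i + j \<le> d then c i j else 0)"
proof -
  show "eval2 g x y = (\<Sum>i\<le>d. \<Sum>j\<le>d - i. c i j * x^i * y^j)"
    by (simp add: g_def eval2_sum poly_sum poly_monom sum_distrib_left sum_distrib_right mult_ac)
  show "coeff (coeff g i) j = (if i + j \<le> d then c i j else 0)"
    by (auto simp: g_def coeff_sum if_distrib[of "\<lambda>p. coeff p j"] sum.delta cong: if_cong)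
qed

lemma form_dehomogenize:
  assumes "is_form UNIV d (A :: 'k::field^3 \<Rightarrow> 'k)"
  shows "\<exists>g. (\<forall>x y. eval2 g x y = A (vector [x, y, 1])) \<and> total_degree_le d g"
proof -
  obtain c where c: "\<And>v. A v = (\<Sum>i\<le>d. \<Sum>j\<le>d - i. c i j * (v$1)^i * (v$2)^j * (v$3)^(d - i - j))"
    using assms unfolding is_form_def by blast
  show ?thesis
    by (rule exI[of _ "\<Sum>i\<le>d. monom (\<Sum>j\<le>d-i. monom (c i j) j) i"])
       (auto simp: dehomogenize_coeffs total_degree_le_def c vector_3)
qed

definition specialize :: "'k::comm_ring_1 poly poly \<Rightarrow> 'k \<Rightarrow> 'k poly" where
  "specialize g y = map_poly (\<lambda>p. poly p y) g"

lemma poly_specialize: "poly (specialize g y) x = eval2 g x y"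
  unfolding specialize_def by (induction g) (simp_all add: map_poly_pCons)

lemma coeff_specialize: "coeff (specialize g y) i = poly (coeff g i) y"
  by (simp add: specialize_def coeff_map_poly)

lemma degree_specialize: "degree (specialize g y) \<le> degree g"
  by (rule degree_le) (simp add: coeff_specialize coeff_eq_0)

lemma eq_0_if_specializations_eq_0:
  fixes g :: "'k::alg_closed_field poly poly"
  assumes "\<And>y. y \<noteq> 0 \<Longrightarrow> specialize g y = 0"
  shows "g = 0"
proof (rule poly_eqI)
  fix i
  have *: "poly (coeff g i) y = 0" if "y \<noteq> 0" for y
    using assms[OF that] by (metis coeff_specialize coeff_0)
  have "infinite (UNIV - {0::'k})" using infinite_UNIV_alg_closed by simp
  moreover have "UNIV - {0} \<subseteq> {y. poly (coeff g i) y = 0}" using * by auto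
  ultimately have "infinite {y. poly (coeff g i) y = 0}" using finite_subset by blast
  thus "coeff g i = coeff 0 i" using poly_roots_finite by fastforce
qed

lemma eq_0_if_eval2_eq_0:
  fixes g :: "'k::alg_closed_field poly poly"
  assumes "\<And>x y. eval2 g x y = 0"
  shows "g = 0"
proof (rule eq_0_if_specializations_eq_0)
  fix y
  have "{x. poly (specialize g y) x = 0} = UNIV" using assms by (simp add: poly_specialize)
  thus "specialize g y = 0" using infinite_UNIV_alg_closed poly_roots_finite by metis
qed

text \<open>The field is infinite, so a polynomial function determines its coefficients; this justifies representing forms by functions.\<close>

lemma form_coeffs_eq_0:
  fixes c :: "nat \<Rightarrow> nat \<Rightarrow> 'k::alg_closed_field"
  assumes "\<And>v::'k^3. (\<Sum>i\<le>d. \<Sum>j\<le>d - i. c i j * (v$1)^i * (v$2)^j * (v$3)^(d - i - j)) = 0"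
    and "i + j \<le> d"
  shows "c i j = 0"
proof -
  define g where "g = (\<Sum>i\<le>d. monom (\<Sum>j\<le>d-i. monom (c i j) j) i)"
  have "eval2 g x y = 0" for x y
    using assms(1)[of "vector [x, y, 1]"] by (simp add: g_def dehomogenize_coeffs vector_3)
  hence "g = 0" by (rule eq_0_if_eval2_eq_0)
  hence "coeff (coeff g i) j = 0" by simp
  thus ?thesis using assms(2) unfolding g_def dehomogenize_coeffs by simp
qed

section \<open>Irreducibility of the affine curve\<close>

text \<open>Splitting off one linear factor at a time: a root that is not a root of the derivative is simple.\<close>

lemma card_roots_separable:
  fixes p :: "'k::alg_closed_field poly"
  assumes "p \<noteq> 0" "\<And>x. poly p x = 0 \<Longrightarrow> poly (pderiv p) x \<noteq> 0"
  shows "card {x. poly p x = 0} = degree p"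
  using assms
proof (induction "degree p" arbitrary: p)
  case 0
  then obtain e where "p = [:e:]" by (metis degree_0_id)
  with 0 show ?case by auto
next
  case (Suc n)
  then obtain x where x: "poly p x = 0" using alg_closed_imp_poly_has_root[of p] by auto
  then obtain r where r: "p = [:-x, 1:] * r" using poly_eq_0_iff_dvd by blast
  have r0: "r \<noteq> 0" using r Suc by auto
  have deg: "degree p = Suc (degree r)" using r0 by (subst r, subst degree_mult_eq) auto
  have rx: "poly r x \<noteq> 0" using Suc(4)[OF x] unfolding r pderiv_mult by (simp add: pderiv_pCons)
  have "card {y. poly r y = 0} = degree r"
  proof (rule Suc(1))
    show "n = degree r" using deg Suc(2) by simp
    fix y assume y: "poly r y = 0"
    hence "poly (pderiv p) y \<noteq> 0" using Suc(4)[of y] by (simp add: r)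
    thus "poly (pderiv r) y \<noteq> 0" using y unfolding r pderiv_mult by (auto simp: pderiv_pCons)
  qed (rule r0)
  moreover have "{y. poly p y = 0} = insert x {y. poly r y = 0}" by (auto simp: r)
  moreover have "finite {y. poly r y = 0}" using r0 poly_roots_finite by blast
  ultimately show ?case using rx deg by simp
qed

text \<open>
Eisenstein's criterion.  In a proper factorization \<open>g h\<close> the prime divides exactly one of the constant terms, say that of
\<open>g\<close>; the first coefficient of \<open>g\<close> that it does not divide yields a coefficient of the product that it does not divide
either, below the leading one.
\<close>

lemma eisenstein_irreducible:
  fixes p :: "'a::{idom_divide,algebraic_semidom} poly"
  assumes \<pi>: "prime_elem \<pi>" and lead: "is_unit (lead_coeff p)" and deg: "degree p > 0"
    and low: "\<And>i. i < degree p \<Longrightarrow> \<pi> dvd coeff p i" and sq: "\<not> \<pi> ^ 2 dvd coeff p 0"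
  shows "irreducible p"
proof -
  have \<pi>1: "\<not> \<pi> dvd lead_coeff p"
    using \<pi> lead dvd_unit_imp_unit by (auto simp: prime_elem_def)
  have no_split: False
    if gh: "p = g * h" and dg: "degree g > 0" and dh: "degree h > 0" and g0: "\<pi> dvd coeff g 0" for g h
  proof -
    have nz: "g \<noteq> 0" "h \<noteq> 0" using gh deg by auto
    have lg: "\<not> \<pi> dvd lead_coeff g" using \<pi>1 dvd_mult2 by (metis gh lead_coeff_mult)
    have h0: "\<not> \<pi> dvd coeff h 0"
      using sq g0 by (auto simp: gh coeff_mult power2_eq_square mult_dvd_mono)
    define i where "i = (LEAST i. \<not> \<pi> dvd coeff g i)"
    have i: "\<not> \<pi> dvd coeff g i" unfolding i_def using lg by (rule LeastI)
    have ilt: "\<pi> dvd coeff g j" if "j < i" for j using that not_less_Least unfolding i_def by blast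
    have "i \<le> degree g" unfolding i_def using lg by (rule Least_le)
    hence "i < degree p" using dh nz by (simp add: gh degree_mult_eq)
    hence "\<pi> dvd coeff p i" by (rule low)
    moreover have "coeff p i = coeff g i * coeff h 0 + (\<Sum>j<i. coeff g j * coeff h (i - j))"
      by (simp add: gh coeff_mult flip: lessThan_Suc_atMost)
    moreover have "\<pi> dvd (\<Sum>j<i. coeff g j * coeff h (i - j))"
      by (rule dvd_sum) (use ilt in auto)
    ultimately have "\<pi> dvd coeff g i * coeff h 0" by (simp add: dvd_add_left_iff)
    thus False using i h0 \<pi> by (simp add: prime_elem_dvd_mult_iff)
  qed
  show ?thesis
  proof (rule Factorial_Ring.irreducibleI)
    show "p \<noteq> 0" using deg by auto
    show "\<not> is_unit p"
    proof
      assume "is_unit p"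
      then obtain r where r: "1 = p * r" by (elim dvdE)
      hence "p \<noteq> 0" "r \<noteq> 0" by auto
      hence "degree (p * r) = degree p + degree r" by (rule degree_mult_eq)
      thus False using r deg by (metis add_is_0 degree_1 not_gr_zero)
    qed
    fix g h assume gh: "p = g * h"
    have units: "is_unit (lead_coeff g)" "is_unit (lead_coeff h)"
      using lead by (simp_all add: gh lead_coeff_mult is_unit_mult_iff)
    have unit: "is_unit f" if "degree f = 0" "is_unit (lead_coeff f)" for f :: "'a poly"
      using that by (metis degree_0_id is_unit_const_poly_iff lead_coeff_pCons(2) degree_pCons_0 coeff_pCons_0)
    have "degree g = 0 \<or> degree h = 0"
    proof (rule ccontr)
      assume "\<not> (degree g = 0 \<or> degree h = 0)"
      hence d: "degree g > 0" "degree h > 0" by auto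
      have "\<pi> dvd coeff g 0 * coeff h 0" using low[OF deg] by (simp add: gh coeff_mult)
      hence "\<pi> dvd coeff g 0 \<or> \<pi> dvd coeff h 0" using \<pi> by (simp add: prime_elem_dvd_mult_iff)
      thus False using no_split[OF gh d] no_split[of h g] gh d by (auto simp: mult.commute)
    qed
    thus "is_unit g \<or> is_unit h" using unit units by blast
  qed
qed

text \<open>
The common shape of the Hermitian curves.  It is preserved by the cyclic rotation of the coordinates, which moves any
vertex of the coordinate triangle to any other; for \<open>q = 3\<close> and unit coefficients it is the equation of the Klein quartic.
\<close>

definition Kform :: "nat \<Rightarrow> 'k::field \<Rightarrow> 'k \<Rightarrow> 'k \<Rightarrow> 'k^3 \<Rightarrow> 'k" where
  "Kform q a b c v = a * v$1 * (v$2)^q + b * v$2 * (v$3)^q + c * v$3 * (v$1)^q"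

text \<open>That \<open>q\<close> is a power of the characteristic enters only through additivity of the \<open>q\<close>-th power and the vanishing of \<open>q\<close>.\<close>

locale klein_curve =
  fixes q :: nat and a b c :: "'k::{alg_closed_field,factorial_ring_gcd,semiring_gcd_mult_normalize}"
  assumes q2: "q \<ge> 2" and q0: "of_nat q = (0::'k)"
    and frob: "\<And>x y::'k. (x + y)^q = x^q + y^q"
    and a0: "a \<noteq> 0" and b0: "b \<noteq> 0" and c0: "c \<noteq> 0"
begin

definition Kpoly :: "'k poly poly" where
  "Kpoly = [:monom b 1, monom a q:] + monom [:c:] q"

lemma eval2_Kpoly: "eval2 Kpoly x y = c * x^q + a * y^q * x + b * y"
  by (simp add: Kpoly_def poly_monom algebra_simps)

lemma eval2_Kpoly_Kform: "eval2 Kpoly x y = Kform q a b c (vector [x, y, 1])"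
  by (simp add: eval2_Kpoly Kform_def vector_3 algebra_simps)

lemma coeff_Kpoly: "coeff Kpoly i = (if i = 0 then monom b 1 else if i = 1 then monom a q else if i = q then [:c:] else 0)"
  using q2 by (auto simp: Kpoly_def coeff_pCons split: nat.split)

lemma degree_Kpoly: "degree Kpoly = q"
proof (rule antisym)
  show "degree Kpoly \<le> q" by (rule degree_le) (use q2 in \<open>auto simp: coeff_Kpoly\<close>)
  show "q \<le> degree Kpoly" by (rule le_degree) (use q2 c0 in \<open>auto simp: coeff_Kpoly\<close>)
qed

lemma Kpoly_nz: "Kpoly \<noteq> 0" using degree_Kpoly q2 by auto

text \<open>The equation \<open>c x\<^sup>q + a y\<^sup>q x + b y\<close> is Eisenstein at \<open>y\<close>: the curve is totally ramified over \<open>y = 0\<close>.\<close>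

lemma prime_Kpoly: "prime_elem Kpoly"
proof (rule irreducible_imp_prime_elem, rule eisenstein_irreducible)
  show "prime_elem [:0, 1::'k:]" by (rule prime_elem_linear_field_poly) simp
  show "is_unit (lead_coeff Kpoly)" using q2 c0 by (simp add: degree_Kpoly coeff_Kpoly is_unit_const_poly_iff dvd_field_iff)
  show "degree Kpoly > 0" using q2 by (simp add: degree_Kpoly)
  fix i assume "i < degree Kpoly"
  thus "[:0, 1:] dvd coeff Kpoly i"
    using q2 by (auto simp: degree_Kpoly coeff_Kpoly poly_monom dvd_iff_poly_eq_0[of 0, simplified] simp flip: poly_eq_0_iff_dvd)
next
  show "\<not> [:0, 1:] ^ 2 dvd coeff Kpoly 0"
  proof
    assume "[:0, 1:] ^ 2 dvd coeff Kpoly 0"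
    then obtain r where r: "monom b 1 = [:0, 1:]^2 * r" by (auto simp: coeff_Kpoly elim: dvdE)
    have "[:0, 1:]^2 * r = pCons 0 (pCons 0 r)" unfolding power2_eq_square by simp
    hence "coeff (monom b 1) 1 = coeff (pCons 0 (pCons 0 r)) 1" by (simp only: r)
    thus False using b0 by simp
  qed
qed

text \<open>The derivative in \<open>x\<close> is the constant \<open>a y\<^sup>q\<close>, so the fibres of the second coordinate are reduced away from \<open>y = 0\<close>.\<close>

lemma card_fibre:
  assumes "y \<noteq> 0"
  shows "card {x. eval2 Kpoly x y = 0} = q"
proof -
  have "pderiv (specialize Kpoly y) = [:a * y^q:]"
  proof (rule poly_eqI)
    fix i
    show "coeff (pderiv (specialize Kpoly y)) i = coeff [:a * y^q:] i"
      using q2 q0 by (cases i) (auto simp: coeff_pderiv coeff_specialize coeff_Kpoly poly_monom)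
  qed
  moreover have "degree (specialize Kpoly y) = q"
  proof (rule antisym)
    show "degree (specialize Kpoly y) \<le> q" using degree_specialize degree_Kpoly by metis
    show "q \<le> degree (specialize Kpoly y)"
      by (rule le_degree) (use q2 c0 in \<open>auto simp: coeff_specialize coeff_Kpoly\<close>)
  qed
  moreover have "specialize Kpoly y \<noteq> 0" using calculation(2) q2 by auto
  ultimately show ?thesis
    using card_roots_separable[of "specialize Kpoly y"] assms a0 by (simp add: poly_specialize)
qed

lemma reduced_eq_0:
  assumes deg: "degree g < q" and van: "\<And>x y. eval2 Kpoly x y = 0 \<Longrightarrow> eval2 g x y = 0"
  shows "g = 0"
proof (rule eq_0_if_specializations_eq_0)
  fix y :: 'k assume y: "y \<noteq> 0"
  show "specialize g y = 0"
  proof (rule ccontr)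
    assume nz: "specialize g y \<noteq> 0"
    have "{x. eval2 Kpoly x y = 0} \<subseteq> {x. poly (specialize g y) x = 0}"
      using van by (auto simp: poly_specialize)
    hence "q \<le> card {x. poly (specialize g y) x = 0}"
      using card_mono[OF poly_roots_finite[OF nz]] card_fibre[OF y] by metis
    also have "\<dots> \<le> degree (specialize g y)" by (rule card_poly_roots_bound[OF nz])
    also have "\<dots> < q" using degree_specialize[of g y] deg by simp
    finally show False by simp
  qed
qed

lemma Kpoly_not_dvd_const: "r \<noteq> 0 \<Longrightarrow> \<not> Kpoly dvd [:r:]"
  using dvd_imp_degree_le[of Kpoly "[:r:]"] q2 degree_Kpoly by auto

lemma Kpoly_not_dvd_reduced: "g \<noteq> 0 \<Longrightarrow> degree g < q \<Longrightarrow> \<not> Kpoly dvd g"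
  using dvd_imp_degree_le[of Kpoly g] degree_Kpoly by auto

text \<open>The Nullstellensatz for the curve.  A remainder has degree less than \<open>q\<close> in \<open>x\<close> but \<open>q\<close> zeros on almost every fibre.\<close>

lemma vanishing_imp_Kpoly_dvd:
  assumes van: "\<And>x y. eval2 Kpoly x y = 0 \<Longrightarrow> eval2 g x y = 0"
  shows "Kpoly dvd g"
proof -
  define r where "r = pseudo_mod g Kpoly"
  obtain e s where e: "e \<noteq> 0" "Polynomial.smult e g = Kpoly * s + r"
    using pseudo_mod(1)[OF Kpoly_nz, of g] unfolding r_def by blast
  have "r = 0"
  proof (rule ccontr)
    assume "r \<noteq> 0"
    hence "degree r < q" using pseudo_mod(2)[OF Kpoly_nz, of g] degree_Kpoly unfolding r_def by auto
    moreover have "eval2 r x y = 0" if "eval2 Kpoly x y = 0" for x y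
    proof -
      have "eval2 (Polynomial.smult e g) x y = eval2 (Kpoly * s + r) x y" by (simp add: e)
      thus ?thesis using that van by simp
    qed
    ultimately show False using reduced_eq_0 \<open>r \<noteq> 0\<close> by blast
  qed
  hence "[:e:] * g = Kpoly * s" using e by simp
  hence "Kpoly dvd [:e:] * g" by simp
  thus ?thesis using prime_Kpoly Kpoly_not_dvd_const[OF e(1)] by (simp only: prime_elem_dvd_mult_iff) blast
qed

lemma Kpoly_dvd_iff: "Kpoly dvd g \<longleftrightarrow> (\<forall>x y. eval2 Kpoly x y = 0 \<longrightarrow> eval2 g x y = 0)"
  using vanishing_imp_Kpoly_dvd[of g] by (auto elim!: dvdE)

text \<open>
Elimination of \<open>x\<close>.  An element of least degree in \<open>x\<close> of the ideal generated by the curve and \<open>g\<close> divides both generators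
up to polynomials in \<open>y\<close>; as the curve is irreducible and does not divide \<open>g\<close>, that element is itself a polynomial in \<open>y\<close>.
\<close>

lemma eliminate:
  assumes g: "\<not> Kpoly dvd g"
  obtains r v where "r \<noteq> 0" "Kpoly dvd [:r:] - v * g"
proof -
  define I where "I = {h. h \<noteq> 0 \<and> (\<exists>u v. h = u * Kpoly + v * g)}"
  have "Kpoly = 1 * Kpoly + 0 * g" by simp
  hence "Kpoly \<in> I" using Kpoly_nz unfolding I_def by blast
  then obtain h where h: "h \<in> I" and min: "\<And>h'. h' \<in> I \<Longrightarrow> degree h \<le> degree h'"
    using ex_has_least_nat[of "\<lambda>h. h \<in> I" Kpoly degree] by blast
  from h obtain u v where uv: "h \<noteq> 0" "h = u * Kpoly + v * g" unfolding I_def by blast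
  have dvd: "\<exists>e s. e \<noteq> 0 \<and> Polynomial.smult e f = h * s" if f: "f = u' * Kpoly + v' * g" for f u' v'
  proof -
    obtain e s where e: "e \<noteq> 0" "Polynomial.smult e f = h * s + pseudo_mod f h"
      using pseudo_mod(1)[OF uv(1), of f] by blast
    have "pseudo_mod f h = 0"
    proof (rule ccontr)
      assume nz: "pseudo_mod f h \<noteq> 0"
      have "pseudo_mod f h = [:e:] * f - h * s" using e(2) by simp
      also have "\<dots> = ([:e:] * u' - u * s) * Kpoly + ([:e:] * v' - v * s) * g"
        unfolding f uv(2) by (simp only: algebra_simps)
      finally have "pseudo_mod f h \<in> I" using nz unfolding I_def by blast
      thus False using min[of "pseudo_mod f h"] pseudo_mod(2)[OF uv(1), of f] nz by auto
    qed
    thus ?thesis using e by auto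
  qed
  have notdvd: "\<not> Kpoly dvd h"
  proof
    assume "Kpoly dvd h"
    obtain e s where e: "e \<noteq> 0" "Polynomial.smult e g = h * s" using dvd[of g 0 1] by auto
    hence "Kpoly dvd [:e:] * g" using \<open>Kpoly dvd h\<close> by simp
    thus False using prime_Kpoly Kpoly_not_dvd_const[OF e(1)] g by (simp only: prime_elem_dvd_mult_iff) blast
  qed
  obtain e s where e: "e \<noteq> 0" "Polynomial.smult e Kpoly = h * s" using dvd[of Kpoly 1 0] by auto
  hence "Kpoly dvd h * s" by (metis dvd_smult dvd_refl)
  hence "Kpoly dvd s" using notdvd prime_Kpoly by (simp only: prime_elem_dvd_mult_iff) blast
  then obtain s' where s': "s = Kpoly * s'" by (elim dvdE)
  have "Kpoly * [:e:] = Kpoly * (h * s')" using e(2) unfolding s' by (simp add: mult_ac)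
  hence hs: "[:e:] = h * s'" using mult_left_cancel[OF Kpoly_nz] by blast
  hence "s' \<noteq> 0" using e by auto
  have "degree [:e:] = degree h + degree s'" unfolding hs using uv(1) \<open>s' \<noteq> 0\<close> by (rule degree_mult_eq)
  hence "degree h = 0" by simp
  then obtain r where r: "h = [:r:]" by (metis degree_0_id)
  have "r \<noteq> 0" using uv(1) r by auto
  moreover have "[:r:] - v * g = u * Kpoly" using uv(2) unfolding r by simp
  hence "Kpoly dvd [:r:] - v * g" by simp
  ultimately show ?thesis by (rule that)
qed

end

section \<open>A Bezout bound by counting monomials\<close>

text \<open>More functions than points of evaluation are linearly dependent: Gaussian elimination, one point at a time.\<close>

lemma dependent_family:
  fixes f :: "'i \<Rightarrow> 'b \<Rightarrow> 'k::field"
  assumes "finite B" "finite S" "card B < card S"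
  shows "\<exists>\<alpha>. (\<exists>i\<in>S. \<alpha> i \<noteq> 0) \<and> (\<forall>b\<in>B. (\<Sum>i\<in>S. \<alpha> i * f i b) = 0)"
  using assms
proof (induction B arbitrary: S f rule: finite_induct)
  case empty
  hence "\<exists>i. i \<in> S" by (metis card.empty ex_in_conv less_irrefl)
  thus ?case by (intro exI[of _ "\<lambda>_. 1"]) auto
next
  case (insert b B)
  show ?case
  proof (cases "\<forall>i\<in>S. f i b = 0")
    case True
    obtain \<alpha> where "\<exists>i\<in>S. \<alpha> i \<noteq> 0" "\<forall>b\<in>B. (\<Sum>i\<in>S. \<alpha> i * f i b) = 0"
      using insert.IH[of S f] insert.prems insert.hyps by auto
    thus ?thesis using True by (intro exI[of _ \<alpha>]) auto
  next
    case False
    then obtain i0 where i0: "i0 \<in> S" "f i0 b \<noteq> 0" by blast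
    define S' where "S' = S - {i0}"
    define f' where "f' = (\<lambda>i b'. f i b' - f i b / f i0 b * f i0 b')"
    have "card B < card S'" "finite S'" using insert i0 by (simp_all add: S'_def)
    then obtain \<alpha> where \<alpha>: "\<exists>i\<in>S'. \<alpha> i \<noteq> 0" "\<forall>b\<in>B. (\<Sum>i\<in>S'. \<alpha> i * f' i b) = 0"
      using insert.IH[of S' f'] by auto
    define \<beta> where "\<beta> = \<alpha>(i0 := - (\<Sum>i\<in>S'. \<alpha> i * f i b) / f i0 b)"
    have eq: "(\<Sum>i\<in>S. \<beta> i * f i b') = (\<Sum>i\<in>S'. \<alpha> i * f' i b')" for b'
    proof -
      have "(\<Sum>i\<in>S. \<beta> i * f i b') = \<beta> i0 * f i0 b' + (\<Sum>i\<in>S'. \<beta> i * f i b')"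
        unfolding S'_def by (rule sum.remove) (use insert i0 in auto)
      also have "(\<Sum>i\<in>S'. \<beta> i * f i b') = (\<Sum>i\<in>S'. \<alpha> i * f i b')"
        by (rule sum.cong) (auto simp: \<beta>_def S'_def)
      also have "\<beta> i0 * f i0 b' = - (\<Sum>i\<in>S'. \<alpha> i * (f i b / f i0 b * f i0 b'))"
        by (simp add: \<beta>_def sum_distrib_left sum_divide_distrib mult_ac)
      finally show ?thesis by (simp add: f'_def right_diff_distrib sum_subtractf)
    qed
    have "(\<Sum>i\<in>S. \<beta> i * f i b') = 0" if "b' \<in> insert b B" for b'
      using that \<alpha>(2) i0(2) unfolding eq by (auto simp: f'_def)
    moreover have "\<exists>i\<in>S. \<beta> i \<noteq> 0" using \<alpha>(1) by (auto simp: \<beta>_def S'_def)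
    ultimately show ?thesis by blast
  qed
qed

text \<open>
The weights \<open>q\<close> of \<open>x\<close> and \<open>q - 1\<close> of \<open>y\<close> are their pole orders at the vertex \<open>(1 : 0 : 0)\<close>.  The two
top terms \<open>c x\<^sup>q\<close> and \<open>a x y\<^sup>q\<close> of the curve both have weight \<open>q\<^sup>2\<close>.
\<close>

definition weight_le :: "nat \<Rightarrow> nat \<Rightarrow> 'k::comm_ring_1 poly poly \<Rightarrow> bool" where
  "weight_le q W g \<longleftrightarrow> (\<forall>i j. coeff (coeff g i) j \<noteq> 0 \<longrightarrow> q * i + (q - 1) * j \<le> W)"

definition mon :: "nat \<times> nat \<Rightarrow> 'k::comm_ring_1 poly poly" where
  "mon ij = monom (monom 1 (snd ij)) (fst ij)"

lemma coeff_mon: "coeff (coeff (mon (i, j)) i') j' = (if i' = i \<and> j' = j then 1 else 0)"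
  by (auto simp: mon_def)

lemma weight_le_mult_mon:
  assumes "weight_le q W g"
  shows "weight_le q (W + (q * i + (q - 1) * j)) (g * mon (i, j))"
  unfolding weight_le_def
proof (intro allI impI)
  fix i' j' assume nz: "coeff (coeff (g * mon (i, j)) i') j' \<noteq> 0"
  have "coeff (coeff (g * mon (i, j)) i') j' =
      (if i' < i \<or> j' < j then 0 else coeff (coeff g (i' - i)) (j' - j))"
    by (simp add: mon_def mult.commute[of g] coeff_monom_mult)
  with nz have *: "i \<le> i'" "j \<le> j'" "coeff (coeff g (i' - i)) (j' - j) \<noteq> 0" by (auto split: if_splits)
  hence "q * (i' - i) + (q - 1) * (j' - j) \<le> W" using assms unfolding weight_le_def by blast
  moreover have "q * i' = q * (i' - i) + q * i" "(q - 1) * j' = (q - 1) * (j' - j) + (q - 1) * j"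
    using * by (simp_all flip: distrib_left)
  ultimately show "q * i' + (q - 1) * j' \<le> W + (q * i + (q - 1) * j)" by linarith
qed

text \<open>
Reduced means of degree less than \<open>q\<close> in \<open>x\<close>.  For a fixed power of \<open>x\<close> the exponent of \<open>y\<close> may grow by \<open>d\<close>, and by one more
for \<open>x, \<dots>, x\<^sup>d\<close>; this rounding gain turns \<open>q d\<close> into \<open>(q + 1) d\<close>.  The lower weight is a multiple of \<open>q - 1\<close>
in order that the rounding is the same for all powers of \<open>x\<close> but the zeroth.
\<close>

lemma card_reduced_monomials:
  fixes q d M :: nat
  assumes d: "d < q - 1" and M: "M \<ge> q"
  defines "I \<equiv> (\<lambda>W. {(i, j). i < q \<and> q * i + (q - 1) * j \<le> W})"
  shows "card (I ((q - 1) * M + q * d)) = card (I ((q - 1) * M)) + (q + 1) * d"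
proof -
  define r where "r = q - 1"
  have q: "q = Suc r" and dr: "d < r" using d by (auto simp: r_def)
  define h where "h = (\<lambda>i. M - i - (if i = 0 then 0 else 1))"
  define h' where "h' = (\<lambda>i. M + d - i - (if i \<le> d then 0 else 1))"
  have aux: "r * s + i \<le> r * n + e \<longleftrightarrow> (if i \<le> e then s \<le> n else s < n)" if "i \<le> r" "e < r" for s i n e :: nat
  proof (cases "s \<le> n")
    case True
    then obtain t where t: "n = s + t" using le_Suc_ex by blast
    show ?thesis
    proof (cases t)
      case 0 thus ?thesis using t by auto
    next
      case (Suc t') thus ?thesis using t that by (auto simp: distrib_left)
    qed
  next
    case False
    then obtain t where t: "s = n + Suc t" using less_imp_Suc_add not_le by (metis add_Suc_right)
    show ?thesis using t that by (auto simp: distrib_left)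
  qed
  have wt: "q * i + (q - 1) * j = r * (i + j) + i" for i j by (simp add: q algebra_simps)
  have W: "(q - 1) * M = r * M + 0" "(q - 1) * M + q * d = r * (M + d) + d" by (simp_all add: q algebra_simps)
  have I1: "I ((q - 1) * M) = Sigma {..<q} (\<lambda>i. {..h i})"
  proof -
    have "(i < q \<and> q * i + (q - 1) * j \<le> (q - 1) * M) \<longleftrightarrow> (i < q \<and> j \<le> h i)" for i j
    proof (cases "i < q")
      case True
      hence "i \<le> r" using q by simp
      thus ?thesis unfolding wt W(1) using aux[of i 0 "i + j" M] dr True M by (auto simp: h_def)
    qed simp
    thus ?thesis by (auto simp: I_def)
  qed
  have I2: "I ((q - 1) * M + q * d) = Sigma {..<q} (\<lambda>i. {..h' i})"
  proof -
    have "(i < q \<and> q * i + (q - 1) * j \<le> (q - 1) * M + q * d) \<longleftrightarrow> (i < q \<and> j \<le> h' i)" for i j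
    proof (cases "i < q")
      case True
      hence "i \<le> r" using q by simp
      thus ?thesis unfolding wt W(2) using aux[of i d "i + j" "M + d"] dr True M by (auto simp: h'_def)
    qed simp
    thus ?thesis by (auto simp: I_def)
  qed
  have "card (I ((q - 1) * M + q * d)) = (\<Sum>i<q. Suc (h' i))" unfolding I2 by simp
  also have "\<dots> = (\<Sum>i<q. Suc (h i) + (d + (if i \<in> {1..d} then 1 else 0)))"
    by (rule sum.cong) (use M in \<open>auto simp: h_def h'_def\<close>)
  also have "\<dots> = (\<Sum>i<q. Suc (h i)) + (q * d + (\<Sum>i<q. if i \<in> {1..d} then 1 else 0))"
    by (simp only: sum.distrib sum_constant card_lessThan of_nat_id)
  also have "(\<Sum>i<q. if i \<in> {1..d} then 1 else 0) = card ({..<q} \<inter> {1..d})"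
    by (simp only: sum.If_cases finite_lessThan Collect_mem_eq) simp
  also have "{..<q} \<inter> {1..d} = {1..d}" using dr q by auto
  also have "(\<Sum>i<q. Suc (h i)) = card (I ((q - 1) * M))" unfolding I1 by simp
  finally show ?thesis by simp
qed

lemma finite_weight:
  assumes "q \<ge> 2" shows "finite {(i, j). q * i + (q - 1) * j \<le> (W::nat)}"
proof (rule finite_subset)
  have "i \<le> W \<and> j \<le> W" if "q * i + (q - 1) * j \<le> W" for i j
  proof -
    have "1 * i \<le> q * i" using assms by (intro mult_le_mono1) simp
    moreover have "1 * j \<le> (q - 1) * j" using assms by (intro mult_le_mono1) simp
    ultimately show ?thesis using that by (metis add_leD1 add_leD2 le_trans mult_1)
  qed
  thus "{(i, j). q * i + (q - 1) * j \<le> W} \<subseteq> {..W} \<times> {..W}" by blast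
qed simp

context klein_curve
begin

text \<open>
Consider the products of the curve and of \<open>g\<close> with monomials, the latter reduced, together with the first \<open>card Z\<close> powers of
\<open>y\<close>, all within a common weight.  If \<open>Z\<close> were too large, they would outnumber the monomials of that weight, so
\<open>Kpoly * U + g * V + R = 0\<close> for some coefficients, not all zero, with \<open>V\<close> reduced and \<open>R\<close> a polynomial in \<open>y\<close> of degree
less than \<open>card Z\<close>.  But \<open>R\<close> vanishes at the distinct second coordinates of \<open>Z\<close>, so \<open>R = 0\<close>; then the
irreducible curve divides the reduced \<open>V\<close>, which forces \<open>V = 0\<close> and \<open>U = 0\<close>.
\<close>

lemma bezout_bound:
  assumes g0: "g \<noteq> 0" and deg: "total_degree_le d g" and d: "d < q - 1"
    and fin: "finite Z" and inj: "inj_on snd Z"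
    and zero: "\<And>x y. (x, y) \<in> Z \<Longrightarrow> eval2 Kpoly x y = 0 \<and> eval2 g x y = 0"
  shows "card Z \<le> (q + 1) * d"
proof (rule ccontr)
  assume "\<not> card Z \<le> (q + 1) * d"
  hence big: "(q + 1) * d < card Z" by simp
  \<comment> \<open>Any \<open>M\<close> large enough does: the powers \<open>y\<^sup>j\<close> with \<open>j < card Z\<close> and the curve itself must have weight at most \<open>W\<close>.\<close>
  define M where "M = card Z + 2 * q"
  define w where "w = (q - 1) * M"
  define W where "W = w + q * d"
  define B where "B = (\<lambda>W. {(i, j). q * i + (q - 1) * j \<le> (W::nat)})"
  define I where "I = (\<lambda>W. {(i, j). i < q \<and> q * i + (q - 1) * j \<le> (W::nat)})"
  have finB: "finite (B W)" for W unfolding B_def by (rule finite_weight[OF q2])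
  have finI: "finite (I W)" for W by (rule finite_subset[OF _ finB[of W]]) (auto simp: I_def B_def)
  have Wq: "q * q \<le> W"
  proof -
    have "1 * (2 * q) \<le> (q - 1) * (2 * q)" using q2 by (intro mult_right_mono) auto
    have "(q - 1) * (2 * q) = 2 * (q * q) - 2 * q" by (simp add: algebra_simps diff_mult_distrib)
    moreover have "2 * q \<le> q * q" using q2 by simp
    ultimately have "q * q \<le> (q - 1) * (2 * q)" by linarith
    also have "\<dots> \<le> w" unfolding w_def M_def by (intro mult_left_mono) auto
    finally show ?thesis by (simp add: W_def)
  qed
  \<comment> \<open>A monomial is reduced or divisible by \<open>x\<^sup>q\<close>, and \<open>x\<^sup>q\<close> has weight \<open>q\<^sup>2\<close>.\<close>
  have cardB: "card (B W) = card (B (W - q * q)) + card (I W)"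
  proof -
    have "B W = (\<lambda>(i, j). (i + q, j)) ` B (W - q * q) \<union> I W"
    proof (intro equalityI subsetI)
      fix z assume "z \<in> B W"
      then obtain i j where z: "z = (i, j)" "q * i + (q - 1) * j \<le> W" by (auto simp: B_def)
      show "z \<in> (\<lambda>(i, j). (i + q, j)) ` B (W - q * q) \<union> I W"
      proof (cases "i < q")
        case False
        then obtain i' where i': "i = i' + q" by (metis add.commute le_Suc_ex not_le)
        thus ?thesis using z by (auto simp: B_def image_iff algebra_simps)
      qed (use z in \<open>auto simp: I_def\<close>)
    qed (use Wq in \<open>auto simp: B_def I_def algebra_simps\<close>)
    moreover have "(\<lambda>(i, j). (i + q, j)) ` B (W - q * q) \<inter> I W = {}" by (auto simp: I_def)
    moreover have "inj_on (\<lambda>(i, j). (i + q, j)) (B (W - q * q))" by (auto simp: inj_on_def)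
    ultimately show ?thesis using finB finI by (simp add: card_Un_disjoint card_image)
  qed
  define S where "S = B (W - q * q) <+> (I w <+> {..<card Z})"
  have cardS: "card S = card (B (W - q * q)) + (card (I w) + card Z)"
    unfolding S_def using finB finI by (simp add: card_Plus)
  have "card (I W) = card (I w) + (q + 1) * d"
    unfolding I_def W_def w_def by (rule card_reduced_monomials[OF d]) (simp add: M_def)
  hence "card (B W) < card S" using cardB cardS big by simp
  define P :: "(nat \<times> nat) + ((nat \<times> nat) + nat) \<Rightarrow> 'k poly poly" where
    "P = case_sum (\<lambda>ij. Kpoly * mon ij) (case_sum (\<lambda>ij. g * mon ij) (\<lambda>j. mon (0, j)))"
  define f where "f = (\<lambda>s (i, j). coeff (coeff (P s) i) j)"
  have "finite S" unfolding S_def using finB finI by simp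
  obtain \<alpha> where \<alpha>0: "\<exists>s\<in>S. \<alpha> s \<noteq> 0" and \<alpha>: "\<forall>b\<in>B W. (\<Sum>s\<in>S. \<alpha> s * f s b) = 0"
    using dependent_family[OF finB \<open>finite S\<close> \<open>card (B W) < card S\<close>, of f] by blast
  have wK: "weight_le q (q * q) Kpoly"
    unfolding weight_le_def coeff_Kpoly using q2
    by (auto simp: algebra_simps coeff_pCons split: nat.splits intro: le_trans[OF diff_le_self])
  have wg: "weight_le q (q * d) g"
    unfolding weight_le_def
  proof (intro allI impI)
    fix i j assume "coeff (coeff g i) j \<noteq> 0"
    hence "i + j \<le> d" using deg unfolding total_degree_le_def by blast
    hence "q * (i + j) \<le> q * d" by simp
    thus "q * i + (q - 1) * j \<le> q * d" by (simp add: algebra_simps diff_mult_distrib)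
  qed
  have wP: "weight_le q W (P s)" if "s \<in> S" for s
  proof -
    have mono: "weight_le q W h" if "weight_le q W' h" "W' \<le> W" for h :: "'k poly poly" and W'
      using that unfolding weight_le_def by (meson le_trans)
    consider i j where "s = Inl (i, j)" "(i, j) \<in> B (W - q * q)"
      | i j where "s = Inr (Inl (i, j))" "(i, j) \<in> I w"
      | j where "s = Inr (Inr j)" "j < card Z" using \<open>s \<in> S\<close> unfolding S_def by auto
    thus ?thesis
    proof cases
      case 1
      show ?thesis unfolding 1 P_def sum.case
        by (rule mono[OF weight_le_mult_mon[OF wK]]) (use 1 Wq in \<open>auto simp: B_def\<close>)
    next
      case 2
      show ?thesis unfolding 2 P_def sum.case
        by (rule mono[OF weight_le_mult_mon[OF wg]]) (use 2 in \<open>auto simp: I_def W_def\<close>)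
    next
      case 3
      have "(q - 1) * j \<le> w" unfolding w_def by (rule mult_left_mono) (use 3 in \<open>auto simp: M_def\<close>)
      thus ?thesis unfolding 3 P_def sum.case by (auto simp: weight_le_def coeff_mon W_def)
    qed
  qed
  define U where "U = (\<Sum>ij\<in>B (W - q * q). Polynomial.smult [:\<alpha> (Inl ij):] (mon ij) :: 'k poly poly)"
  define V where "V = (\<Sum>ij\<in>I w. Polynomial.smult [:\<alpha> (Inr (Inl ij)):] (mon ij) :: 'k poly poly)"
  define R where "R = (\<Sum>j<card Z. monom (\<alpha> (Inr (Inr j))) j)"
  have total: "Kpoly * U + g * V + [:R:] = 0"
  proof -
    have R: "[:R:] = (\<Sum>j<card Z. Polynomial.smult [:\<alpha> (Inr (Inr j)):] (mon (0, j)))"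
    proof -
      have "(\<Sum>j\<in>J. [:r j:]) = [:\<Sum>j\<in>J. r j:]" for J and r :: "nat \<Rightarrow> 'k poly"
        by (induction J rule: infinite_finite_induct) auto
      moreover have "Polynomial.smult [:e:] (mon (0, j)) = [:monom e j:]" for e :: 'k and j
        by (simp add: mon_def monom_0 smult_monom)
      ultimately show ?thesis unfolding R_def by simp
    qed
    have "Kpoly * U + g * V + [:R:] = (\<Sum>s\<in>S. Polynomial.smult [:\<alpha> s:] (P s))"
      unfolding S_def U_def V_def R using finB finI
      by (simp add: sum.Plus P_def sum_distrib_left)
    also have "\<dots> = 0"
    proof (rule poly_eqI, rule poly_eqI)
      fix i j
      have "coeff (coeff (\<Sum>s\<in>S. Polynomial.smult [:\<alpha> s:] (P s)) i) j = (\<Sum>s\<in>S. \<alpha> s * f s (i, j))"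
        by (simp add: coeff_sum f_def)
      also have "\<dots> = 0"
      proof (cases "(i, j) \<in> B W")
        case True thus ?thesis using \<alpha> by blast
      next
        case False
        have "f s (i, j) = 0" if "s \<in> S" for s
          using wP[OF that] False unfolding f_def weight_le_def B_def by auto
        thus ?thesis by simp
      qed
      finally show "coeff (coeff (\<Sum>s\<in>S. Polynomial.smult [:\<alpha> s:] (P s)) i) j = coeff (coeff 0 i) j" by simp
    qed
    finally show ?thesis .
  qed
  have "R = 0"
  proof (rule ccontr)
    assume "R \<noteq> 0"
    have "snd ` Z \<subseteq> {y. poly R y = 0}"
    proof
      fix y assume "y \<in> snd ` Z"
      then obtain x where "(x, y) \<in> Z" by force
      hence "eval2 Kpoly x y = 0" "eval2 g x y = 0" using zero by auto
      moreover have "eval2 (Kpoly * U + g * V + [:R:]) x y = 0" by (simp add: total)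
      ultimately show "y \<in> {y. poly R y = 0}" by simp
    qed
    hence "card (snd ` Z) \<le> card {y. poly R y = 0}" using poly_roots_finite[OF \<open>R \<noteq> 0\<close>] by (rule card_mono[rotated])
    also have "\<dots> \<le> degree R" by (rule card_poly_roots_bound[OF \<open>R \<noteq> 0\<close>])
    finally have "card Z \<le> degree R" using inj by (simp add: card_image)
    moreover have "degree R < card Z" unfolding R_def
      by (rule degree_sum_less) (use big in \<open>auto intro: le_less_trans[OF degree_monom_le]\<close>)
    ultimately show False by simp
  qed
  have "degree g \<le> d"
    using deg unfolding total_degree_le_def
    by (metis degree_le le_add1 le_trans leading_coeff_0_iff not_le poly_eqI coeff_0)
  hence "\<not> Kpoly dvd g" using Kpoly_not_dvd_reduced g0 d by simp
  moreover have "g * V = Kpoly * (- U)" using total \<open>R = 0\<close> by (simp add: eq_neg_iff_add_eq_0 add.commute)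
  hence "Kpoly dvd g * V" by simp
  ultimately have "Kpoly dvd V" using prime_Kpoly prime_elem_dvd_mult_iff by blast
  moreover have "degree V < q" unfolding V_def
    by (rule degree_sum_less)
       (use q2 in \<open>auto simp: I_def mon_def intro!: le_less_trans[OF degree_smult_le] le_less_trans[OF degree_monom_le]\<close>)
  ultimately have "V = 0" using Kpoly_not_dvd_reduced by blast
  hence "U = 0" using total \<open>R = 0\<close> Kpoly_nz by simp
  have coeff_comb: "coeff (coeff (\<Sum>ij\<in>J. Polynomial.smult [:\<gamma> ij:] (mon ij)) i) j = \<gamma> (i, j)"
    if "finite J" "(i, j) \<in> J" for J i j and \<gamma> :: "nat \<times> nat \<Rightarrow> 'k"
  proof -
    have "coeff (coeff (\<Sum>ij\<in>J. Polynomial.smult [:\<gamma> ij:] (mon ij)) i) j = (\<Sum>ij\<in>J. \<gamma> ij * coeff (coeff (mon ij) i) j)"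
      by (simp add: coeff_sum)
    also have "\<dots> = (\<Sum>ij\<in>J. if ij = (i, j) then \<gamma> ij else 0)"
    proof (rule sum.cong)
      fix ij :: "nat \<times> nat"
      show "\<gamma> ij * coeff (coeff (mon ij) i) j = (if ij = (i, j) then \<gamma> ij else 0)"
        by (cases ij) (simp add: coeff_mon)
    qed simp
    finally show ?thesis using that by (simp add: sum.delta)
  qed
  have "\<alpha> s = 0" if "s \<in> S" for s
  proof -
    consider i j where "s = Inl (i, j)" "(i, j) \<in> B (W - q * q)"
      | i j where "s = Inr (Inl (i, j))" "(i, j) \<in> I w"
      | j where "s = Inr (Inr j)" "j < card Z" using \<open>s \<in> S\<close> unfolding S_def by auto
    thus ?thesis
    proof cases
      case 1
      thus ?thesis using coeff_comb[OF finB 1(2), of "\<lambda>ij. \<alpha> (Inl ij)"] \<open>U = 0\<close> by (simp add: U_def)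
    next
      case 2
      thus ?thesis using coeff_comb[OF finI 2(2), of "\<lambda>ij. \<alpha> (Inr (Inl ij))"] \<open>V = 0\<close> by (simp add: V_def)
    next
      case 3
      have "coeff R j = (\<Sum>j'<card Z. if j' = j then \<alpha> (Inr (Inr j')) else 0)"
        unfolding R_def coeff_sum by (rule sum.cong) auto
      thus ?thesis using 3 \<open>R = 0\<close> by (simp add: sum.delta)
    qed
  qed
  thus False using \<alpha>0 by blast
qed

end

section \<open>Local parameters\<close>

definition rotate_coords :: "'k::zero^3 \<Rightarrow> 'k^3" where
  "rotate_coords v = vector [v$2, v$3, v$1]"

lemma rotate_coords_simps [simp]:
  "rotate_coords v $ 1 = v $ 2" "rotate_coords v $ 2 = v $ 3" "rotate_coords v $ 3 = v $ 1"
  by (simp_all add: rotate_coords_def vector_3)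

lemma vec3_eq_iff: "v = w \<longleftrightarrow> v $ 1 = w $ 1 \<and> v $ 2 = w $ 2 \<and> v $ 3 = (w $ 3 :: 'a)" for v w :: "'a^3"
  by (simp add: vec_eq_iff forall_3)

lemma rotate_coords_thrice: "rotate_coords (rotate_coords (rotate_coords v)) = v"
  by (simp add: vec3_eq_iff)

lemma is_form_rotate:
  assumes "is_form UNIV d A"
  shows "is_form UNIV d (\<lambda>v::'k::field^3. A (rotate_coords v))"
proof (rule is_form_compose[OF assms])
  fix k :: 3
  show "is_form UNIV 1 (\<lambda>v::'k^3. rotate_coords v $ k)"
    using exhaust_3[of k] is_form_coord by auto
qed

lemma Kform_rotate: "Kform q a b c (rotate_coords v) = Kform q c a b v"
  by (simp add: Kform_def algebra_simps)

lemma is_form_Kform: "is_form UNIV (q + 1) (Kform q a b c)"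
proof -
  have "is_form UNIV (q + 1) (\<lambda>v. a * v$1^1 * v$2^q * v$3^0 + b * v$1^0 * v$2^1 * v$3^q + c * v$1^q * v$2^0 * v$3^1)"
    by (intro is_form_add is_form_monomial) auto
  thus ?thesis unfolding Kform_def[abs_def] by (simp add: mult_ac)
qed

lemma affine_normalize:
  fixes v :: "'k::field^3"
  assumes "v $ 3 \<noteq> 0"
  shows "v = v$3 *s vector [v$1 / v$3, v$2 / v$3, 1]"
  using assms by (simp add: vec3_eq_iff vector_3)

text \<open>
The quotient \<open>l/m\<close> is a uniformizer at \<open>p\<close>, expressed by forms.  The first long clause says that every form vanishing at \<open>p\<close>
is a multiple of it in the local ring; the second that no form, unless it vanishes on the whole curve, is divisible by all
powers of it.
\<close>

definition local_param :: "('k::field^3 \<Rightarrow> 'k) \<Rightarrow> 'k^3 \<Rightarrow> ('k^3 \<Rightarrow> 'k) \<Rightarrow> ('k^3 \<Rightarrow> 'k) \<Rightarrow> bool" where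
  "local_param F p l m \<longleftrightarrow> is_form UNIV 1 l \<and> is_form UNIV 1 m \<and> m p \<noteq> 0 \<and> l p = 0 \<and> (\<exists>v. F v = 0 \<and> l v \<noteq> 0) \<and>
    (\<forall>d A. is_form UNIV d A \<and> A p = 0 \<longrightarrow>
      (\<exists>e C D. is_form UNIV e D \<and> is_form UNIV (d + e) C \<and> D p \<noteq> 0 \<and> (\<forall>v. F v = 0 \<longrightarrow> A v * D v * m v = l v * C v))) \<and>
    (\<forall>d A. is_form UNIV d A \<and> (\<exists>v. F v = 0 \<and> A v \<noteq> 0) \<longrightarrow>
      (\<exists>N. \<forall>e C D. is_form UNIV e D \<and> is_form UNIV (d + e) C \<and> D p \<noteq> 0 \<longrightarrow>
        \<not> (\<forall>v. F v = 0 \<longrightarrow> A v * D v * m v ^ N = l v ^ N * C v)))"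

lemma local_param_forms:
  assumes "local_param F p l m"
  shows "is_form UNIV 1 l" "is_form UNIV 1 m" "m p \<noteq> 0" "l p = 0" "\<exists>v. F v = 0 \<and> l v \<noteq> 0"
  using assms by (simp_all add: local_param_def)

lemma local_param_divide:
  assumes "local_param F p l m" "is_form UNIV d A" "A p = 0"
  shows "\<exists>e C D. is_form UNIV e D \<and> is_form UNIV (d + e) C \<and> D p \<noteq> 0 \<and> (\<forall>v. F v = 0 \<longrightarrow> A v * D v * m v = l v * C v)"
  using assms by (simp add: local_param_def)

lemma local_param_order_bound:
  assumes "local_param F p l m" "is_form UNIV d A" "\<exists>v. F v = 0 \<and> A v \<noteq> 0"
  shows "\<exists>N. \<forall>e C D. is_form UNIV e D \<and> is_form UNIV (d + e) C \<and> D p \<noteq> 0 \<longrightarrow>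
        \<not> (\<forall>v. F v = 0 \<longrightarrow> A v * D v * m v ^ N = l v ^ N * C v)"
  using assms by (simp add: local_param_def)

lemma local_param_scale:
  assumes "local_param F p l m" "s \<noteq> 0"
  shows "local_param F (s *s p) l m"
proof -
  have nz: "D (s *s p) \<noteq> 0 \<longleftrightarrow> D p \<noteq> 0" if "is_form UNIV d D" for d D
    using form_homogeneous[OF that, of s p] assms(2) by simp
  have z: "D (s *s p) = 0 \<longleftrightarrow> D p = 0" if "is_form UNIV d D" for d D
    using nz[OF that] by blast
  from assms(1) have l: "is_form UNIV 1 l" "is_form UNIV 1 m" by (simp_all add: local_param_def)
  show ?thesis
    unfolding local_param_def nz[OF l(2)] z[OF l(1)]
  proof (intro conjI allI impI)
    fix d A assume A: "is_form UNIV d A \<and> A (s *s p) = 0"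
    hence "A p = 0" using z by blast
    then obtain e C D where "is_form UNIV e D" "is_form UNIV (d + e) C" "D p \<noteq> 0"
        "\<forall>v. F v = 0 \<longrightarrow> A v * D v * m v = l v * C v" using local_param_divide[OF assms(1)] A by blast
    thus "\<exists>e C D. is_form UNIV e D \<and> is_form UNIV (d + e) C \<and> D (s *s p) \<noteq> 0 \<and>
        (\<forall>v. F v = 0 \<longrightarrow> A v * D v * m v = l v * C v)" using nz by blast
  next
    fix d A assume "is_form UNIV d A \<and> (\<exists>v. F v = 0 \<and> A v \<noteq> 0)"
    then obtain N where "\<forall>e C D. is_form UNIV e D \<and> is_form UNIV (d + e) C \<and> D p \<noteq> 0 \<longrightarrow>
        \<not> (\<forall>v. F v = 0 \<longrightarrow> A v * D v * m v ^ N = l v ^ N * C v)" using local_param_order_bound[OF assms(1)] by blast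
    thus "\<exists>N. \<forall>e C D. is_form UNIV e D \<and> is_form UNIV (d + e) C \<and> D (s *s p) \<noteq> 0 \<longrightarrow>
        \<not> (\<forall>v. F v = 0 \<longrightarrow> A v * D v * m v ^ N = l v ^ N * C v)" using nz by blast
  qed (use assms(1) in \<open>auto simp: local_param_def\<close>)
qed

lemma local_param_rotate:
  assumes lp: "local_param F p l m" and F: "\<And>v. F v = G (rotate_coords v)"
  shows "local_param G (rotate_coords p) (\<lambda>v. l (rotate_coords (rotate_coords v))) (\<lambda>v. m (rotate_coords (rotate_coords v)))"
proof -
  let ?R = rotate_coords
  have G: "G v = F (?R (?R v))" for v by (simp add: F rotate_coords_thrice)
  show ?thesis
    unfolding local_param_def
  proof (intro conjI allI impI)
    show "is_form UNIV 1 (\<lambda>v. l (?R (?R v)))" "is_form UNIV 1 (\<lambda>v. m (?R (?R v)))"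
      using lp by (simp_all add: local_param_def is_form_rotate[OF is_form_rotate])
    show "m (?R (?R (?R p))) \<noteq> 0" "l (?R (?R (?R p))) = 0"
      using lp by (simp_all add: local_param_def rotate_coords_thrice)
    obtain v where "F v = 0" "l v \<noteq> 0" using lp unfolding local_param_def by blast
    thus "\<exists>v. G v = 0 \<and> l (?R (?R v)) \<noteq> 0"
      by (intro exI[of _ "?R v"]) (simp add: F rotate_coords_thrice)
  next
    fix d A assume A: "is_form UNIV d A \<and> A (?R p) = 0"
    hence "is_form UNIV d (\<lambda>v. A (?R v))" by (simp add: is_form_rotate)
    then obtain e C D where *: "is_form UNIV e D" "is_form UNIV (d + e) C" "D p \<noteq> 0"
        "\<And>v. F v = 0 \<Longrightarrow> A (?R v) * D v * m v = l v * C v" using local_param_divide[OF lp, of d "\<lambda>v. A (?R v)"] A by blast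
    have "A v * D (?R (?R v)) * m (?R (?R v)) = l (?R (?R v)) * C (?R (?R v))" if "G v = 0" for v
      using *(4)[of "?R (?R v)"] that by (simp add: G rotate_coords_thrice)
    with * show "\<exists>e C D. is_form UNIV e D \<and> is_form UNIV (d + e) C \<and> D (?R p) \<noteq> 0 \<and>
        (\<forall>v. G v = 0 \<longrightarrow> A v * D v * m (?R (?R v)) = l (?R (?R v)) * C v)"
      by (intro exI[of _ e] exI[of _ "\<lambda>v. C (?R (?R v))"] exI[of _ "\<lambda>v. D (?R (?R v))"])
         (auto simp: is_form_rotate[OF is_form_rotate] rotate_coords_thrice)
  next
    fix d A assume A: "is_form UNIV d A \<and> (\<exists>v. G v = 0 \<and> A v \<noteq> 0)"
    then obtain v where v: "G v = 0" "A v \<noteq> 0" by blast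
    have "is_form UNIV d (\<lambda>v. A (?R v))" using A by (simp add: is_form_rotate)
    moreover have "\<exists>v. F v = 0 \<and> A (?R v) \<noteq> 0"
      using v by (intro exI[of _ "?R (?R v)"]) (simp add: G rotate_coords_thrice)
    ultimately obtain N where N: "\<And>e C D. is_form UNIV e D \<Longrightarrow> is_form UNIV (d + e) C \<Longrightarrow> D p \<noteq> 0 \<Longrightarrow>
        \<not> (\<forall>v. F v = 0 \<longrightarrow> A (?R v) * D v * m v ^ N = l v ^ N * C v)"
      using local_param_order_bound[OF lp, of d "\<lambda>v. A (?R v)"] by blast
    show "\<exists>N. \<forall>e C D. is_form UNIV e D \<and> is_form UNIV (d + e) C \<and> D (?R p) \<noteq> 0 \<longrightarrow>
        \<not> (\<forall>v. G v = 0 \<longrightarrow> A v * D v * m (?R (?R v)) ^ N = l (?R (?R v)) ^ N * C v)"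
    proof (intro exI[of _ N] allI impI notI)
      fix e C D assume CD: "is_form UNIV e D \<and> is_form UNIV (d + e) C \<and> D (?R p) \<noteq> 0"
        and eq: "\<forall>v. G v = 0 \<longrightarrow> A v * D v * m (?R (?R v)) ^ N = l (?R (?R v)) ^ N * C v"
      have "\<forall>v. F v = 0 \<longrightarrow> A (?R v) * D (?R v) * m v ^ N = l v ^ N * C (?R v)"
        using eq by (metis F rotate_coords_thrice)
      with N[of e "\<lambda>v. D (?R v)" "\<lambda>v. C (?R v)"] CD is_form_rotate show False by blast
    qed
  qed
qed

text \<open>
The homogeneous version of the statement that \<open>x - x0\<close> and \<open>y - y0\<close> generate the maximal ideal of the chart; the factor
\<open>v$3\<close> makes the degrees match.
\<close>

lemma form_point_ideal:
  fixes x0 y0 :: "'k::field"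
  assumes "is_form UNIV d A" "A (vector [x0, y0, 1]) = 0"
  shows "\<exists>A1 A2. is_form UNIV d A1 \<and> is_form UNIV d A2 \<and>
    (\<forall>v. v$3 * A v = (v$1 - x0 * v$3) * A1 v + (v$2 - y0 * v$3) * A2 v)"
proof -
  have l: "is_form UNIV 1 (\<lambda>v::'k^3. v$i - e * v$3)" for i e
    by (intro is_form_diff is_form_scale is_form_coord)
  have "\<exists>\<kappa> A1 A2. is_form UNIV d A1 \<and> is_form UNIV d A2 \<and>
    (\<forall>v. v$3 * A v = (v$1 - x0 * v$3) * A1 v + (v$2 - y0 * v$3) * A2 v + \<kappa> * v$3 ^ (d + 1))"
    using assms(1)
  proof (induction rule: form_induct)
    case (const c)
    show ?case by (rule exI[of _ c], rule exI[of _ "\<lambda>_. 0"], rule exI[of _ "\<lambda>_. 0"]) (simp add: is_form_const)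
  next
    case (coord d A k)
    from coord(2) obtain \<kappa> A1 A2 where A1: "is_form UNIV d A1" and A2: "is_form UNIV d A2"
      and eq: "\<And>v. v$3 * A v = (v$1 - x0 * v$3) * A1 v + (v$2 - y0 * v$3) * A2 v + \<kappa> * v$3 ^ (d + 1)" by blast
    have z: "is_form UNIV (Suc d) (\<lambda>v::'k^3. \<kappa> * v$3 ^ Suc d)"
      using is_form_monomial[of 0 0 "Suc d" "Suc d" \<kappa>] by (simp add: mult_ac)
    have step: "v$3 * (v$k * A v) = v$k * ((v$1 - x0 * v$3) * A1 v + (v$2 - y0 * v$3) * A2 v + \<kappa> * v$3 ^ (d + 1))" for v
      unfolding eq[symmetric] by (simp only: mult_ac)
    note z = z[unfolded power_Suc]
    consider "k = 1" | "k = 2" | "k = 3" using exhaust_3[of k] by blast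
    thus ?case
    proof cases
      case 1
      have "v$3 * (v$1 * A v) = (v$1 - x0 * v$3) * (v$1 * A1 v + \<kappa> * (v$3 * v$3 ^ d))
          + (v$2 - y0 * v$3) * (v$1 * A2 v) + (\<kappa> * x0) * v$3 ^ (Suc d + 1)" for v
        unfolding step[unfolded 1] by (simp add: algebra_simps)
      moreover have "is_form UNIV (Suc d) (\<lambda>v. v$1 * A1 v + \<kappa> * (v$3 * v$3 ^ d))" "is_form UNIV (Suc d) (\<lambda>v. v$1 * A2 v)"
        by (intro is_form_add is_form_coord_mult A1 A2 z)+
      ultimately show ?thesis unfolding 1 by blast
    next
      case 2
      have "v$3 * (v$2 * A v) = (v$1 - x0 * v$3) * (v$2 * A1 v)
          + (v$2 - y0 * v$3) * (v$2 * A2 v + \<kappa> * (v$3 * v$3 ^ d)) + (\<kappa> * y0) * v$3 ^ (Suc d + 1)" for v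
        unfolding step[unfolded 2] by (simp add: algebra_simps)
      moreover have "is_form UNIV (Suc d) (\<lambda>v. v$2 * A1 v)" "is_form UNIV (Suc d) (\<lambda>v. v$2 * A2 v + \<kappa> * (v$3 * v$3 ^ d))"
        by (intro is_form_add is_form_coord_mult A1 A2 z)+
      ultimately show ?thesis unfolding 2 by blast
    next
      case 3
      have "v$3 * (v$3 * A v) = (v$1 - x0 * v$3) * (v$3 * A1 v)
          + (v$2 - y0 * v$3) * (v$3 * A2 v) + \<kappa> * v$3 ^ (Suc d + 1)" for v
        unfolding step[unfolded 3] by (simp add: algebra_simps)
      moreover have "is_form UNIV (Suc d) (\<lambda>v. v$3 * A1 v)" "is_form UNIV (Suc d) (\<lambda>v. v$3 * A2 v)"
        by (intro is_form_coord_mult A1 A2)+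
      ultimately show ?thesis unfolding 3 by blast
    qed
  next
    case (add d A B)
    from add(3) obtain \<kappa> A1 A2 where A: "is_form UNIV d A1" "is_form UNIV d A2"
      "\<And>v. v$3 * A v = (v$1 - x0 * v$3) * A1 v + (v$2 - y0 * v$3) * A2 v + \<kappa> * v$3 ^ (d + 1)" by blast
    from add(4) obtain \<mu> B1 B2 where B: "is_form UNIV d B1" "is_form UNIV d B2"
      "\<And>v. v$3 * B v = (v$1 - x0 * v$3) * B1 v + (v$2 - y0 * v$3) * B2 v + \<mu> * v$3 ^ (d + 1)" by blast
    have "v$3 * (A v + B v) = (v$1 - x0 * v$3) * (A1 v + B1 v) + (v$2 - y0 * v$3) * (A2 v + B2 v) + (\<kappa> + \<mu>) * v$3 ^ (d + 1)" for v
      unfolding distrib_left[of "v$3"] A(3) B(3) by (simp add: algebra_simps)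
    thus ?case using is_form_add A B by blast
  qed
  then obtain \<kappa> A1 A2 where *: "is_form UNIV d A1" "is_form UNIV d A2"
    "\<And>v. v$3 * A v = (v$1 - x0 * v$3) * A1 v + (v$2 - y0 * v$3) * A2 v + \<kappa> * v$3 ^ (d + 1)" by blast
  have "\<kappa> = 0" using *(3)[of "vector [x0, y0, 1]"] assms(2) by (simp add: vector_3)
  thus ?thesis using * by auto
qed

context klein_curve
begin

abbreviation "F \<equiv> Kform q a b c"

lemma Kform_zero_scale: "F (s *s v) = s ^ (q + 1) * F v"
  by (rule form_homogeneous[OF is_form_Kform])

lemma q_pos: "q > 0" using q2 by simp

lemma frob_diff: "(x - y)^q = x^q - y^q" for x y :: 'k
  using frob[of "x - y" y] by (simp add: eq_diff_eq)

lemma rotated: "klein_curve q c a b"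
  using q2 q0 frob a0 b0 c0 by unfold_locales

lemma vanish_chart_iff:
  assumes A: "is_form UNIV d A" and g: "\<And>x y. eval2 g x y = A (vector [x, y, 1])"
  shows "(\<forall>v. F v = 0 \<and> v$3 \<noteq> 0 \<longrightarrow> A v = 0) \<longleftrightarrow> Kpoly dvd g"
proof
  assume "\<forall>v. F v = 0 \<and> v$3 \<noteq> 0 \<longrightarrow> A v = 0"
  thus "Kpoly dvd g" unfolding Kpoly_dvd_iff g eval2_Kpoly_Kform by (auto simp: vector_3)
next
  assume dvd: "Kpoly dvd g"
  show "\<forall>v. F v = 0 \<and> v$3 \<noteq> 0 \<longrightarrow> A v = 0"
  proof (intro allI impI)
    fix v :: "'k^3" assume v: "F v = 0 \<and> v$3 \<noteq> 0"
    define w :: "'k^3" where "w = vector [v$1 / v$3, v$2 / v$3, 1]"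
    have vw: "v = v$3 *s w" unfolding w_def using v by (intro affine_normalize) simp
    have "F w = 0" using v Kform_zero_scale[of "v$3" w] vw by simp
    hence "A w = 0" using dvd unfolding Kpoly_dvd_iff g eval2_Kpoly_Kform w_def by blast
    thus "A v = 0" using form_homogeneous[OF A, of "v$3" w] vw by simp
  qed
qed

text \<open>
A form that vanishes on the points of one chart, multiplied by a coordinate, vanishes on the points of the next chart;
the coordinate can be cancelled because the curve is irreducible.
\<close>

lemma vanish_change_chart:
  assumes A: "is_form UNIV d A" and van: "\<And>v. F v = 0 \<Longrightarrow> v$3 \<noteq> 0 \<Longrightarrow> A v = 0"
    and v: "F v = 0" "v$2 \<noteq> 0"
  shows "A v = 0"
proof -
  interpret R: klein_curve q c a b by (rule rotated)
  define A' where "A' = (\<lambda>v. A (rotate_coords v))"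
  have A': "is_form UNIV d A'" unfolding A'_def by (rule is_form_rotate[OF A])
  obtain g where g: "\<And>x y. eval2 g x y = A' (vector [x, y, 1])" and "total_degree_le d g"
    using form_dehomogenize[OF A'] by blast
  define T :: "'k poly poly" where "T = [:0, 1:]"
  have "R.Kpoly dvd T * g"
  proof (subst R.vanish_chart_iff[symmetric, of "Suc d" "\<lambda>v. v$1 * A' v"])
    show "is_form UNIV (Suc d) (\<lambda>v. v$1 * A' v)" by (rule is_form_coord_mult[OF A'])
    show "eval2 (T * g) x y = (vector [x, y, 1] :: 'k^3) $ 1 * A' (vector [x, y, 1])" for x y
      by (simp add: T_def g vector_3)
    show "\<forall>v. R.F v = 0 \<and> v$3 \<noteq> 0 \<longrightarrow> v$1 * A' v = 0"
      using van[of "rotate_coords _"] by (auto simp: A'_def Kform_rotate)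
  qed
  moreover have "\<not> R.Kpoly dvd T"
    by (rule R.Kpoly_not_dvd_reduced) (use q2 in \<open>auto simp: T_def\<close>)
  ultimately have "R.Kpoly dvd g" using R.prime_Kpoly by (simp add: prime_elem_dvd_mult_iff)
  hence "\<forall>v. R.F v = 0 \<and> v$3 \<noteq> 0 \<longrightarrow> A' v = 0" using R.vanish_chart_iff[OF A' g] by blast
  moreover have "R.F (rotate_coords (rotate_coords v)) = 0"
    using v(1) Kform_rotate[of q a b c "rotate_coords (rotate_coords v)"] by (simp add: rotate_coords_thrice)
  ultimately show ?thesis using v(2) by (auto simp: A'_def rotate_coords_thrice dest: spec[of _ "rotate_coords (rotate_coords v)"])
qed

lemma vanish_affine_imp:
  assumes A: "is_form UNIV d A" and van: "\<And>v. F v = 0 \<Longrightarrow> v$3 \<noteq> 0 \<Longrightarrow> A v = 0" and v: "F v = 0"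
  shows "A v = 0"
proof -
  interpret R: klein_curve q c a b by (rule rotated)
  consider "v$3 \<noteq> 0" | "v$2 \<noteq> 0" | "v$1 \<noteq> 0" | "v = 0" by (auto simp: vec3_eq_iff)
  thus ?thesis
  proof cases
    case 2
    show ?thesis by (rule vanish_change_chart[OF A van v 2])
  next
    case 3
    have "A (rotate_coords (rotate_coords (rotate_coords v))) = 0"
    proof (rule R.vanish_change_chart[OF is_form_rotate[OF A]])
      fix w assume "R.F w = 0" "w$3 \<noteq> 0"
      thus "A (rotate_coords w) = 0"
        using vanish_change_chart[OF A van, of "rotate_coords w"] by (simp add: Kform_rotate)
    next
      show "R.F (rotate_coords (rotate_coords v)) = 0"
        using v Kform_rotate[of q a b c "rotate_coords (rotate_coords v)"] by (simp add: rotate_coords_thrice)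
      show "rotate_coords (rotate_coords v) $ 2 \<noteq> 0" using 3 by simp
    qed
    thus ?thesis by (simp add: rotate_coords_thrice)
  next
    case 4
    define w :: "'k^3" where "w = vector [0, 0, 1]"
    have "F w = 0" "w$3 \<noteq> 0" using q_pos by (simp_all add: w_def Kform_def vector_3 power_0_left)
    hence "A w = 0" by (rule van)
    thus ?thesis using form_homogeneous[OF A, of 0 w] 4 by simp
  qed (use van v in auto)
qed

lemma vanish_iff:
  assumes "is_form UNIV d A" "\<And>x y. eval2 g x y = A (vector [x, y, 1])"
  shows "(\<forall>v. F v = 0 \<longrightarrow> A v = 0) \<longleftrightarrow> Kpoly dvd g"
  using vanish_affine_imp[OF assms(1)] vanish_chart_iff[OF assms] by blast

text \<open>Irreducibility of the projective curve, inherited from that of its affine equation.\<close>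

lemma forms_mult_vanish:
  assumes A: "is_form UNIV d A" and B: "is_form UNIV e B" and van: "\<And>v. F v = 0 \<Longrightarrow> A v * B v = 0"
  shows "(\<forall>v. F v = 0 \<longrightarrow> A v = 0) \<or> (\<forall>v. F v = 0 \<longrightarrow> B v = 0)"
proof -
  obtain g where g: "\<And>x y. eval2 g x y = A (vector [x, y, 1])" and "total_degree_le d g"
    using form_dehomogenize[OF A] by blast
  obtain h where h: "\<And>x y. eval2 h x y = B (vector [x, y, 1])" and "total_degree_le e h"
    using form_dehomogenize[OF B] by blast
  have "Kpoly dvd g * h"
    using vanish_iff[OF is_form_mult[OF A B], of "g * h"] van by (simp add: g h)
  thus ?thesis using vanish_iff[OF A g] vanish_iff[OF B h] prime_Kpoly by (simp add: prime_elem_dvd_mult_iff)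
qed

text \<open>
Elimination replaces \<open>A\<close> by a polynomial \<open>r\<close> in \<open>y\<close> that is a multiple of it, and for polynomials in \<open>y\<close> the
order can be read off: by \<open>elim\<close>, \<open>r\<close> divides \<open>T\<^sup>k\<close> up to factors that are units at the point, so \<open>A\<close> cannot be divisible by
\<open>T\<^bsup>k+1\<^esup>\<close>.
\<close>

lemma order_bound:
  assumes l: "is_form UNIV 1 l" "\<And>x y. l (vector [x, y, 1]) = eval2 T x y"
    and T: "eval2 T x0 y0 = 0" "\<not> Kpoly dvd T" and p: "eval2 Kpoly x0 y0 = 0"
    and elim: "\<And>r. r \<noteq> 0 \<Longrightarrow> \<exists>k s E. eval2 s x0 y0 \<noteq> 0 \<and> Kpoly dvd E * [:r:] - T ^ k * s"
    and A: "is_form UNIV d A" "\<exists>v. F v = 0 \<and> A v \<noteq> 0"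
  shows "\<exists>N. \<forall>e C D. is_form UNIV e D \<and> is_form UNIV (d + e) C \<and> D (vector [x0, y0, 1]) \<noteq> 0 \<longrightarrow>
        \<not> (\<forall>v. F v = 0 \<longrightarrow> A v * D v * (v$3) ^ N = l v ^ N * C v)"
proof -
  obtain g where g: "\<And>x y. eval2 g x y = A (vector [x, y, 1])" and "total_degree_le d g"
    using form_dehomogenize[OF A(1)] by blast
  have "\<not> Kpoly dvd g" using vanish_iff[OF A(1) g] A(2) by blast
  then obtain r v where rv: "r \<noteq> 0" "Kpoly dvd [:r:] - v * g" by (rule eliminate)
  obtain k s E where s: "eval2 s x0 y0 \<noteq> 0" and sE: "Kpoly dvd E * [:r:] - T ^ k * s" using elim[OF rv(1)] by blast
  show ?thesis
  proof (intro exI[of _ "Suc k"] allI impI notI)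
    fix e C D
    assume CD: "is_form UNIV e D \<and> is_form UNIV (d + e) C \<and> D (vector [x0, y0, 1]) \<noteq> 0"
      and eq: "\<forall>v. F v = 0 \<longrightarrow> A v * D v * (v$3) ^ Suc k = l v ^ Suc k * C v"
    obtain D' where D': "\<And>x y. eval2 D' x y = D (vector [x, y, 1])" and "total_degree_le e D'"
    using form_dehomogenize[OF conjunct1[OF CD]] by blast
    obtain C' where C': "\<And>x y. eval2 C' x y = C (vector [x, y, 1])" and "total_degree_le (d + e) C'"
    using form_dehomogenize[OF conjunct1[OF conjunct2[OF CD]]] by blast
    have "Kpoly dvd T ^ k * (s * D' - E * v * T * C')"
      unfolding Kpoly_dvd_iff
    proof (intro allI impI)
      fix x y assume xy: "eval2 Kpoly x y = 0"
      have 1: "eval2 g x y * eval2 D' x y = eval2 T x y ^ Suc k * eval2 C' x y"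
        using eq[rule_format, of "vector [x, y, 1]"] xy by (simp add: eval2_Kpoly_Kform g D' C' l(2) vector_3)
      have 2: "poly r y = eval2 v x y * eval2 g x y" using rv(2) xy unfolding Kpoly_dvd_iff by simp
      have 3: "eval2 E x y * poly r y = eval2 T x y ^ k * eval2 s x y" using sE xy unfolding Kpoly_dvd_iff by (simp add: mult_ac)
      have "eval2 T x y ^ k * eval2 s x y * eval2 D' x y = eval2 E x y * eval2 v x y * (eval2 g x y * eval2 D' x y)"
        unfolding 3[symmetric] 2 by (simp add: mult_ac)
      thus "eval2 (T ^ k * (s * D' - E * v * T * C')) x y = 0"
        unfolding 1 by (simp add: algebra_simps)
    qed
    moreover have "\<not> Kpoly dvd T ^ k" using T(2) prime_Kpoly prime_elem_dvd_power by blast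
    ultimately have "Kpoly dvd s * D' - E * v * T * C'" using prime_Kpoly by (simp add: prime_elem_dvd_mult_iff)
    hence "eval2 s x0 y0 * D (vector [x0, y0, 1]) = 0" using p T(1) unfolding Kpoly_dvd_iff by (auto simp: D')
    thus False using s CD by simp
  qed
qed

lemma ex_off_line:
  assumes "is_form UNIV 1 l" "\<And>x y. l (vector [x, y, 1]) = eval2 T x y" "\<not> Kpoly dvd T"
  shows "\<exists>v. F v = 0 \<and> l v \<noteq> 0"
  using vanish_iff[OF assms(1), of T] assms(2,3) by auto

lemma factor_linear_power:
  fixes r :: "'k poly"
  assumes "r \<noteq> 0"
  shows "\<exists>k s. r = [:-y0, 1:] ^ k * s \<and> poly s y0 \<noteq> 0"
  using order_decomp[OF assms, of y0] by (auto simp: poly_eq_0_iff_dvd)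

text \<open>
Written in \<open>\<xi> = x - x0\<close> and \<open>\<eta> = y - y0\<close>, the equation of the curve is \<open>\<xi> E = \<eta> W\<close>, where \<open>E\<close> is a unit at the
point because its value there is \<open>a y0\<^sup>q\<close>.  So \<open>\<eta>\<close> alone generates the maximal ideal.
\<close>

lemma local_param_affine:
  assumes p: "F (vector [x0, y0, 1]) = 0" and y0: "y0 \<noteq> 0"
  shows "local_param F (vector [x0, y0, 1]) (\<lambda>v. v$2 - y0 * v$3) (\<lambda>v. v$3)"
proof -
  define T :: "'k poly poly" where "T = [:[:-y0, 1:]:]"
  define l where "l = (\<lambda>v::'k^3. v$2 - y0 * v$3)"
  have l: "is_form UNIV 1 l" unfolding l_def by (intro is_form_diff is_form_scale is_form_coord)
  have lT: "l (vector [x, y, 1]) = eval2 T x y" for x y by (simp add: l_def T_def vector_3)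
  have T: "\<not> Kpoly dvd T" unfolding T_def by (rule Kpoly_not_dvd_const) simp
  have T0: "eval2 T x0 y0 = 0" by (simp add: T_def)
  have p': "eval2 Kpoly x0 y0 = 0" using p by (simp add: eval2_Kpoly_Kform)
  have "\<exists>k s E. eval2 s x0 y0 \<noteq> 0 \<and> Kpoly dvd E * [:r:] - T ^ k * s" if "r \<noteq> 0" for r
  proof -
    obtain k s where "r = [:-y0, 1:] ^ k * s" "poly s y0 \<noteq> 0" using factor_linear_power[OF \<open>r \<noteq> 0\<close>] by blast
    moreover have "[:u:] ^ k * [:w:] = [:u ^ k * w:]" for u w :: "'k poly"
      by (simp add: poly_const_pow)
    ultimately show ?thesis by (intro exI[of _ k] exI[of _ "[:s:]"] exI[of _ 1]) (simp add: T_def)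
  qed
  note order = order_bound[OF l lT T0 T p' this]
  define E where "E = (\<lambda>v::'k^3. a * (v$2 - y0 * v$3)^q + a * y0^q * v$3^q + c * (v$3 * (v$1 - x0 * v$3)^(q-1)))"
  define W where "W = (\<lambda>v::'k^3. - (a * x0 * (v$3 * (v$2 - y0 * v$3)^(q-1)) + b * v$3^q))"
  have lin: "is_form UNIV 1 (\<lambda>v::'k^3. v$i - e * v$3)" for i e by (intro is_form_diff is_form_scale is_form_coord)
  have pw: "is_form UNIV n (\<lambda>v. f v ^ n)" if "is_form UNIV 1 f" for f :: "'k^3 \<Rightarrow> 'k" and n
    using is_form_power[OF that, of n] by simp
  have pw1: "is_form UNIV q (\<lambda>v::'k^3. v$3 * (v$i - e * v$3)^(q-1))" for i e
    by (rule is_form_mult'[OF is_form_coord pw[OF lin]]) (use q2 in simp)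
  have z: "is_form UNIV q (\<lambda>v::'k^3. e * v$3^q)" for e
    by (intro is_form_scale pw is_form_coord)
  have E: "is_form UNIV q E" unfolding E_def by (intro is_form_add is_form_scale pw lin pw1 z)
  have W: "is_form UNIV q W" unfolding W_def by (intro is_form_uminus is_form_add is_form_scale pw1 z)
  have key: "(v$1 - x0 * v$3) * E v = (v$2 - y0 * v$3) * W v" if "F v = 0" for v
  proof -
    define \<xi> where "\<xi> = v$1 - x0 * v$3"
    define \<eta> where "\<eta> = v$2 - y0 * v$3"
    have v: "v$1 = \<xi> + x0 * v$3" "v$2 = \<eta> + y0 * v$3" by (simp_all add: \<xi>_def \<eta>_def)
    have q1: "u * u^(q-1) = u^q" for u :: 'k using q_pos by (simp add: power_eq_if)
    have "F v = \<xi> * (a * \<eta>^q + a * y0^q * v$3^q) + c * v$3 * \<xi>^q + a * x0 * v$3 * \<eta>^q + b * \<eta> * v$3^q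
        + v$3 * v$3^q * F (vector [x0, y0, 1])"
      unfolding Kform_def vector_3 v frob power_mult_distrib by (simp add: algebra_simps)
    hence "0 = \<xi> * (a * \<eta>^q + a * y0^q * v$3^q) + c * v$3 * \<xi>^q + a * x0 * v$3 * \<eta>^q + b * \<eta> * v$3^q"
      using that p by simp
    thus ?thesis unfolding E_def W_def \<xi>_def[symmetric] \<eta>_def[symmetric] q1[of \<xi>, symmetric] q1[of \<eta>, symmetric]
      by (simp add: algebra_simps eq_neg_iff_add_eq_0)
  qed
  show ?thesis
    unfolding local_param_def l_def[symmetric]
  proof (intro conjI allI impI)
    show "is_form UNIV 1 l" "is_form UNIV 1 (\<lambda>v::'k^3. v$3)" by (rule l, rule is_form_coord)
    show "(vector [x0, y0, 1] :: 'k^3) $ 3 \<noteq> 0" "l (vector [x0, y0, 1]) = 0" by (simp_all add: l_def vector_3)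
    show "\<exists>v. F v = 0 \<and> l v \<noteq> 0" by (rule ex_off_line[OF l lT T])
  next
    fix d and A :: "'k^3 \<Rightarrow> 'k" assume A: "is_form UNIV d A \<and> A (vector [x0, y0, 1]) = 0"
    obtain A1 A2 where A12: "is_form UNIV d A1" "is_form UNIV d A2"
      "\<And>v. v$3 * A v = (v$1 - x0 * v$3) * A1 v + (v$2 - y0 * v$3) * A2 v"
      using form_point_ideal[of d A x0 y0] A by blast
    show "\<exists>e C D. is_form UNIV e D \<and> is_form UNIV (d + e) C \<and> D (vector [x0, y0, 1]) \<noteq> 0 \<and>
        (\<forall>v. F v = 0 \<longrightarrow> A v * D v * v$3 = l v * C v)"
    proof (rule exI[of _ q], rule exI[of _ "\<lambda>v. A1 v * W v + A2 v * E v"], rule exI[of _ E], intro conjI allI impI)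
      show "is_form UNIV q E" by (rule E)
      show "is_form UNIV (d + q) (\<lambda>v. A1 v * W v + A2 v * E v)"
        by (intro is_form_add is_form_mult A12 E W)
      show "E (vector [x0, y0, 1]) \<noteq> 0" using y0 a0 q2 by (simp add: E_def vector_3 power_0_left)
      fix v assume v: "F v = 0"
      have "A v * E v * v$3 = (v$3 * A v) * E v" by (simp add: mult_ac)
      also have "\<dots> = A1 v * ((v$1 - x0 * v$3) * E v) + l v * A2 v * E v"
        unfolding A12(3) l_def by (simp add: algebra_simps)
      also have "\<dots> = l v * (A1 v * W v + A2 v * E v)" unfolding key[OF v] l_def by (simp add: algebra_simps)
      finally show "A v * E v * v$3 = l v * (A1 v * W v + A2 v * E v)" .
    qed
  next
    fix d and A :: "'k^3 \<Rightarrow> 'k" assume "is_form UNIV d A \<and> (\<exists>v. F v = 0 \<and> A v \<noteq> 0)"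
    thus "\<exists>N. \<forall>e C D. is_form UNIV e D \<and> is_form UNIV (d + e) C \<and> D (vector [x0, y0, 1]) \<noteq> 0 \<longrightarrow>
        \<not> (\<forall>v. F v = 0 \<longrightarrow> A v * D v * (v$3) ^ N = l v ^ N * C v)" using order by blast
  qed
qed

text \<open>
At the vertex the roles are exchanged: the equation reads \<open>y E = x W\<close> with \<open>E = b\<close> at the vertex, so \<open>x\<close> is a uniformizer, and \<open>y\<close>
agrees with \<open>x\<^sup>q\<close> up to a unit.
\<close>

lemma local_param_vertex:
  "local_param F (vector [0, 0, 1]) (\<lambda>v. v$1) (\<lambda>v. v$3)"
proof -
  define T :: "'k poly poly" where "T = [:0, 1:]"
  define l where "l = (\<lambda>v::'k^3. v$1)"
  have l: "is_form UNIV 1 l" unfolding l_def by (rule is_form_coord)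
  have lT: "l (vector [x, y, 1]) = eval2 T x y" for x y by (simp add: l_def T_def vector_3)
  have T: "\<not> Kpoly dvd T" by (rule Kpoly_not_dvd_reduced) (use q2 in \<open>auto simp: T_def\<close>)
  have T0: "eval2 T 0 0 = 0" by (simp add: T_def)
  have p': "eval2 Kpoly 0 0 = 0" using q_pos by (simp add: eval2_Kpoly power_0_left)
  have q1: "u * u^(q-1) = u^q" for u :: 'k using q_pos by (simp add: power_eq_if)
  have "\<exists>k s E. eval2 s 0 0 \<noteq> 0 \<and> Kpoly dvd E * [:r:] - T ^ k * s" if "r \<noteq> 0" for r
  proof -
    obtain k s where r: "r = [:-0, 1:] ^ k * s" "poly s 0 \<noteq> 0" using factor_linear_power[OF \<open>r \<noteq> 0\<close>, of 0] by blast
    \<comment> \<open>On the curve \<open>y E = - c x\<^sup>q\<close>, so a power of \<open>y\<close> is a power of \<open>x\<close> up to a unit at the vertex.\<close>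
    define E :: "'k poly poly" where "E = [:[:b:], monom a (q - 1):]"
    have "Kpoly dvd E ^ k * [:r:] - T ^ (q * k) * [:[:(-c) ^ k:] * s:]"
      unfolding Kpoly_dvd_iff
    proof (intro allI impI)
      fix x y assume xy: "eval2 Kpoly x y = 0"
      have "y * eval2 E x y = a * (y * y^(q-1)) * x + b * y" by (simp add: E_def poly_monom algebra_simps)
      also have "\<dots> = - c * x^q" using xy unfolding q1 eval2_Kpoly by (simp add: algebra_simps eq_neg_iff_add_eq_0)
      finally have "(y * eval2 E x y) ^ k = (- c * x^q) ^ k" by simp
      hence eq: "y ^ k * eval2 E x y ^ k = (- c) ^ k * x ^ (q * k)" by (simp only: power_mult_distrib power_mult)
      have "eval2 (E ^ k * [:r:] - T ^ (q * k) * [:[:(-c) ^ k:] * s:]) x y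
          = (y ^ k * eval2 E x y ^ k) * poly s y - x ^ (q * k) * ((-c) ^ k * poly s y)"
        unfolding r(1) by (simp add: T_def algebra_simps)
      thus "eval2 (E ^ k * [:r:] - T ^ (q * k) * [:[:(-c) ^ k:] * s:]) x y = 0"
        unfolding eq by (simp add: algebra_simps)
    qed
    moreover have "eval2 [:[:(-c) ^ k:] * s:] 0 0 \<noteq> 0" using r(2) c0 by simp
    ultimately show ?thesis by blast
  qed
  note order = order_bound[OF l lT T0 T p' this]
  define E where "E = (\<lambda>v::'k^3. b * v$3^q + a * (v$1 * v$2^(q-1)))"
  define W where "W = (\<lambda>v::'k^3. - c * (v$3 * v$1^(q-1)))"
  have pw: "is_form UNIV n (\<lambda>v. f v ^ n)" if "is_form UNIV 1 f" for f :: "'k^3 \<Rightarrow> 'k" and n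
    using is_form_power[OF that, of n] by simp
  have pw1: "is_form UNIV q (\<lambda>v::'k^3. v$i * v$j^(q-1))" for i j
    by (rule is_form_mult'[OF is_form_coord pw[OF is_form_coord]]) (use q2 in simp)
  have E: "is_form UNIV q E" unfolding E_def by (intro is_form_add is_form_scale pw is_form_coord pw1)
  have W: "is_form UNIV q W" unfolding W_def by (intro is_form_scale pw1)
  have key: "v$2 * E v = v$1 * W v" if "F v = 0" for v
  proof -
    have "0 = a * v$1 * (v$2 * v$2^(q-1)) + b * v$2 * v$3^q + c * v$3 * (v$1 * v$1^(q-1))"
      using that unfolding q1 Kform_def by simp
    thus ?thesis unfolding E_def W_def by (simp add: algebra_simps eq_neg_iff_add_eq_0)
  qed
  show ?thesis
    unfolding local_param_def l_def[symmetric]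
  proof (intro conjI allI impI)
    show "is_form UNIV 1 l" "is_form UNIV 1 (\<lambda>v::'k^3. v$3)" by (rule l, rule is_form_coord)
    show "(vector [0, 0, 1] :: 'k^3) $ 3 \<noteq> 0" "l (vector [0, 0, 1]) = 0" by (simp_all add: l_def vector_3)
    show "\<exists>v. F v = 0 \<and> l v \<noteq> 0" by (rule ex_off_line[OF l lT T])
  next
    fix d and A :: "'k^3 \<Rightarrow> 'k" assume A: "is_form UNIV d A \<and> A (vector [0, 0, 1]) = 0"
    obtain A1 A2 where A12: "is_form UNIV d A1" "is_form UNIV d A2"
      "\<And>v. v$3 * A v = v$1 * A1 v + v$2 * A2 v"
      using form_point_ideal[of d A 0 0] A by auto
    show "\<exists>e C D. is_form UNIV e D \<and> is_form UNIV (d + e) C \<and> D (vector [0, 0, 1]) \<noteq> 0 \<and>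
        (\<forall>v. F v = 0 \<longrightarrow> A v * D v * v$3 = l v * C v)"
    proof (rule exI[of _ q], rule exI[of _ "\<lambda>v. A1 v * E v + A2 v * W v"], rule exI[of _ E], intro conjI allI impI)
      show "is_form UNIV q E" by (rule E)
      show "is_form UNIV (d + q) (\<lambda>v. A1 v * E v + A2 v * W v)"
        by (intro is_form_add is_form_mult A12 E W)
      show "E (vector [0, 0, 1]) \<noteq> 0" using b0 by (simp add: E_def vector_3)
      fix v assume v: "F v = 0"
      have "A v * E v * v$3 = (v$3 * A v) * E v" by (simp add: mult_ac)
      also have "\<dots> = l v * A1 v * E v + A2 v * (v$2 * E v)"
        unfolding A12(3) l_def by (simp add: algebra_simps)
      also have "\<dots> = l v * (A1 v * E v + A2 v * W v)" unfolding key[OF v] l_def by (simp add: algebra_simps)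
      finally show "A v * E v * v$3 = l v * (A1 v * E v + A2 v * W v)" .
    qed
  next
    fix d and A :: "'k^3 \<Rightarrow> 'k" assume "is_form UNIV d A \<and> (\<exists>v. F v = 0 \<and> A v \<noteq> 0)"
    thus "\<exists>N. \<forall>e C D. is_form UNIV e D \<and> is_form UNIV (d + e) C \<and> D (vector [0, 0, 1]) \<noteq> 0 \<longrightarrow>
        \<not> (\<forall>v. F v = 0 \<longrightarrow> A v * D v * (v$3) ^ N = l v ^ N * C v)" using order by blast
  qed
qed

lemma curve_point_cases:
  assumes "F v = 0" "v \<noteq> 0"
  obtains (affine) "v$3 \<noteq> 0" "v$2 \<noteq> 0" | (vertex3) "v$1 = 0" "v$2 = 0" "v$3 \<noteq> 0"
  | (vertex1) "v$1 \<noteq> 0" "v$2 = 0" "v$3 = 0" | (vertex2) "v$1 = 0" "v$2 \<noteq> 0" "v$3 = 0"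
  using assms a0 b0 c0 q_pos by (cases "v$1 = 0"; cases "v$2 = 0"; cases "v$3 = 0") (auto simp: Kform_def vec3_eq_iff power_0_left)

text \<open>
A point of the curve off the triangle \<open>X\<^sub>1 X\<^sub>2 X\<^sub>0 = 0\<close> lies in the affine chart, and the points on the triangle are its three vertices, which the
rotation of coordinates carries to one another.
\<close>

lemma ex_local_param:
  assumes "F p = 0" "p \<noteq> 0"
  shows "\<exists>l m. local_param F p l m"
  using assms
proof (cases rule: curve_point_cases)
  case affine
  have p: "p = p$3 *s vector [p$1 / p$3, p$2 / p$3, 1]" using affine by (intro affine_normalize)
  have "F (vector [p$1 / p$3, p$2 / p$3, 1]) = 0"
    using assms(1) Kform_zero_scale[of "p$3" "vector [p$1 / p$3, p$2 / p$3, 1]"] p affine by simp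
  from local_param_scale[OF local_param_affine[OF this], of "p$3"] affine p show ?thesis by auto
next
  case vertex3
  have "p = p$3 *s vector [0, 0, 1]" using vertex3 by (simp add: vec3_eq_iff vector_3)
  with local_param_scale[OF local_param_vertex, of "p$3"] vertex3 show ?thesis by auto
next
  case vertex2
  interpret R: klein_curve q c a b by (rule rotated)
  have "p = p$2 *s rotate_coords (vector [0, 0, 1])" using vertex2 by (simp add: vec3_eq_iff vector_3)
  moreover have "\<exists>l m. local_param F (rotate_coords (vector [0, 0, 1])) l m"
    using local_param_rotate[OF R.local_param_vertex, of F] by (auto simp: Kform_rotate)
  ultimately show ?thesis using local_param_scale[of F _ _ _ "p$2"] vertex2 by metis
next
  case vertex1
  interpret R: klein_curve q c a b by (rule rotated)
  interpret R2: klein_curve q b c a by (rule R.rotated)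
  have "p = p$1 *s rotate_coords (rotate_coords (vector [0, 0, 1]))" using vertex1 by (simp add: vec3_eq_iff vector_3)
  moreover obtain l m where lm: "local_param R.F (rotate_coords (vector [0, 0, 1])) l m"
    using local_param_rotate[OF R2.local_param_vertex, of R.F] by (auto simp: Kform_rotate)
  have "\<exists>l m. local_param F (rotate_coords (rotate_coords (vector [0, 0, 1]))) l m"
    using local_param_rotate[OF lm, of F] by (auto simp: Kform_rotate)
  ultimately show ?thesis using local_param_scale[of F _ _ _ "p$1"] vertex1 by metis
qed

end

section \<open>Rational functions and their orders\<close>

lemma mem_span_singleton: "v \<in> vec.span {p} \<longleftrightarrow> (\<exists>s. v = s *s (p :: 'k::field^3))"
  by (auto simp: vec.span_singleton)

lemma form_nonzero_on_span:
  assumes "is_form UNIV d B"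
  shows "(\<exists>v\<in>vec.span {p}. B v \<noteq> 0) \<longleftrightarrow> B (p :: 'k::field^3) \<noteq> 0"
proof
  assume "\<exists>v\<in>vec.span {p}. B v \<noteq> 0"
  then obtain s where "B (s *s p) \<noteq> 0" by (auto simp: mem_span_singleton)
  thus "B p \<noteq> 0" using form_homogeneous[OF assms, of s p] by auto
next
  assume "B p \<noteq> 0"
  moreover have "p \<in> vec.span {p}" by (rule vec.span_base) simp
  ultimately show "\<exists>v\<in>vec.span {p}. B v \<noteq> 0" by blast
qed

lemma curve_span_iff:
  assumes "is_form UNIV d F" "d > 0" "p \<noteq> (0 :: 'k::field^3)"
  shows "vec.span {p} \<in> curve F \<longleftrightarrow> F p = 0"
proof -
  have "(\<forall>v\<in>vec.span {p}. F v = 0) \<longleftrightarrow> F p = 0"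
    using form_nonzero_on_span[OF assms(1), of p] by blast
  moreover have "vec.span {p} \<in> PG2 UNIV" using assms(3) unfolding PG2_def by auto
  ultimately show ?thesis by (simp add: curve_def)
qed

context klein_curve
begin

abbreviation "Y \<equiv> curve F"

lemma F_span_iff: "p \<noteq> 0 \<Longrightarrow> vec.span {p} \<in> Y \<longleftrightarrow> F p = 0"
  by (rule curve_span_iff[OF is_form_Kform]) simp

lemma curve_pointE:
  assumes "P \<in> Y"
  obtains p where "p \<noteq> 0" "F p = 0" "P = vec.span {p}"
proof -
  from assms obtain p where "p \<noteq> 0" "P = vec.span {p}" by (auto simp: curve_def PG2_def)
  thus ?thesis using that assms F_span_iff by blast
qed

text \<open>
Points are subspaces, so quantifying over their vectors amounts to quantifying over the affine cone; the zero vector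
is in the cone because the curve has a point.
\<close>

lemma ball_cone: "(\<forall>P\<in>Y. \<forall>v\<in>P. Q v) \<longleftrightarrow> (\<forall>v. F v = 0 \<longrightarrow> Q v)"
proof (intro iffI allI impI ballI)
  fix v assume *: "\<forall>P\<in>Y. \<forall>v\<in>P. Q v" "F v = 0"
  define e3 :: "'k^3" where "e3 = vector [0, 0, 1]"
  have "F e3 = 0" "e3 \<noteq> 0" using q_pos by (simp_all add: e3_def Kform_def vector_3 vec3_eq_iff power_0_left)
  hence "vec.span {if v = 0 then e3 else v} \<in> Y" using *(2) by (subst F_span_iff) auto
  moreover have "v \<in> vec.span {if v = 0 then e3 else v}"
    by (auto simp: vec.span_base vec.span_zero)
  ultimately show "Q v" using *(1) by blast
next
  fix P v assume "\<forall>v. F v = 0 \<longrightarrow> Q v" "P \<in> Y" "v \<in> P"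
  thus "Q v" by (auto simp: curve_def)
qed

text \<open>The denominators admitted in rational functions, and the numerators of nonzero ones.\<close>

definition nz :: "('k^3 \<Rightarrow> 'k) \<Rightarrow> bool" where "nz B \<longleftrightarrow> (\<exists>v. F v = 0 \<and> B v \<noteq> 0)"

lemma quots_iff: "(A, B) \<in> quots Y \<longleftrightarrow> (\<exists>d. is_form UNIV d A \<and> is_form UNIV d B) \<and> nz B"
  unfolding quots_def nz_def using ball_cone[of "\<lambda>v. B v = 0"] by auto

lemma quot_rel_iff: "((A, B), (C, D)) \<in> quot_rel Y \<longleftrightarrow>
  (A, B) \<in> quots Y \<and> (C, D) \<in> quots Y \<and> (\<forall>v. F v = 0 \<longrightarrow> A v * D v = C v * B v)"
  unfolding quot_rel_def ball_cone by simp

lemma nz_mult: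
  assumes "is_form UNIV d A" "is_form UNIV e B" "nz A" "nz B"
  shows "nz (\<lambda>v. A v * B v)"
  using forms_mult_vanish[OF assms(1,2)] assms(3,4) unfolding nz_def by auto

lemma forms_cancel:
  assumes "is_form UNIV d A" "is_form UNIV d B" "is_form UNIV e C" "nz C"
    and "\<And>v. F v = 0 \<Longrightarrow> A v * C v = B v * C v" "F v = 0"
  shows "A v = B v"
  using forms_mult_vanish[OF is_form_diff[OF assms(1,2)] assms(3)] assms(4,5,6)
  unfolding nz_def by (auto simp: algebra_simps)

text \<open>Transitivity is where irreducibility of the curve is used: a common denominator has to be cancelled.\<close>

lemma equiv_quot_rel: "equiv (quots Y) (quot_rel Y)"
proof (rule equivI)
  show "quot_rel Y \<subseteq> quots Y \<times> quots Y" by (auto simp: quot_rel_def)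
  show "refl_on (quots Y) (quot_rel Y)" by (auto simp: refl_on_def quot_rel_def)
  show "sym (quot_rel Y)" by (auto simp: sym_def quot_rel_def)
  show "trans (quot_rel Y)"
  proof (rule transI, clarify)
    fix A B C D E G
    assume 1: "((A, B), (C, D)) \<in> quot_rel Y" and 2: "((C, D), (E, G)) \<in> quot_rel Y"
    obtain d where d: "is_form UNIV d A" "is_form UNIV d B" using 1 by (auto simp: quot_rel_iff quots_iff)
    obtain e where e: "is_form UNIV e C" "is_form UNIV e D" "nz D" using 2 by (auto simp: quot_rel_iff quots_iff)
    obtain g where g: "is_form UNIV g E" "is_form UNIV g G" using 2 by (auto simp: quot_rel_iff quots_iff)
    have eq: "(A v * G v) * D v = (E v * B v) * D v" if "F v = 0" for v
    proof -
      have "A v * D v = C v * B v" "C v * G v = E v * D v" using 1 2 that by (auto simp: quot_rel_iff)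
      thus ?thesis by (metis mult.assoc mult.commute)
    qed
    have "is_form UNIV (d + g) (\<lambda>v. E v * B v)" by (rule is_form_mult'[OF g(1) d(2)]) simp
    hence "A v * G v = E v * B v" if "F v = 0" for v
      using forms_cancel[OF is_form_mult[OF d(1) g(2)] _ e(2,3) eq that] by blast
    thus "((A, B), (E, G)) \<in> quot_rel Y" using 1 2 by (auto simp: quot_rel_iff)
  qed
qed

definition frac :: "('k^3 \<Rightarrow> 'k) \<Rightarrow> ('k^3 \<Rightarrow> 'k) \<Rightarrow> 'k quot set" where
  "frac A B = quot_rel Y `` {(A, B)}"

lemma frac_eq_iff:
  assumes "(A, B) \<in> quots Y" "(C, D) \<in> quots Y"
  shows "frac A B = frac C D \<longleftrightarrow> (\<forall>v. F v = 0 \<longrightarrow> A v * D v = C v * B v)"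
  unfolding frac_def eq_equiv_class_iff[OF equiv_quot_rel assms] using assms by (simp add: quot_rel_iff)

lemma mem_frac_iff:
  assumes "(A, B) \<in> quots Y"
  shows "(C, D) \<in> frac A B \<longleftrightarrow> (C, D) \<in> quots Y \<and> (\<forall>v. F v = 0 \<longrightarrow> A v * D v = C v * B v)"
  unfolding frac_def using assms by (auto simp: quot_rel_iff)

lemma frac_in_rat_funs: "(A, B) \<in> quots Y \<Longrightarrow> frac A B \<in> rat_funs Y"
  unfolding frac_def rat_funs_def by (rule quotientI)

lemma rat_funsE:
  assumes "f \<in> rat_funs Y"
  obtains A B where "(A, B) \<in> quots Y" "f = frac A B"
  using assms unfolding rat_funs_def frac_def by (elim quotientE) auto

lemma frac_eq_of_mem:
  assumes "(A, B) \<in> quots Y" "(C, D) \<in> frac A B"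
  shows "frac A B = frac C D"
  using assms by (simp add: mem_frac_iff frac_eq_iff)

lemma quots_mult:
  assumes "(A, B) \<in> quots Y" "(C, D) \<in> quots Y"
  shows "(\<lambda>v. A v * C v, \<lambda>v. B v * D v) \<in> quots Y"
proof -
  obtain d e where d: "is_form UNIV d A" "is_form UNIV d B" "nz B" and e: "is_form UNIV e C" "is_form UNIV e D" "nz D"
    using assms unfolding quots_iff by blast
  have "nz (\<lambda>v. B v * D v)" by (rule nz_mult[OF d(2) e(2) d(3) e(3)])
  thus ?thesis using is_form_mult[OF d(1) e(1)] is_form_mult[OF d(2) e(2)] unfolding quots_iff by blast
qed

lemma rat_mult_frac:
  assumes AB: "(A, B) \<in> quots Y" and CD: "(C, D) \<in> quots Y"
  shows "rat_mult Y (frac A B) (frac C D) = frac (\<lambda>v. A v * C v) (\<lambda>v. B v * D v)"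
proof -
  define S where "S = {(\<lambda>v. A1 v * A' v, \<lambda>v. B1 v * B' v) | A1 B1 A' B'. (A1, B1) \<in> frac A B \<and> (A', B') \<in> frac C D}"
  have "x \<in> frac (\<lambda>v. A v * C v) (\<lambda>v. B v * D v)" if x: "x \<in> S" for x
  proof -
    obtain A1 B1 C1 D1 where x1: "x = (\<lambda>v. A1 v * C1 v, \<lambda>v. B1 v * D1 v)" "(A1, B1) \<in> frac A B" "(C1, D1) \<in> frac C D"
      using x unfolding S_def by blast
    have *: "(A1, B1) \<in> quots Y" "\<And>v. F v = 0 \<Longrightarrow> A v * B1 v = A1 v * B v"
      "(C1, D1) \<in> quots Y" "\<And>v. F v = 0 \<Longrightarrow> C v * D1 v = C1 v * D v"
      using x1(2,3) AB CD by (auto simp: mem_frac_iff)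
    have "A v * C v * (B1 v * D1 v) = A1 v * C1 v * (B v * D v)" if "F v = 0" for v
    proof -
      have "A v * C v * (B1 v * D1 v) = (A v * B1 v) * (C v * D1 v)" by (simp add: mult_ac)
      also have "\<dots> = A1 v * C1 v * (B v * D v)" unfolding *(2)[OF that] *(4)[OF that] by (simp add: mult_ac)
      finally show ?thesis .
    qed
    thus ?thesis unfolding x1(1) mem_frac_iff[OF quots_mult[OF AB CD]]
      using quots_mult[OF *(1,3)] by blast
  qed
  moreover have "(\<lambda>v. A v * C v, \<lambda>v. B v * D v) \<in> S"
  proof -
    have "(A, B) \<in> frac A B" "(C, D) \<in> frac C D" using AB CD by (simp_all add: mem_frac_iff)
    thus ?thesis unfolding S_def by blast
  qed
  moreover have "trans (quot_rel Y)" using equiv_quot_rel by (rule equivE)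
  ultimately have "quot_rel Y `` S = frac (\<lambda>v. A v * C v) (\<lambda>v. B v * D v)"
    unfolding frac_def by (blast dest: transD)
  thus ?thesis unfolding rat_mult_def S_def .
qed

lemma quots_one: "(\<lambda>_. 1, \<lambda>_. 1) \<in> quots Y"
proof -
  have "F 0 = 0" using q_pos by (simp add: Kform_def)
  hence "nz (\<lambda>_. 1)" unfolding nz_def by auto
  thus ?thesis unfolding quots_iff using is_form_const by blast
qed

text \<open>The multiplicative structure of the function field as a monoid, so that powers of uniformizers obey the laws of commutative monoids.\<close>

definition rat_monoid :: "'k quot set monoid" where
  "rat_monoid = \<lparr>carrier = rat_funs Y, mult = rat_mult Y, one = frac (\<lambda>_. 1) (\<lambda>_. 1)\<rparr>"

lemma rat_monoid_simps: "carrier rat_monoid = rat_funs Y" "mult rat_monoid = rat_mult Y" "one rat_monoid = frac (\<lambda>_. 1) (\<lambda>_. 1)"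
  by (simp_all add: rat_monoid_def)

lemma comm_monoid_rat: "comm_monoid rat_monoid"
proof (rule comm_monoidI)
  fix f g assume "f \<in> carrier rat_monoid" "g \<in> carrier rat_monoid"
  then obtain A B C D where f: "(A, B) \<in> quots Y" "f = frac A B" and g: "(C, D) \<in> quots Y" "g = frac C D"
    unfolding rat_monoid_simps by (meson rat_funsE)
  show "f \<otimes>\<^bsub>rat_monoid\<^esub> g \<in> carrier rat_monoid"
    using f g by (simp add: rat_monoid_simps rat_mult_frac quots_mult frac_in_rat_funs)
  show "f \<otimes>\<^bsub>rat_monoid\<^esub> g = g \<otimes>\<^bsub>rat_monoid\<^esub> f"
    using f g by (simp add: rat_monoid_simps rat_mult_frac mult.commute)
next
  fix f g h assume "f \<in> carrier rat_monoid" "g \<in> carrier rat_monoid" "h \<in> carrier rat_monoid"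
  then obtain A B C D E G where f: "(A, B) \<in> quots Y" "f = frac A B" and g: "(C, D) \<in> quots Y" "g = frac C D"
    and h: "(E, G) \<in> quots Y" "h = frac E G"
    unfolding rat_monoid_simps by (meson rat_funsE)
  show "f \<otimes>\<^bsub>rat_monoid\<^esub> g \<otimes>\<^bsub>rat_monoid\<^esub> h = f \<otimes>\<^bsub>rat_monoid\<^esub> (g \<otimes>\<^bsub>rat_monoid\<^esub> h)"
    using f g h by (simp add: rat_monoid_simps rat_mult_frac quots_mult mult.assoc)
next
  show "\<one>\<^bsub>rat_monoid\<^esub> \<in> carrier rat_monoid" using quots_one by (simp add: rat_monoid_simps frac_in_rat_funs)
  fix f assume "f \<in> carrier rat_monoid"
  then obtain A B where f: "(A, B) \<in> quots Y" "f = frac A B" unfolding rat_monoid_simps by (meson rat_funsE)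
  show "\<one>\<^bsub>rat_monoid\<^esub> \<otimes>\<^bsub>rat_monoid\<^esub> f = f"
    using f quots_one by (simp add: rat_monoid_simps rat_mult_frac)
qed

sublocale M: comm_monoid rat_monoid by (rule comm_monoid_rat)

lemma rat_mult_iterate:
  assumes "t \<in> rat_funs Y" "f \<in> rat_funs Y"
  shows "(rat_mult Y t ^^ n) f = t [^]\<^bsub>rat_monoid\<^esub> n \<otimes>\<^bsub>rat_monoid\<^esub> f"
proof (induction n)
  case 0 thus ?case using assms by (simp add: rat_monoid_simps(1))
next
  case (Suc n)
  have "(rat_mult Y t ^^ Suc n) f = t \<otimes>\<^bsub>rat_monoid\<^esub> (t [^]\<^bsub>rat_monoid\<^esub> n \<otimes>\<^bsub>rat_monoid\<^esub> f)"
    by (simp add: Suc rat_monoid_simps(2))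
  also have "\<dots> = t [^]\<^bsub>rat_monoid\<^esub> Suc n \<otimes>\<^bsub>rat_monoid\<^esub> f"
    using assms unfolding rat_monoid_simps(1)[symmetric] by (simp add: M.nat_pow_Suc M.m_ac)
  finally show ?case .
qed

lemma frac_power:
  assumes "(A, B) \<in> quots Y"
  shows "frac A B [^]\<^bsub>rat_monoid\<^esub> (n::nat) = frac (\<lambda>v. A v ^ n) (\<lambda>v. B v ^ n) \<and> (\<lambda>v. A v ^ n, \<lambda>v. B v ^ n) \<in> quots Y"
proof (induction n)
  case 0 thus ?case using quots_one by (simp add: rat_monoid_simps)
next
  case (Suc n)
  thus ?case using rat_mult_frac[of "\<lambda>v. A v ^ n" "\<lambda>v. B v ^ n" A B] quots_mult[of "\<lambda>v. A v ^ n" "\<lambda>v. B v ^ n" A B] assms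
    by (simp add: M.nat_pow_Suc rat_monoid_simps(2) mult.commute)
qed

lemma rat_zero_frac: "rat_zero Y = frac (\<lambda>_. 0) (\<lambda>_. 1)"
  by (simp add: rat_zero_def frac_def)

lemma quots_zero: "(\<lambda>_. 0, \<lambda>_. 1) \<in> quots Y"
  using quots_one is_form_const is_form_zero unfolding quots_iff by blast

lemma frac_eq_zero_iff:
  assumes "(A, B) \<in> quots Y"
  shows "frac A B = rat_zero Y \<longleftrightarrow> \<not> nz A"
  unfolding rat_zero_frac frac_eq_iff[OF assms quots_zero] by (simp add: nz_def)

lemma rat_cancel:
  assumes "t \<in> rat_funs Y" "t \<noteq> rat_zero Y" "f \<in> rat_funs Y" "g \<in> rat_funs Y"
    and "t \<otimes>\<^bsub>rat_monoid\<^esub> f = t \<otimes>\<^bsub>rat_monoid\<^esub> g"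
  shows "f = g"
proof -
  obtain A B C D E G where t: "(A, B) \<in> quots Y" "t = frac A B" and f: "(C, D) \<in> quots Y" "f = frac C D"
    and g: "(E, G) \<in> quots Y" "g = frac E G" using assms by (meson rat_funsE)
  obtain d where d: "is_form UNIV d A" "is_form UNIV d B" "nz B" using t by (auto simp: quots_iff)
  obtain e where e: "is_form UNIV e C" "is_form UNIV e D" using f by (auto simp: quots_iff)
  obtain h where h: "is_form UNIV h E" "is_form UNIV h G" using g by (auto simp: quots_iff)
  have "nz A" using assms(2) t by (simp add: frac_eq_zero_iff)
  have eq: "(A v * C v) * (B v * G v) = (A v * E v) * (B v * D v)" if "F v = 0" for v
    using assms(5) that t f g by (simp add: rat_monoid_simps rat_mult_frac frac_eq_iff quots_mult)
  have "C v * G v = E v * D v" if "F v = 0" for v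
  proof (rule forms_cancel[OF is_form_mult[OF e(1) h(2)] _ is_form_mult[OF d(1,2)]])
    show "is_form UNIV (e + h) (\<lambda>v. E v * D v)" by (rule is_form_mult'[OF h(1) e(2)]) simp
    show "nz (\<lambda>v. A v * B v)" by (rule nz_mult[OF d(1,2) \<open>nz A\<close> d(3)])
  qed (use eq that in \<open>simp_all add: mult_ac\<close>)
  thus ?thesis using f g by (simp add: frac_eq_iff)
qed

lemma regular_frac_iff:
  assumes "(A, B) \<in> quots Y"
  shows "regular_at (frac A B) (vec.span {p}) \<longleftrightarrow> (\<exists>C D. (C, D) \<in> quots Y \<and> frac A B = frac C D \<and> D p \<noteq> 0)"
proof
  assume "regular_at (frac A B) (vec.span {p})"
  then obtain C D where CD: "(C, D) \<in> frac A B" "\<exists>v\<in>vec.span {p}. D v \<noteq> 0" unfolding regular_at_def by auto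
  hence q: "(C, D) \<in> quots Y" using assms by (simp add: mem_frac_iff)
  then obtain d where "is_form UNIV d D" by (auto simp: quots_iff)
  thus "\<exists>C D. (C, D) \<in> quots Y \<and> frac A B = frac C D \<and> D p \<noteq> 0"
    using CD q frac_eq_of_mem[OF assms] form_nonzero_on_span by blast
next
  assume "\<exists>C D. (C, D) \<in> quots Y \<and> frac A B = frac C D \<and> D p \<noteq> 0"
  then obtain C D where CD: "(C, D) \<in> quots Y" "frac A B = frac C D" "D p \<noteq> 0" by blast
  have "(C, D) \<in> frac A B" unfolding CD(2) using CD(1) by (simp add: mem_frac_iff)
  thus "regular_at (frac A B) (vec.span {p})" unfolding regular_at_def
    using CD(3) vec.span_base[of p "{p}"] by fast
qed

lemma rat_value_frac:
  assumes "(A, B) \<in> quots Y" "B p \<noteq> 0" "F p = 0"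
  shows "rat_value (frac A B) (vec.span {p}) = A p / B p"
  unfolding rat_value_def
proof (rule the_equality)
  have "(A, B) \<in> frac A B" using assms by (simp add: mem_frac_iff)
  thus "\<exists>(A', B')\<in>frac A B. \<exists>v\<in>vec.span {p}. B' v \<noteq> 0 \<and> A p / B p = A' v / B' v"
    using assms(2) vec.span_base[of p "{p}"] by fast
next
  fix c assume "\<exists>(A', B')\<in>frac A B. \<exists>v\<in>vec.span {p}. B' v \<noteq> 0 \<and> c = A' v / B' v"
  then obtain C D v where *: "(C, D) \<in> frac A B" "v \<in> vec.span {p}" "D v \<noteq> 0" "c = C v / D v" by auto
  then obtain s where s: "v = s *s p" by (auto simp: mem_span_singleton)
  from * have CD: "(C, D) \<in> quots Y" "\<And>v. F v = 0 \<Longrightarrow> A v * D v = C v * B v" using assms(1) by (auto simp: mem_frac_iff)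
  obtain d where d: "is_form UNIV d C" "is_form UNIV d D" using CD(1) by (auto simp: quots_iff)
  have v: "D v = s ^ d * D p" "C v = s ^ d * C p"
    unfolding s by (rule form_homogeneous[OF d(2)], rule form_homogeneous[OF d(1)])
  hence "D p \<noteq> 0" "s ^ d \<noteq> 0" using *(3) by auto
  moreover have "A p * D p = C p * B p" using CD(2) assms(3) by blast
  ultimately show "c = A p / B p" unfolding *(4) v using assms(2) by (auto simp: frac_eq_eq)
qed

lemma local_ringE:
  assumes "f \<in> local_ring Y (vec.span {p})"
  obtains A B where "(A, B) \<in> quots Y" "f = frac A B" "B p \<noteq> 0"
proof -
  from assms have f: "f \<in> rat_funs Y" "regular_at f (vec.span {p})" by (auto simp: local_ring_def)
  from f(1) obtain A B where "(A, B) \<in> quots Y" "f = frac A B" by (rule rat_funsE)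
  thus ?thesis using f(2) that regular_frac_iff by metis
qed

lemma local_ringI:
  assumes "(A, B) \<in> quots Y" "B p \<noteq> 0"
  shows "frac A B \<in> local_ring Y (vec.span {p})"
  unfolding local_ring_def using assms regular_frac_iff frac_in_rat_funs by blast

lemma local_ring_mult:
  assumes "F p = 0" "f \<in> local_ring Y (vec.span {p})" "g \<in> local_ring Y (vec.span {p})"
  shows "f \<otimes>\<^bsub>rat_monoid\<^esub> g \<in> local_ring Y (vec.span {p})"
    and "rat_value (f \<otimes>\<^bsub>rat_monoid\<^esub> g) (vec.span {p}) = rat_value f (vec.span {p}) * rat_value g (vec.span {p})"
proof -
  obtain A B where f: "(A, B) \<in> quots Y" "f = frac A B" "B p \<noteq> 0" using assms(2) by (rule local_ringE)
  obtain C D where g: "(C, D) \<in> quots Y" "g = frac C D" "D p \<noteq> 0" using assms(3) by (rule local_ringE)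
  have fg: "f \<otimes>\<^bsub>rat_monoid\<^esub> g = frac (\<lambda>v. A v * C v) (\<lambda>v. B v * D v)"
    using f g by (simp add: rat_monoid_simps rat_mult_frac)
  show "f \<otimes>\<^bsub>rat_monoid\<^esub> g \<in> local_ring Y (vec.span {p})"
    unfolding fg by (rule local_ringI[OF quots_mult[OF f(1) g(1)]]) (use f g in simp)
  show "rat_value (f \<otimes>\<^bsub>rat_monoid\<^esub> g) (vec.span {p}) = rat_value f (vec.span {p}) * rat_value g (vec.span {p})"
    unfolding fg using f g assms(1) quots_mult[OF f(1) g(1)] by (simp add: rat_value_frac)
qed

lemma local_ring_power:
  assumes "F p = 0" "f \<in> local_ring Y (vec.span {p})"
  shows "f [^]\<^bsub>rat_monoid\<^esub> (n::nat) \<in> local_ring Y (vec.span {p})"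
    and "rat_value (f [^]\<^bsub>rat_monoid\<^esub> n) (vec.span {p}) = rat_value f (vec.span {p}) ^ n"
proof -
  have "frac (\<lambda>_. 1) (\<lambda>_. 1) \<in> local_ring Y (vec.span {p})" by (rule local_ringI[OF quots_one]) simp
  moreover have "rat_value (frac (\<lambda>_. 1) (\<lambda>_. 1)) (vec.span {p}) = 1"
    using rat_value_frac[OF quots_one, of p] assms(1) by simp
  ultimately have "f [^]\<^bsub>rat_monoid\<^esub> (n::nat) \<in> local_ring Y (vec.span {p}) \<and>
      rat_value (f [^]\<^bsub>rat_monoid\<^esub> n) (vec.span {p}) = rat_value f (vec.span {p}) ^ n"
    by (induction n) (simp_all add: M.nat_pow_0 rat_monoid_simps(3) M.nat_pow_Suc local_ring_mult assms mult.commute)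
  thus "f [^]\<^bsub>rat_monoid\<^esub> (n::nat) \<in> local_ring Y (vec.span {p})"
    "rat_value (f [^]\<^bsub>rat_monoid\<^esub> n) (vec.span {p}) = rat_value f (vec.span {p}) ^ n" by auto
qed

lemma local_ring_rat_funs: "f \<in> local_ring Y P \<Longrightarrow> f \<in> rat_funs Y" by (simp add: local_ring_def)

lemma quots_of_nonzero_at:
  assumes "is_form UNIV d A" "is_form UNIV d B" "B p \<noteq> 0" "F p = 0"
  shows "(A, B) \<in> quots Y"
  using assms unfolding quots_iff nz_def by blast

text \<open>A function of value zero at the point has a numerator that vanishes there, and the division clause of \<open>local_param\<close> factors it.\<close>

lemma uniformizer_local_param:
  assumes p: "F p = 0" and lm: "local_param F p l m"
  shows "uniformizer Y (vec.span {p}) (frac l m)" "frac l m \<noteq> rat_zero Y" "(l, m) \<in> quots Y"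
proof -
  note f = local_param_forms[OF lm]
  show q: "(l, m) \<in> quots Y" by (rule quots_of_nonzero_at[OF f(1,2,3) p])
  show "frac l m \<noteq> rat_zero Y" using f(5) q by (simp add: frac_eq_zero_iff nz_def)
  have t: "frac l m \<in> local_ring Y (vec.span {p})" by (rule local_ringI[OF q f(3)])
  have v0: "rat_value (frac l m) (vec.span {p}) = 0" using rat_value_frac[OF q f(3) p] f(4) by simp
  have "{f \<in> local_ring Y (vec.span {p}). rat_value f (vec.span {p}) = 0} = rat_mult Y (frac l m) ` local_ring Y (vec.span {p})"
  proof (intro equalityI subsetI)
    fix g assume "g \<in> {f \<in> local_ring Y (vec.span {p}). rat_value f (vec.span {p}) = 0}"
    hence g: "g \<in> local_ring Y (vec.span {p})" "rat_value g (vec.span {p}) = 0" by auto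
    obtain A B where AB: "(A, B) \<in> quots Y" "g = frac A B" "B p \<noteq> 0" using g(1) by (rule local_ringE)
    have "A p = 0" using g(2) AB p by (simp add: rat_value_frac)
    obtain d where d: "is_form UNIV d A" "is_form UNIV d B" using AB by (auto simp: quots_iff)
    obtain e C D where CD: "is_form UNIV e D" "is_form UNIV (d + e) C" "D p \<noteq> 0" "\<And>v. F v = 0 \<Longrightarrow> A v * D v * m v = l v * C v"
      using local_param_divide[OF lm d(1) \<open>A p = 0\<close>] by blast
    have q2: "(C, \<lambda>v. B v * D v) \<in> quots Y"
      by (rule quots_of_nonzero_at[OF CD(2) is_form_mult[OF d(2) CD(1)] _ p]) (use AB CD in simp)
    have "g = rat_mult Y (frac l m) (frac C (\<lambda>v. B v * D v))"
      unfolding rat_mult_frac[OF q q2] AB(2) frac_eq_iff[OF AB(1) quots_mult[OF q q2]]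
    proof (intro allI impI)
      fix v assume "F v = 0"
      have "A v * (m v * (B v * D v)) = (A v * D v * m v) * B v" by (simp add: mult_ac)
      also have "\<dots> = l v * C v * B v" unfolding CD(4)[OF \<open>F v = 0\<close>] ..
      finally show "A v * (m v * (B v * D v)) = l v * C v * B v" .
    qed
    moreover have "frac C (\<lambda>v. B v * D v) \<in> local_ring Y (vec.span {p})"
      by (rule local_ringI[OF q2]) (use AB CD in simp)
    ultimately show "g \<in> rat_mult Y (frac l m) ` local_ring Y (vec.span {p})" by blast
  next
    fix g assume "g \<in> rat_mult Y (frac l m) ` local_ring Y (vec.span {p})"
    then obtain h where h: "h \<in> local_ring Y (vec.span {p})" "g = frac l m \<otimes>\<^bsub>rat_monoid\<^esub> h"
      by (auto simp: rat_monoid_simps)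
    thus "g \<in> {f \<in> local_ring Y (vec.span {p}). rat_value f (vec.span {p}) = 0}"
      using local_ring_mult[OF p t h(1)] v0 by simp
  qed
  thus "uniformizer Y (vec.span {p}) (frac l m)" unfolding uniformizer_def using t by blast
qed

lemma uniformizerD:
  assumes "uniformizer Y (vec.span {p}) t"
  shows "t \<in> local_ring Y (vec.span {p})" "F p = 0 \<Longrightarrow> rat_value t (vec.span {p}) = 0"
    and "g \<in> local_ring Y (vec.span {p}) \<Longrightarrow> rat_value g (vec.span {p}) = 0 \<Longrightarrow> \<exists>w\<in>local_ring Y (vec.span {p}). g = t \<otimes>\<^bsub>rat_monoid\<^esub> w"
proof -
  let ?P = "vec.span {p}"
  from assms have t: "t \<in> local_ring Y ?P" and eq: "{f \<in> local_ring Y ?P. rat_value f ?P = 0} = rat_mult Y t ` local_ring Y ?P"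
    by (auto simp: uniformizer_def)
  show "t \<in> local_ring Y ?P" by (rule t)
  show "g \<in> local_ring Y ?P \<Longrightarrow> rat_value g ?P = 0 \<Longrightarrow> \<exists>w\<in>local_ring Y ?P. g = t \<otimes>\<^bsub>rat_monoid\<^esub> w"
    using eq by (auto simp: rat_monoid_simps)
  assume "F p = 0"
  have one: "frac (\<lambda>_. 1) (\<lambda>_. 1) \<in> local_ring Y ?P" by (rule local_ringI[OF quots_one]) simp
  have "t = rat_mult Y t (frac (\<lambda>_. 1) (\<lambda>_. 1))"
    using M.r_one[of t] local_ring_rat_funs[OF t] by (simp add: rat_monoid_simps)
  hence "t \<in> rat_mult Y t ` local_ring Y ?P" using one by blast
  thus "rat_value t ?P = 0" using eq by blast
qed

text \<open>Cancelling common powers of \<open>t\<close> leaves a unit on one side and a function vanishing at the point on the other.\<close>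

lemma power_unit_unique:
  assumes p: "F p = 0" and t: "t \<in> local_ring Y (vec.span {p})" "rat_value t (vec.span {p}) = 0" "t \<noteq> rat_zero Y"
    and u: "u \<in> local_ring Y (vec.span {p})" "rat_value u (vec.span {p}) \<noteq> 0"
    and w: "w \<in> local_ring Y (vec.span {p})" "rat_value w (vec.span {p}) \<noteq> 0"
    and eq: "t [^]\<^bsub>rat_monoid\<^esub> (i::nat) \<otimes>\<^bsub>rat_monoid\<^esub> u = t [^]\<^bsub>rat_monoid\<^esub> (j::nat) \<otimes>\<^bsub>rat_monoid\<^esub> w"
  shows "i \<le> j"
  using eq
proof (induction j arbitrary: i)
  case 0
  show ?case
  proof (rule ccontr)
    assume "\<not> i \<le> 0"
    then have "rat_value (t [^]\<^bsub>rat_monoid\<^esub> i \<otimes>\<^bsub>rat_monoid\<^esub> u) (vec.span {p}) = 0"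
      using local_ring_mult(2)[OF p local_ring_power(1)[OF p t(1)] u(1)] local_ring_power(2)[OF p t(1)] t(2) by simp
    moreover have "w \<in> carrier rat_monoid" using w local_ring_rat_funs by (simp add: rat_monoid_simps)
    ultimately show False using 0 w by (simp add: M.nat_pow_0)
  qed
next
  case (Suc j)
  show ?case
  proof (cases i)
    case (Suc i')
    have c: "t \<in> carrier rat_monoid" "u \<in> carrier rat_monoid" "w \<in> carrier rat_monoid"
      using t u w local_ring_rat_funs by (simp_all add: rat_monoid_simps)
    have "t \<otimes>\<^bsub>rat_monoid\<^esub> (t [^]\<^bsub>rat_monoid\<^esub> i' \<otimes>\<^bsub>rat_monoid\<^esub> u) = t \<otimes>\<^bsub>rat_monoid\<^esub> (t [^]\<^bsub>rat_monoid\<^esub> j \<otimes>\<^bsub>rat_monoid\<^esub> w)"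
      using Suc.prems c unfolding Suc by (simp add: M.nat_pow_Suc M.m_ac)
    hence "t [^]\<^bsub>rat_monoid\<^esub> i' \<otimes>\<^bsub>rat_monoid\<^esub> u = t [^]\<^bsub>rat_monoid\<^esub> j \<otimes>\<^bsub>rat_monoid\<^esub> w"
      by (rule rat_cancel[rotated -1]) (use c t in \<open>simp_all flip: rat_monoid_simps(1)\<close>)
    thus ?thesis using Suc.IH Suc by simp
  qed simp
qed

text \<open>
The order is independent of the uniformizer: two uniformizers differ by a factor \<open>w\<close> that is a unit, and its powers are absorbed
into the unit parts.
\<close>

lemma ord_at_eqI:
  assumes p: "F p = 0" and lm: "local_param F p l m" and f: "f \<in> rat_funs Y"
    and u: "u \<in> local_ring Y (vec.span {p})" "rat_value u (vec.span {p}) \<noteq> 0"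
    and eq: "frac l m [^]\<^bsub>rat_monoid\<^esub> j \<otimes>\<^bsub>rat_monoid\<^esub> f = frac l m [^]\<^bsub>rat_monoid\<^esub> i \<otimes>\<^bsub>rat_monoid\<^esub> u"
  shows "ord_at Y (vec.span {p}) f = int i - int j"
  unfolding ord_at_def
proof (rule the_equality)
  let ?P = "vec.span {p}"
  let ?M = rat_monoid
  define t where "t = frac l m"
  note tu = uniformizer_local_param[OF p lm]
  have t: "uniformizer Y ?P t" "t \<noteq> rat_zero Y" using tu by (simp_all add: t_def)
  have tl: "t \<in> local_ring Y ?P" "rat_value t ?P = 0" using uniformizerD[OF t(1)] p by auto
  have carr: "g \<in> carrier ?M" if "g \<in> local_ring Y ?P" for g
    using that local_ring_rat_funs by (simp add: rat_monoid_simps)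
  have fc: "f \<in> carrier ?M" using f by (simp add: rat_monoid_simps)
  show "\<exists>t u i' j'. uniformizer Y ?P t \<and> u \<in> local_ring Y ?P \<and> rat_value u ?P \<noteq> 0 \<and>
      int i - int j = int i' - int j' \<and> (rat_mult Y t ^^ j') f = (rat_mult Y t ^^ i') u"
    using t u eq f local_ring_rat_funs[OF u(1)] local_ring_rat_funs[OF tl(1)]
    by (intro exI[of _ t] exI[of _ u] exI[of _ i] exI[of _ j]) (simp add: rat_mult_iterate t_def)
  fix n assume "\<exists>t u i j. uniformizer Y ?P t \<and> u \<in> local_ring Y ?P \<and> rat_value u ?P \<noteq> 0 \<and>
      n = int i - int j \<and> (rat_mult Y t ^^ j) f = (rat_mult Y t ^^ i) u"
  then obtain t' u' i' j' where t': "uniformizer Y ?P t'" and u': "u' \<in> local_ring Y ?P" "rat_value u' ?P \<noteq> 0"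
    and n: "n = int i' - int j'" and eq': "(rat_mult Y t' ^^ j') f = (rat_mult Y t' ^^ i') u'" by blast
  have tl': "t' \<in> local_ring Y ?P" "rat_value t' ?P = 0" using uniformizerD[OF t'] p by auto
  have eq'': "t' [^]\<^bsub>?M\<^esub> j' \<otimes>\<^bsub>?M\<^esub> f = t' [^]\<^bsub>?M\<^esub> i' \<otimes>\<^bsub>?M\<^esub> u'"
    using eq' f local_ring_rat_funs[OF u'(1)] local_ring_rat_funs[OF tl'(1)] by (simp add: rat_mult_iterate)
  obtain w where w: "w \<in> local_ring Y ?P" "t' = t \<otimes>\<^bsub>?M\<^esub> w" using uniformizerD(3)[OF t(1) tl'] by blast
  obtain w' where w': "w' \<in> local_ring Y ?P" "t = t' \<otimes>\<^bsub>?M\<^esub> w'" using uniformizerD(3)[OF t' tl] by blast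
  note c = carr[OF tl(1)] carr[OF tl'(1)] carr[OF w(1)] carr[OF w'(1)] carr[OF u(1)] carr[OF u'(1)] fc
  have "t \<otimes>\<^bsub>?M\<^esub> (w \<otimes>\<^bsub>?M\<^esub> w') = t' \<otimes>\<^bsub>?M\<^esub> w'" unfolding w(2) using c by (simp add: M.m_ac)
  also have "\<dots> = t \<otimes>\<^bsub>?M\<^esub> \<one>\<^bsub>?M\<^esub>" using c w'(2) by simp
  finally have "w \<otimes>\<^bsub>?M\<^esub> w' = \<one>\<^bsub>?M\<^esub>"
    by (rule rat_cancel[rotated -1]) (use c t in \<open>simp_all flip: rat_monoid_simps(1)\<close>)
  moreover have "rat_value \<one>\<^bsub>?M\<^esub> ?P = 1" using rat_value_frac[OF quots_one, of p] p by (simp add: rat_monoid_simps)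
  ultimately have "rat_value w ?P * rat_value w' ?P = 1" using local_ring_mult(2)[OF p w(1) w'(1)] by simp
  hence wnz: "rat_value w ?P \<noteq> 0" by auto
  define U where "U = w [^]\<^bsub>?M\<^esub> j' \<otimes>\<^bsub>?M\<^esub> u"
  define U' where "U' = w [^]\<^bsub>?M\<^esub> i' \<otimes>\<^bsub>?M\<^esub> u'"
  have U: "U \<in> local_ring Y ?P" "rat_value U ?P \<noteq> 0"
    unfolding U_def using local_ring_mult[OF p local_ring_power(1)[OF p w(1)] u(1)] local_ring_power(2)[OF p w(1)] wnz u by simp_all
  have U': "U' \<in> local_ring Y ?P" "rat_value U' ?P \<noteq> 0"
    unfolding U'_def using local_ring_mult[OF p local_ring_power(1)[OF p w(1)] u'(1)] local_ring_power(2)[OF p w(1)] wnz u' by simp_all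
  have "t [^]\<^bsub>?M\<^esub> (i + j') \<otimes>\<^bsub>?M\<^esub> U = (t [^]\<^bsub>?M\<^esub> j' \<otimes>\<^bsub>?M\<^esub> w [^]\<^bsub>?M\<^esub> j') \<otimes>\<^bsub>?M\<^esub> (t [^]\<^bsub>?M\<^esub> i \<otimes>\<^bsub>?M\<^esub> u)"
    unfolding U_def using c by (simp add: M.m_ac flip: M.nat_pow_mult)
  also have "\<dots> = t [^]\<^bsub>?M\<^esub> j \<otimes>\<^bsub>?M\<^esub> (t' [^]\<^bsub>?M\<^esub> j' \<otimes>\<^bsub>?M\<^esub> f)"
    unfolding eq[folded t_def, symmetric] w(2) using c by (simp add: M.m_ac M.pow_mult_distrib)
  also have "\<dots> = t [^]\<^bsub>?M\<^esub> (j + i') \<otimes>\<^bsub>?M\<^esub> U'"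
    unfolding eq'' U'_def unfolding w(2) using c by (simp add: M.m_ac M.pow_mult_distrib flip: M.nat_pow_mult)
  finally have fin: "t [^]\<^bsub>?M\<^esub> (i + j') \<otimes>\<^bsub>?M\<^esub> U = t [^]\<^bsub>?M\<^esub> (j + i') \<otimes>\<^bsub>?M\<^esub> U'" .
  have "i + j' \<le> j + i'" by (rule power_unit_unique[OF p tl t(2) U U' fin])
  moreover have "j + i' \<le> i + j'" by (rule power_unit_unique[OF p tl t(2) U' U fin[symmetric]])
  ultimately show "n = int i - int j" using n by linarith
qed

text \<open>As long as the cofactor vanishes at the point, another power of the uniformizer can be split off; the order bound stops this.\<close>

lemma form_factor_local:
  assumes p: "F p = 0" and lm: "local_param F p l m" and A: "is_form UNIV d A" "nz A"
  shows "\<exists>r e C D. is_form UNIV e D \<and> is_form UNIV (d + e) C \<and> C p \<noteq> 0 \<and> D p \<noteq> 0 \<and>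
    (\<forall>v. F v = 0 \<longrightarrow> A v * D v * m v ^ r = l v ^ r * C v)"
proof (rule ccontr)
  assume none: "\<not> ?thesis"
  have all: "\<exists>e C D. is_form UNIV e D \<and> is_form UNIV (d + e) C \<and> D p \<noteq> 0 \<and>
    (\<forall>v. F v = 0 \<longrightarrow> A v * D v * m v ^ r = l v ^ r * C v)" for r
  proof (induction r)
    case 0
    show ?case by (rule exI[of _ 0], rule exI[of _ A], rule exI[of _ "\<lambda>_. 1"]) (simp add: is_form_const A)
  next
    case (Suc r)
    then obtain e C D where CD: "is_form UNIV e D" "is_form UNIV (d + e) C" "D p \<noteq> 0"
      "\<And>v. F v = 0 \<Longrightarrow> A v * D v * m v ^ r = l v ^ r * C v" by blast
    hence "C p = 0" using none by blast
    then obtain e' C' D' where CD': "is_form UNIV e' D'" "is_form UNIV (d + e + e') C'" "D' p \<noteq> 0"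
      "\<And>v. F v = 0 \<Longrightarrow> C v * D' v * m v = l v * C' v" using local_param_divide[OF lm CD(2)] by blast
    have "A v * (D v * D' v) * m v ^ Suc r = l v ^ Suc r * C' v" if "F v = 0" for v
    proof -
      have "A v * (D v * D' v) * m v ^ Suc r = (A v * D v * m v ^ r) * D' v * m v" by (simp add: mult_ac)
      also have "\<dots> = l v ^ r * (C v * D' v * m v)" unfolding CD(4)[OF that] by (simp add: mult_ac)
      also have "\<dots> = l v ^ Suc r * C' v" unfolding CD'(4)[OF that] by (simp add: mult_ac)
      finally show ?thesis .
    qed
    moreover have "is_form UNIV (e + e') (\<lambda>v. D v * D' v)" by (rule is_form_mult[OF CD(1) CD'(1)])
    moreover have "is_form UNIV (d + (e + e')) C'" using CD'(2) by (simp add: add.assoc)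
    ultimately show ?case using CD(3) CD'(3) by (intro exI[of _ "e + e'"] exI[of _ C'] exI[of _ "\<lambda>v. D v * D' v"]) simp
  qed
  obtain N where "\<forall>e C D. is_form UNIV e D \<and> is_form UNIV (d + e) C \<and> D p \<noteq> 0 \<longrightarrow>
        \<not> (\<forall>v. F v = 0 \<longrightarrow> A v * D v * m v ^ N = l v ^ N * C v)"
    using local_param_order_bound[OF lm A(1)] A(2) unfolding nz_def by blast
  thus False using all[of N] by blast
qed

text \<open>The cofactor \<open>C/D\<close> is regular at the point, hence a nonnegative power of the uniformizer times a unit.\<close>

lemma ord_at_ge:
  assumes p: "F p = 0" and lm: "local_param F p l m" and AB: "(A, B) \<in> quots Y" and A: "nz A"
    and CD: "is_form UNIV d C" "is_form UNIV d D" "D p \<noteq> 0"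
    and eq: "\<And>v. F v = 0 \<Longrightarrow> l v ^ n * A v * D v = m v ^ n * B v * C v"
  shows "ord_at Y (vec.span {p}) (frac A B) \<ge> - int n"
proof -
  let ?M = rat_monoid
  note f = local_param_forms[OF lm]
  note tu = uniformizer_local_param[OF p lm]
  have q: "(C, D) \<in> quots Y" by (rule quots_of_nonzero_at[OF CD p])
  have lb: "nz l" "nz m" "nz D" using f p CD(3) by (auto simp: nz_def)
  obtain d' where d': "is_form UNIV d' A" "is_form UNIV d' B" using AB by (auto simp: quots_iff)
  note pw = frac_power[OF tu(3)]
  have tb: "frac l m [^]\<^bsub>?M\<^esub> n \<otimes>\<^bsub>?M\<^esub> frac A B = frac C D"
  proof -
    have "frac l m [^]\<^bsub>?M\<^esub> n \<otimes>\<^bsub>?M\<^esub> frac A B = frac (\<lambda>v. l v ^ n * A v) (\<lambda>v. m v ^ n * B v)"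
      using pw[of n] AB by (simp add: rat_monoid_simps(2) rat_mult_frac)
    also have "\<dots> = frac C D"
      using frac_eq_iff[OF quots_mult[OF conjunct2[OF pw[of n]] AB] q] eq by (simp add: mult_ac)
    finally show ?thesis .
  qed
  have "nz C"
  proof -
    have "is_form UNIV n (\<lambda>v. l v ^ n)" using is_form_power[OF f(1), of n] by simp
    moreover have "nz (\<lambda>v. l v ^ n)" using lb(1) unfolding nz_def by (metis power_not_zero)
    ultimately have "nz (\<lambda>v. l v ^ n * A v * D v)"
      using nz_mult[OF is_form_mult[OF _ d'(1)] CD(2) nz_mult[OF _ d'(1) _ A] lb(3)] by blast
    thus ?thesis using eq unfolding nz_def by (metis mult_zero_right)
  qed
  obtain r e C1 D1 where C1: "is_form UNIV e D1" "is_form UNIV (d + e) C1" "C1 p \<noteq> 0" "D1 p \<noteq> 0"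
    "\<And>v. F v = 0 \<Longrightarrow> C v * D1 v * m v ^ r = l v ^ r * C1 v"
    using form_factor_local[OF p lm CD(1) \<open>nz C\<close>] by blast
  have D2: "is_form UNIV (d + e) (\<lambda>v. D v * D1 v)" by (rule is_form_mult[OF CD(2) C1(1)])
  have q1: "(C1, \<lambda>v. D v * D1 v) \<in> quots Y" by (rule quots_of_nonzero_at[OF C1(2) D2 _ p]) (use CD C1 in simp)
  define u where "u = frac C1 (\<lambda>v. D v * D1 v)"
  have u: "u \<in> local_ring Y (vec.span {p})" "rat_value u (vec.span {p}) \<noteq> 0"
    unfolding u_def using local_ringI[OF q1, of p] rat_value_frac[OF q1, of p] CD C1 p by auto
  have "frac C D = frac (\<lambda>v. l v ^ r * C1 v) (\<lambda>v. m v ^ r * (D v * D1 v))"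
    unfolding frac_eq_iff[OF q quots_mult[OF conjunct2[OF pw[of r]] q1]]
  proof (intro allI impI)
    fix v assume "F v = 0"
    have "C v * (m v ^ r * (D v * D1 v)) = (C v * D1 v * m v ^ r) * D v" by (simp add: mult_ac)
    also have "\<dots> = l v ^ r * C1 v * D v" unfolding C1(5)[OF \<open>F v = 0\<close>] ..
    finally show "C v * (m v ^ r * (D v * D1 v)) = l v ^ r * C1 v * D v" .
  qed
  also have "\<dots> = frac l m [^]\<^bsub>?M\<^esub> r \<otimes>\<^bsub>?M\<^esub> u"
    unfolding u_def using pw[of r] q1 by (simp add: rat_monoid_simps(2) rat_mult_frac)
  finally have "frac l m [^]\<^bsub>?M\<^esub> n \<otimes>\<^bsub>?M\<^esub> frac A B = frac l m [^]\<^bsub>?M\<^esub> r \<otimes>\<^bsub>?M\<^esub> u" using tb by simp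
  from ord_at_eqI[OF p lm frac_in_rat_funs[OF AB] u this] show ?thesis by simp
qed

end

section \<open>Arithmetic of the Singer group\<close>

text \<open>Each chosen element excludes at most \<open>m\<close> elements, itself included, as long as the union does not exhaust \<open>U\<close>.\<close>

lemma greedy_independent:
  assumes fin: "finite U" and refl: "\<And>b. b \<in> U \<Longrightarrow> R b b"
    and deg: "\<And>b. b \<in> U \<Longrightarrow> card {b'\<in>U. R b b'} \<le> m" and size: "t * m < card U + m"
  shows "\<exists>B\<subseteq>U. card B = t \<and> (\<forall>b\<in>B. \<forall>b'\<in>B. b \<noteq> b' \<longrightarrow> \<not> (R b b' \<and> R b' b))"
  using size
proof (induction t)
  case 0 show ?case by (rule exI[of _ "{}"]) simp
next
  case (Suc t)
  hence "t * m < card U + m" by simp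
  then obtain B where B: "B \<subseteq> U" "card B = t" "\<forall>b\<in>B. \<forall>b'\<in>B. b \<noteq> b' \<longrightarrow> \<not> (R b b' \<and> R b' b)"
    using Suc.IH by blast
  have finB: "finite B" using B fin finite_subset by blast
  have "card (\<Union>b\<in>B. {b'\<in>U. R b b'}) \<le> (\<Sum>b\<in>B. card {b'\<in>U. R b b'})" by (rule card_UN_le[OF finB])
  also have "\<dots> \<le> (\<Sum>b\<in>B. m)" by (rule sum_mono) (use deg B in blast)
  also have "\<dots> < card U" using Suc.prems B by simp
  finally have lt: "card (\<Union>b\<in>B. {b'\<in>U. R b b'}) < card U" .
  have "\<exists>b'. b' \<in> U \<and> b' \<notin> (\<Union>b\<in>B. {b'\<in>U. R b b'})"
  proof (rule ccontr)
    assume "\<not> ?thesis"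
    hence "U \<subseteq> (\<Union>b\<in>B. {b'\<in>U. R b b'})" by blast
    hence "card U \<le> card (\<Union>b\<in>B. {b'\<in>U. R b b'})" by (rule card_mono[rotated]) (use fin finB in auto)
    thus False using lt by simp
  qed
  then obtain b' where b': "b' \<in> U" "\<And>b. b \<in> B \<Longrightarrow> \<not> R b b'" by blast
  have "b' \<notin> B" using b' refl by blast
  thus ?case using B b' finB by (intro exI[of _ "insert b' B"]) auto
qed

text \<open>The values at non-fixed points of the involution are taken at least twice.\<close>

lemma card_image_involution:
  assumes fin: "finite S" and \<iota>: "\<And>x. x \<in> S \<Longrightarrow> \<iota> x \<in> S \<and> \<iota> (\<iota> x) = x \<and> h (\<iota> x) = h x"
  shows "2 * card (h ` S) \<le> card S + card {x\<in>S. \<iota> x = x}"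
proof -
  define F where "F = {x\<in>S. \<iota> x = x}"
  define T where "T = S - F"
  have finT: "finite T" "finite F" using fin by (simp_all add: T_def F_def)
  have "card T = (\<Sum>v\<in>h ` T. card {x\<in>T. h x = v})"
    using sum.image_gen[OF finT(1), of "\<lambda>_. 1::nat" h] by simp
  also have "\<dots> \<ge> (\<Sum>v\<in>h ` T. 2)"
  proof (rule sum_mono)
    fix v assume "v \<in> h ` T"
    then obtain x where x: "x \<in> T" "h x = v" by blast
    hence "\<iota> x \<in> T" "\<iota> x \<noteq> x" using \<iota> by (auto simp: T_def F_def)
    hence "{x, \<iota> x} \<subseteq> {x\<in>T. h x = v}" using x \<iota> by (auto simp: T_def)
    hence "card {x, \<iota> x} \<le> card {x\<in>T. h x = v}" by (rule card_mono[rotated]) (use finT in simp)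
    thus "2 \<le> card {x\<in>T. h x = v}" using \<open>\<iota> x \<noteq> x\<close> by simp
  qed
  finally have "2 * card (h ` T) \<le> card T" by simp
  moreover have "card (h ` F) \<le> card F" by (rule card_image_le[OF finT(2)])
  moreover have "card (h ` S) \<le> card (h ` T) + card (h ` F)"
  proof -
    have "h ` S = h ` T \<union> h ` F" by (auto simp: T_def F_def)
    thus ?thesis by (simp add: card_Un_le)
  qed
  moreover have "card S = card T + card F"
  proof -
    have "card F \<le> card S" by (rule card_mono[OF fin]) (auto simp: F_def)
    moreover have "card T = card S - card F" unfolding T_def by (rule card_Diff_subset[OF finT(2)]) (auto simp: F_def)
    ultimately show ?thesis by simp
  qed
  ultimately show ?thesis unfolding F_def by linarith
qed

text \<open>
The points \<open>(g : g\<^bsup>q\<^sup>2+1\<^esup> : 1)\<close> of \<open>\<Pi>\<close> correspond to the roots of unity \<open>g\<close> of order \<open>n2 = N n1\<close>.  The Singer orbits are the cosets of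
the roots of order \<open>N\<close>, and the power \<open>g\<^bsup>q\<^sup>3+1\<^esup>\<close>, a root of unity of order \<open>n1\<close>, tells them apart.
\<close>

locale singer_field =
  fixes q :: nat and \<tau> :: "'k::alg_closed_field"
  assumes \<tau>: "\<tau> ^ (q^2 + q + 1) = 1" and q3: "q > 2" and q0: "of_nat q = (0::'k)"
    and frob: "\<And>x y::'k. (x + y)^q = x^q + y^q"
begin

abbreviation "N \<equiv> q^2 - q + 1"
abbreviation "n1 \<equiv> q^2 + q + 1"
abbreviation "n2 \<equiv> q^4 + q^2 + 1"

lemma q_pos: "q > 0" using q3 by simp

lemma N_add_q: "N + q = q^2 + 1"
proof -
  have "q \<le> q^2" by (simp add: power2_eq_square)
  thus ?thesis by simp
qed

lemma N_q: "q * (q - 1) + 1 = N" by (simp add: power2_eq_square diff_mult_distrib2)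

lemma N_mult: "N * (q + 1) = q^3 + 1"
proof -
  have "N * (q + 1) + q * (q + 1) = (q^2 + 1) * (q + 1)" unfolding N_add_q[symmetric] by (simp only: distrib_right)
  thus ?thesis by (simp add: algebra_simps power2_eq_square power3_eq_cube)
qed

lemma N_n1: "N * n1 = n2"
proof -
  have "N * n1 + q * n1 = (q^2 + 1) * n1" unfolding N_add_q[symmetric] by (simp only: distrib_right)
  thus ?thesis by (simp add: algebra_simps power2_eq_square power3_eq_cube power4_eq_xxxx)
qed

lemma cube_n1: "(q^3 + 1) * n1 = (q + 1) * n2"
  unfolding N_mult[symmetric] N_n1[symmetric] by (simp only: mult_ac)

lemma of_nat_N: "of_nat N = (1::'k)"
proof -
  have "of_nat (N + q) = (of_nat (q^2 + 1) :: 'k)" by (simp only: N_add_q)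
  thus ?thesis using q0 by simp
qed

lemma of_nat_n1: "of_nat n1 = (1::'k)" using q0 by simp

lemma frob_power: "(x + y) ^ (q ^ j) = x ^ (q ^ j) + y ^ (q ^ j)" for x y :: 'k
  by (induction j) (simp_all add: frob power_mult mult.commute[of q])

lemma frob_minus: "(- x) ^ q = - (x ^ q)" for x :: 'k
  using frob[of x "-x"] q_pos by (simp add: power_0_left eq_neg_iff_add_eq_0 add.commute)

lemma frob_diff: "(x - y) ^ q = x ^ q - y ^ q" for x y :: 'k
  using frob[of x "-y"] by (simp add: frob_minus)

lemma frob_inj: "x ^ q = y ^ q \<Longrightarrow> x = y" for x y :: 'k
  using frob_diff[of x y] q_pos by simp

lemma frob_pow_swap: "(x ^ n) ^ q = (x ^ q) ^ n" for x :: 'k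
  by (simp add: mult.commute flip: power_mult)

lemma card_roots_of_unity:
  assumes "of_nat n \<noteq> (0::'k)"
  shows "card {x::'k. x ^ n = 1} = n" "finite {x::'k. x ^ n = 1}"
proof -
  define p :: "'k poly" where "p = monom 1 n - 1"
  have n: "n > 0" using assms by (cases n) auto
  have deg: "degree p = n"
  proof (rule antisym)
    show "degree p \<le> n" unfolding p_def by (rule degree_diff_le) (simp_all add: degree_monom_le)
    show "n \<le> degree p" by (rule le_degree) (use n in \<open>simp add: p_def\<close>)
  qed
  have p0: "p \<noteq> 0" using deg n by auto
  have roots: "{x. poly p x = 0} = {x::'k. x ^ n = 1}" by (auto simp: p_def poly_monom)
  have "card {x. poly p x = 0} = degree p"
  proof (rule card_roots_separable[OF p0])
    fix x assume "poly p x = 0"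
    hence "x \<noteq> 0" using n by (auto simp: p_def poly_monom power_0_left)
    thus "poly (pderiv p) x \<noteq> 0" using assms by (simp add: p_def pderiv_diff pderiv_monom poly_monom)
  qed
  thus "card {x::'k. x ^ n = 1} = n" unfolding roots deg .
  show "finite {x::'k. x ^ n = 1}" unfolding roots[symmetric] using poly_roots_finite[OF p0] .
qed

text \<open>
The Singer difference set of a plane of order \<open>q\<close>: an orbit with invariant \<open>y\<close> lies on \<open>H\<^sub>t\<close> if and only if
\<open>t y\<close> belongs to it.
\<close>

definition Dq :: "'k set" where "Dq = {y. y ^ (q + 1) + y ^ q + 1 = 0}"

lemma Dq_nonzero: "y \<in> Dq \<Longrightarrow> y \<noteq> 0" using q_pos by (auto simp: Dq_def power_0_left)

lemma card_Dq: "card Dq = q + 1" and finite_Dq: "finite Dq"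
proof -
  define p :: "'k poly" where "p = monom 1 (q + 1) + monom 1 q + 1"
  have deg: "degree p = q + 1"
  proof (rule antisym)
    show "degree p \<le> q + 1" unfolding p_def
      by (intro degree_add_le) (auto intro: degree_monom_le order.trans[OF degree_monom_le])
    show "q + 1 \<le> degree p" by (rule le_degree) (use q_pos in \<open>simp add: p_def\<close>)
  qed
  have p0: "p \<noteq> 0" using deg by auto
  have roots: "{x. poly p x = 0} = Dq" by (auto simp: p_def poly_monom Dq_def)
  have "card {x. poly p x = 0} = degree p"
  proof (rule card_roots_separable[OF p0])
    fix x assume "poly p x = 0"
    hence "x \<noteq> 0" using roots Dq_nonzero by blast
    thus "poly (pderiv p) x \<noteq> 0" using q0 by (simp add: p_def pderiv_add pderiv_monom poly_monom)
  qed
  thus "card Dq = q + 1" unfolding roots deg .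
  show "finite Dq" unfolding roots[symmetric] using poly_roots_finite[OF p0] .
qed

text \<open>Applying Frobenius to \<open>y\<^sup>q (y + 1) = -1\<close> and substituting the equation again gives \<open>y \<cdot> y\<^sup>q \<cdot> y\<^bsup>q\<^sup>2\<^esup> = 1\<close>.\<close>

lemma Dq_unity: assumes "y \<in> Dq" shows "y ^ n1 = 1"
proof -
  have 1: "y ^ q * (y + 1) = - 1" using assms by (simp add: Dq_def algebra_simps eq_neg_iff_add_eq_0)
  have "(y ^ q * (y + 1)) ^ q = - 1" unfolding 1 frob_minus by simp
  hence 2: "(y ^ q) ^ q * (y ^ q + 1) = - 1" by (simp add: power_mult_distrib frob)
  have "y ^ q + 1 = - (y * y ^ q)" using 1 by (simp add: algebra_simps eq_neg_iff_add_eq_0)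
  hence "(y ^ q) ^ q * (y * y ^ q) = 1" using 2 by simp
  moreover have "y ^ n1 = (y ^ q) ^ q * (y * y ^ q)"
    by (simp add: power_add power2_eq_square power_mult mult_ac)
  ultimately show ?thesis by simp
qed

text \<open>On the roots of unity of the odd order \<open>n1\<close>, the exponent \<open>q\<^sup>3 + 1\<close> acts as \<open>2\<close>, which is invertible.\<close>

lemma root_of_unity_has_root:
  fixes z :: 'k
  assumes "z ^ n1 = 1"
  obtains s where "s ^ n1 = 1" "s ^ (q^3 + 1) = z"
proof -
  \<comment> \<open>The inverse of \<open>2\<close> modulo \<open>n1\<close>.\<close>
  define h where "h = (q^2 + q) div 2 + 1"
  have "even (q^2 + q)" by simp
  hence h: "2 * h = n1 + 1" unfolding h_def by auto
  have "(q - 1) * n1 + 1 = q^3"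
    using q_pos by (cases q) (simp_all add: algebra_simps power2_eq_square power3_eq_cube)
  hence "z ^ (q^3) = z ^ ((q - 1) * n1 + 1)" by simp
  also have "\<dots> = (z ^ n1) ^ (q - 1) * z" by (simp only: power_add power_mult power_one_right mult.commute[of "q - 1"])
  also have "\<dots> = z" unfolding assms by simp
  finally have zq: "z ^ (q^3) = z" .
  have "(z ^ h) ^ (q^3 + 1) = (z ^ (q^3)) ^ h * z ^ h" by (simp add: power_add mult.commute flip: power_mult)
  also have "\<dots> = z ^ (2 * h)" unfolding zq by (simp add: mult_2 power_add)
  also have "\<dots> = z ^ n1 * z" unfolding h by (simp only: power_add power_one_right)
  also have "\<dots> = z" unfolding assms by simp
  finally have "(z ^ h) ^ (q^3 + 1) = z" .
  moreover have "(z ^ h) ^ n1 = 1"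
    using assms by (metis mult.commute power_mult power_one)
  ultimately show ?thesis using that by blast
qed

lemma unity_N_cube: "u ^ N = 1 \<Longrightarrow> u ^ (q^3 + 1) = 1" for u :: 'k
  unfolding N_mult[symmetric] by (simp only: power_mult power_one)

lemma unity_N_n2: "u ^ N = 1 \<Longrightarrow> u ^ n2 = 1" for u :: 'k
  unfolding N_n1[symmetric] by (simp only: power_mult power_one)

lemma unity_n1_n2: "u ^ n1 = 1 \<Longrightarrow> u ^ n2 = 1" for u :: 'k
  unfolding N_n1[symmetric] by (subst mult.commute) (simp only: power_mult power_one)

lemma unity_n2_cube_n1:
  fixes g :: 'k
  assumes "g ^ n2 = 1"
  shows "(g ^ (q^3 + 1)) ^ n1 = 1"
proof -
  have "(g ^ (q^3 + 1)) ^ n1 = g ^ ((q + 1) * n2)" by (simp only: cube_n1 flip: power_mult)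
  also have "\<dots> = (g ^ n2) ^ (q + 1)" by (simp only: power_mult mult.commute[of "q + 1"])
  also have "\<dots> = 1" unfolding assms by simp
  finally show ?thesis .
qed

text \<open>Indeed \<open>n2 = N n1\<close>, \<open>q\<^sup>3 + 1 = N (q + 1)\<close>, and \<open>n1 = (q + 1) q + 1\<close> is coprime to \<open>q + 1\<close>.\<close>

lemma unity_gcd:
  fixes g :: 'k
  assumes "g ^ n2 = 1" "g ^ (q^3 + 1) = 1"
  shows "g ^ N = 1"
proof -
  have g0: "g \<noteq> 0" using assms(1) by auto
  define w where "w = g ^ N"
  have 1: "w ^ (q + 1) = 1" using assms(2) by (simp only: w_def N_mult flip: power_mult)
  have 2: "w ^ n1 = 1" using assms(1) by (simp only: w_def N_n1 flip: power_mult)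
  have "n1 = (q + 1) * q + 1" by (simp add: power2_eq_square)
  hence "w ^ n1 = (w ^ (q + 1)) ^ q * w" by (simp only: power_add power_mult power_one_right)
  hence "w = 1" unfolding 1 2 by simp
  thus ?thesis by (simp only: w_def)
qed

lemma unity_n2_frob6:
  fixes x :: 'k
  assumes "x ^ n2 = 1"
  shows "x ^ (q^6) = x"
proof -
  have "q \<noteq> 0" using q_pos by simp
  then obtain r where r: "q^2 = Suc r" using not0_implies_Suc by (metis power_not_zero)
  have "q^6 = n2 * (q^2 - 1) + 1"
  proof -
    have "q^6 = (Suc r)^3" "q^4 = (Suc r)^2" unfolding r[symmetric] by (simp_all flip: power_mult)
    thus ?thesis unfolding r by (simp add: algebra_simps power2_eq_square power3_eq_cube)
  qed
  hence "x ^ (q^6) = (x ^ n2) ^ (q^2 - 1) * x" by (simp only: power_add power_mult power_one_right)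
  thus ?thesis using assms by simp
qed

text \<open>
Scaling by \<open>s\<close> moves the line with parameter \<open>s\<close> to the line \<open>x + x\<^bsup>q\<^sup>2+1\<^esup> + 1 = 0\<close> and the curve \<open>H\<^sub>\<tau>\<close> to \<open>H\<^sub>\<kappa>\<close>, where
\<open>\<kappa> = \<tau> / s\<^bsup>q\<^sup>3+1\<^esup>\<close> depends only on the Singer orbit of the line.  Eliminating the conjugates of \<open>x\<close> between the two equations
leaves this equation of degree \<open>q + 1\<close> for the points of intersection.
\<close>

definition Xk :: "'k \<Rightarrow> 'k set" where
  "Xk \<kappa> = {x. \<kappa>^(q+1) * x^(q+1) - \<kappa>^q * x^q + (\<kappa>^(q+1) + 1) * x + 1 = 0}"

text \<open>
A double root would satisfy \<open>(\<kappa> x)\<^sup>q = 1\<close>, and this makes the line tangent, which is the excluded case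
\<open>\<kappa>\<^bsup>q+1\<^esup> + \<kappa> + 1 = 0\<close>.
\<close>

lemma card_Xk:
  assumes \<kappa>: "\<kappa> \<noteq> 0" and sec: "\<kappa>^(q+1) + \<kappa> + 1 \<noteq> 0"
  shows "card (Xk \<kappa>) = q + 1" "finite (Xk \<kappa>)"
proof -
  define p :: "'k poly" where "p = monom (\<kappa>^(q+1)) (q+1) - monom (\<kappa>^q) q + [:1, \<kappa>^(q+1) + 1:]"
  have deg: "degree p = q + 1"
  proof (rule antisym)
    show "degree p \<le> q + 1" unfolding p_def using q_pos
      by (intro degree_add_le degree_diff_le) (auto intro: degree_monom_le order.trans[OF degree_monom_le])
    show "q + 1 \<le> degree p"
      by (rule le_degree) (use q_pos \<kappa> in \<open>auto simp: p_def coeff_pCons split: nat.splits\<close>)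
  qed
  have p0: "p \<noteq> 0" using deg by auto
  have px: "poly p x = \<kappa>^(q+1) * x^(q+1) - \<kappa>^q * x^q + (\<kappa>^(q+1) + 1) * x + 1" for x
    by (simp add: p_def poly_monom algebra_simps)
  have dpx: "poly (pderiv p) x = \<kappa>^(q+1) * x^q + \<kappa>^(q+1) + 1" for x
    using q0 by (simp add: p_def pderiv_add pderiv_diff pderiv_monom pderiv_pCons poly_monom)
  have roots: "{x. poly p x = 0} = Xk \<kappa>" by (auto simp: px Xk_def)
  have "card {x. poly p x = 0} = degree p"
  proof (rule card_roots_separable[OF p0], rule notI)
    fix x assume x: "poly p x = 0" "poly (pderiv p) x = 0"
    have "poly p x - x * poly (pderiv p) x = 1 - (\<kappa> * x)^q"
      unfolding px dpx by (simp add: algebra_simps power_mult_distrib)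
    hence kx: "(\<kappa> * x)^q = 1" using x by simp
    have "\<kappa>^(q+1) * x^q = \<kappa> * (\<kappa> * x)^q" by (simp add: power_mult_distrib)
    hence "poly (pderiv p) x = \<kappa>^(q+1) + \<kappa> + 1" unfolding dpx kx by simp
    thus False using sec x(2) by simp
  qed
  thus "card (Xk \<kappa>) = q + 1" unfolding roots deg .
  show "finite (Xk \<kappa>)" unfolding roots[symmetric] using poly_roots_finite[OF p0] .
qed

text \<open>
Every root is a point of \<open>\<Pi>\<close> on the line and on \<open>H\<^sub>\<kappa>\<close>.  Write \<open>u, u', z\<close> for \<open>x\<^sup>q\<close>, \<open>x\<^bsup>q\<^sup>2\<^esup>\<close>, \<open>x\<^bsup>q\<^sup>3\<^esup>\<close> and \<open>K, L\<close> for the conjugates of \<open>\<kappa>\<close>;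
all four claims are rational consequences of the equation and its conjugates, with \<open>\<kappa> K L = 1\<close>.  The last claim is a
relation symmetric in \<open>x\<close> and \<open>z\<close>.
\<close>

lemma Xk_point:
  assumes \<kappa>: "\<kappa> ^ n1 = 1" and sec: "\<kappa>^(q+1) + \<kappa> + 1 \<noteq> 0" and x: "x \<in> Xk \<kappa>"
  shows "x ^ (q^2 + 1) + x + 1 = 0" "x ^ n2 = 1" "\<kappa> * x ^ (q^3 + 1) \<in> Dq"
    and "(\<kappa>^(q+1) + 1) * (x * x^(q^3)) + x + x^(q^3) + 1 + \<kappa>^q = 0"
proof -
  define u where "u = x ^ q"
  define u' where "u' = u ^ q"
  define z where "z = u' ^ q"
  define K where "K = \<kappa> ^ q"
  define L where "L = K ^ q"
  have xq: "x ^ (q^2) = u'" "x ^ (q^3) = z" "x ^ (q^4) = z ^ q"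
    by (simp_all add: u_def u'_def z_def power2_eq_square power3_eq_cube power4_eq_xxxx power_mult)
  have kkl: "\<kappa> * K * L = 1"
    using \<kappa> by (simp add: K_def L_def power_add power2_eq_square power_mult mult_ac)
  have R: "u * K * (\<kappa> * x - 1) + (\<kappa> * K + 1) * x + 1 = 0"
    using x by (simp add: Xk_def K_def u_def algebra_simps)
  hence "(u * K * (\<kappa> * x - 1) + (\<kappa> * K + 1) * x + 1) ^ q = 0" using q_pos by simp
  hence R': "u' * L * (K * u - 1) + (K * L + 1) * u + 1 = 0"
    by (simp add: frob frob_diff power_mult_distrib flip: u_def u'_def K_def L_def)
  have x0: "x \<noteq> 0" using R q_pos by (auto simp: u_def power_0_left)
  have Ku: "K * u \<noteq> 1"
  proof
    assume Ku: "K * u = 1"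
    have "u * K * (\<kappa> * x - 1) + (\<kappa> * K + 1) * x + 1 = (K * u) * (\<kappa> * x - 1) + (\<kappa> * K + 1) * x + 1"
      by (simp only: mult_ac)
    also have "\<dots> = x * (\<kappa>^(q+1) + \<kappa> + 1)" unfolding Ku by (simp add: K_def algebra_simps)
    finally show False using R x0 sec by simp
  qed
  have L0: "L \<noteq> 0" using kkl by auto
  have \<kappa>K: "\<kappa> * K \<noteq> 0" using kkl by auto
  have "\<kappa> * K * (x * ((K * L + 1) * u + 1) - (x + 1) * L * (K * u - 1))
      = (\<kappa> * K * L) * (K * x * u - (x + 1) * (K * u - 1)) + \<kappa> * K * x * u + \<kappa> * K * x"
    by (simp add: algebra_simps)
  also have "\<dots> = u * K * (\<kappa> * x - 1) + (\<kappa> * K + 1) * x + 1" unfolding kkl by (simp add: algebra_simps)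
  finally have id: "x * ((K * L + 1) * u + 1) = (x + 1) * L * (K * u - 1)" using R \<kappa>K by simp
  have "(u' * x + (x + 1)) * (L * (K * u - 1)) = x * (u' * L * (K * u - 1)) + (x + 1) * L * (K * u - 1)"
    by (simp add: algebra_simps)
  also have "\<dots> = x * (u' * L * (K * u - 1) + (K * L + 1) * u + 1)" unfolding id[symmetric] by (simp add: algebra_simps)
  finally have E1: "u' * x + (x + 1) = 0" using R' L0 Ku by simp
  show "x ^ (q^2 + 1) + x + 1 = 0" using E1 by (simp add: xq power_add add.assoc mult.commute)
  have E2: "z * u + (u + 1) = 0"
  proof -
    have "(u' * x + (x + 1)) ^ q = 0" using E1 q_pos by simp
    thus ?thesis by (simp add: frob power_mult_distrib flip: u_def u'_def z_def)
  qed
  have "(z * u + (u + 1)) ^ q = 0" using E2 q_pos by simp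
  hence E3: "z ^ q * u' + (u' + 1) = 0" by (simp add: frob power_mult_distrib flip: u'_def)
  have ux: "u' * x = - (x + 1)" using E1 by (simp only: eq_neg_iff_add_eq_0)
  have "z ^ q * (u' * x) + u' * x + x = x * (z ^ q * u' + (u' + 1))" by (simp add: algebra_simps)
  hence "z ^ q * (- (x + 1)) + - (x + 1) + x = 0" unfolding ux E3 by simp
  moreover have "z ^ q * (x + 1) + 1 = - (z ^ q * (- (x + 1)) + - (x + 1) + x)" by (simp add: algebra_simps)
  ultimately have E4: "z ^ q * (x + 1) = - 1" by (simp only: eq_neg_iff_add_eq_0) simp
  have "x ^ n2 = x * (z ^ q * u')" by (simp add: power_add xq mult_ac)
  also have "z ^ q * u' = - (u' + 1)" using E3 by (simp only: eq_neg_iff_add_eq_0)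
  also have "x * - (u' + 1) = - (u' * x + (x + 1)) + 1" by (simp add: algebra_simps)
  finally show "x ^ n2 = 1" using E1 by simp
  have u0: "u \<noteq> 0" using x0 by (simp add: u_def)
  have zu: "z * u = - (u + 1)" using E2 by (simp only: eq_neg_iff_add_eq_0)
  define y where "y = \<kappa> * x ^ (q^3 + 1)"
  have y: "y = \<kappa> * x * z" by (simp add: y_def power_add xq mult_ac)
  have yq: "y ^ q = K * u * z ^ q" by (simp add: y power_mult_distrib K_def u_def)
  have "(y ^ (q + 1) + y ^ q + 1) * ((x + 1) * u) = K * u * (z ^ q * (x + 1)) * (\<kappa> * x * (z * u) + u) + (x + 1) * u"
    unfolding power_add yq power_one_right unfolding y by (simp add: algebra_simps)
  also have "\<dots> = u * (u * K * (\<kappa> * x - 1) + (\<kappa> * K + 1) * x + 1)" unfolding E4 zu by (simp add: algebra_simps)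
  also have "\<dots> = 0" using R by simp
  finally have "y ^ (q + 1) + y ^ q + 1 = 0" using E4 u0 by auto
  thus "\<kappa> * x ^ (q^3 + 1) \<in> Dq" by (simp add: Dq_def y_def)
  have "((\<kappa> * K + 1) * (x * z) + x + z + 1 + K) * u = (\<kappa> * K + 1) * x * (z * u) + x * u + z * u + (1 + K) * u"
    by (simp add: algebra_simps)
  also have "\<dots> = - (u * K * (\<kappa> * x - 1) + (\<kappa> * K + 1) * x + 1)" unfolding zu by (simp add: algebra_simps)
  finally have "(\<kappa> * K + 1) * (x * z) + x + z + 1 + K = 0" using R u0 by simp
  thus "(\<kappa>^(q+1) + 1) * (x * x^(q^3)) + x + x^(q^3) + 1 + \<kappa>^q = 0" by (simp add: xq K_def)
qed

text \<open>
For two points of equal invariant the products \<open>x x\<^bsup>q\<^sup>3\<^esup>\<close> agree; by the symmetric relation so do the sums, and hence the two pairs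
are the roots of one quadratic equation.
\<close>

lemma Xk_same_orbit:
  assumes \<kappa>: "\<kappa> ^ n1 = 1" and sec: "\<kappa>^(q+1) + \<kappa> + 1 \<noteq> 0" and x: "x \<in> Xk \<kappa>" "x' \<in> Xk \<kappa>"
    and eq: "x ^ (q^3 + 1) = x' ^ (q^3 + 1)"
  shows "x' = x \<or> x' = x ^ (q^3)"
proof -
  define z z' where "z = x ^ (q^3)" and "z' = x' ^ (q^3)"
  have p: "x * z = x' * z'" using eq by (simp add: z_def z'_def)
  have "(\<kappa>^(q+1) + 1) * (x * z) + x + z + 1 + \<kappa>^q = 0"
    unfolding z_def by (rule Xk_point(4)[OF \<kappa> sec x(1)])
  moreover have "(\<kappa>^(q+1) + 1) * (x' * z') + x' + z' + 1 + \<kappa>^q = 0"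
    unfolding z'_def by (rule Xk_point(4)[OF \<kappa> sec x(2)])
  ultimately have "(\<kappa>^(q+1) + 1) * (x * z) + (x + z) + (1 + \<kappa>^q) = (\<kappa>^(q+1) + 1) * (x * z) + (x' + z') + (1 + \<kappa>^q)"
    unfolding p by (simp only: add.assoc)
  hence s: "x + z = x' + z'" by (simp only: add_left_cancel add_right_cancel)
  have "(x' - x) * (x' - z) = x' * x' - x' * (x + z) + x * z" by (simp add: algebra_simps)
  also have "\<dots> = 0" unfolding s p by (simp add: algebra_simps)
  finally show ?thesis by (auto simp: z_def)
qed

text \<open>The points of the line with parameter \<open>1\<close>.\<close>

definition D0 :: "'k set" where "D0 = {x. x ^ (q^2 + 1) + x + 1 = 0}"

lemma poly_roots_card_le:
  fixes f :: "'k \<Rightarrow> 'k"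
  assumes "\<And>x. poly p x = f x" "degree p \<le> n" "p \<noteq> 0"
  shows "card {x. f x = 0} \<le> n" "finite {x. f x = 0}"
  using card_poly_roots_bound[OF assms(3)] poly_roots_finite[OF assms(3)] assms(1,2) by auto

lemma card_trinomial_roots:
  "card {x::'k. x ^ Suc n + x + 1 = 0} \<le> Suc n" "finite {x::'k. x ^ Suc n + x + 1 = 0}" if "n > 0"
proof -
  define p :: "'k poly" where "p = monom 1 (Suc n) + [:1, 1:]"
  have "degree p \<le> Suc n" unfolding p_def
    by (intro degree_add_le) (auto intro: degree_monom_le)
  moreover have "coeff p (Suc n) = 1" using that by (simp add: p_def coeff_pCons split: nat.split)
  hence "p \<noteq> 0" by auto
  moreover have "poly p x = x ^ Suc n + x + 1" for x by (simp add: p_def poly_monom algebra_simps)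
  ultimately show "card {x::'k. x ^ Suc n + x + 1 = 0} \<le> Suc n" "finite {x::'k. x ^ Suc n + x + 1 = 0}"
    using poly_roots_card_le[of p "\<lambda>x. x ^ Suc n + x + 1" "Suc n"] by auto
qed

text \<open>
Count the Singer orbits of lines to be avoided, out of \<open>q\<^sup>2 + q + 1\<close>.  At most \<open>q + 1\<close> are tangent.  The orbits of lines through a given
orbit of points arise from the \<open>q\<^sup>2 + 1\<close> points \<open>x\<close> of the line with parameter \<open>1\<close>, but \<open>x\<close> and its conjugate \<open>x\<^bsup>q\<^sup>3\<^esup>\<close> give the same one;
as at most \<open>q + 1\<close> of these points are self-conjugate, there are at most \<open>(q\<^sup>2 + q + 2) / 2\<close> of them.
\<close>

lemma exists_external_secant:
  assumes y0: "y0 \<in> Dq"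
  obtains \<kappa> where "\<kappa> ^ n1 = 1" "\<kappa>^(q+1) + \<kappa> + 1 \<noteq> 0" "\<And>x. x \<in> Xk \<kappa> \<Longrightarrow> \<kappa> * x ^ (q^3 + 1) \<noteq> y0"
proof -
  \<comment> \<open>If the secant of \<open>\<kappa>\<close> meets the orbit \<open>y0\<close> in the point \<open>x\<close>, then \<open>\<kappa> = h x\<close>.\<close>
  define h where "h = (\<lambda>x::'k. y0 / x ^ (q^3 + 1))"
  define B1 where "B1 = {\<kappa>::'k. \<kappa>^Suc q + \<kappa> + 1 = 0}"
  have D0': "D0 = {x::'k. x ^ Suc (q^2) + x + 1 = 0}" by (simp add: D0_def)
  have finD0: "finite D0" "card D0 \<le> q^2 + 1" unfolding D0' using card_trinomial_roots[of "q^2"] q_pos by auto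
  have B1: "finite B1" "card B1 \<le> q + 1" unfolding B1_def using card_trinomial_roots[of q] q_pos by auto
  have D0_eq: "(x ^ q) ^ q * x + x + 1 = 0" if "x \<in> D0" for x
    using that by (simp add: D0_def power2_eq_square power_mult mult.commute)
  have frobD0: "x ^ q \<in> D0" if "x \<in> D0" for x
  proof -
    have "(x ^ (q^2 + 1) + x + 1) ^ q = 0" using that q_pos by (simp add: D0_def)
    thus ?thesis by (simp add: D0_def frob frob_pow_swap del: power_Suc)
  qed
  have n2D0: "x ^ n2 = 1" if "x \<in> D0" for x
  proof -
    define w where "w = (x ^ q) ^ q"
    have 1: "w * x + x + 1 = 0" using D0_eq[OF that] by (simp add: w_def)
    have 2: "(w ^ q) ^ q * w + w + 1 = 0" using D0_eq[OF frobD0[OF frobD0[OF that]]] by (simp add: w_def)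
    have "x ^ n2 = x * ((w ^ q) ^ q * w)"
      by (simp add: w_def power_add power2_eq_square power4_eq_xxxx power_mult mult_ac)
    also have "(w ^ q) ^ q * w = - (w + 1)" using 2 by (simp only: eq_neg_iff_add_eq_0 add.assoc)
    also have "x * - (w + 1) = - (w * x + x + 1) + 1" by (simp add: algebra_simps)
    finally show ?thesis using 1 by simp
  qed
  have cube: "x ^ (q^3) = ((x ^ q) ^ q) ^ q" for x :: 'k by (simp add: power3_eq_cube power_mult)
  have inv: "x ^ (q^3) \<in> D0 \<and> (x ^ (q^3)) ^ (q^3) = x \<and> h (x ^ (q^3)) = h x" if "x \<in> D0" for x
  proof -
    have "x ^ (q^3) \<in> D0" unfolding cube using frobD0 that by blast
    moreover have e: "(x ^ (q^3)) ^ (q^3) = x"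
      using unity_n2_frob6[OF n2D0[OF that]] by (simp flip: power_mult power_add)
    moreover have "(x ^ (q^3)) ^ (q^3 + 1) = x ^ (q^3 + 1)" unfolding power_add e by (simp add: mult.commute)
    ultimately show ?thesis by (simp add: h_def)
  qed
  have "{x\<in>D0. x ^ (q^3) = x} \<subseteq> Dq"
  proof
    fix x assume x: "x \<in> {x\<in>D0. x ^ (q^3) = x}"
    hence "((x ^ q) ^ q) ^ q = x" by (simp add: cube)
    moreover have "((x ^ q) ^ q) ^ q * x ^ q + x ^ q + 1 = 0" using D0_eq[OF frobD0] x by blast
    ultimately show "x \<in> Dq" by (simp add: Dq_def)
  qed
  hence "card {x\<in>D0. x ^ (q^3) = x} \<le> q + 1" using card_mono[OF finite_Dq] card_Dq by metis
  moreover have "2 * card (h ` D0) \<le> card D0 + card {x\<in>D0. x ^ (q^3) = x}"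
    by (rule card_image_involution[OF finD0(1) inv])
  ultimately have "2 * card (h ` D0) \<le> q^2 + q + 2" using finD0(2) by linarith
  moreover have "card (B1 \<union> h ` D0) \<le> card B1 + card (h ` D0)" by (rule card_Un_le)
  ultimately have "2 * card (B1 \<union> h ` D0) \<le> 2 * (q + 1) + (q^2 + q + 2)"
    using mult_le_mono2[OF B1(2), of 2] by (simp only: distrib_left)
  moreover have "3 * q \<le> q^2" using q3 by (simp add: power2_eq_square)
  moreover have "C < Q + q + 1" if "2 * C \<le> 2 * (q + 1) + (Q + q + 2)" "3 * q \<le> Q" for C Q :: nat
    using that q3 by presburger
  ultimately have "card (B1 \<union> h ` D0) < n1" by blast
  also have "n1 = card {\<kappa>::'k. \<kappa> ^ n1 = 1}" using card_roots_of_unity(1)[of n1] of_nat_n1 by simp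
  finally have "\<not> {\<kappa>::'k. \<kappa> ^ n1 = 1} \<subseteq> B1 \<union> h ` D0"
    using card_mono[of "B1 \<union> h ` D0" "{\<kappa>. \<kappa> ^ n1 = 1}"] B1 finD0 by auto
  then obtain \<kappa> where \<kappa>: "\<kappa> ^ n1 = 1" "\<kappa> \<notin> B1" "\<kappa> \<notin> h ` D0" by blast
  show ?thesis
  proof (rule that[OF \<kappa>(1)])
    show sec: "\<kappa>^(q+1) + \<kappa> + 1 \<noteq> 0" using \<kappa>(2) by (simp add: B1_def)
    fix x assume x: "x \<in> Xk \<kappa>"
    note xp = Xk_point[OF \<kappa>(1) sec x]
    have "x \<in> D0" using xp(1) by (simp add: D0_def)
    moreover have "x \<noteq> 0" using xp(2) by auto
    ultimately show "\<kappa> * x ^ (q^3 + 1) \<noteq> y0" using \<kappa>(3) by (auto simp: h_def image_iff field_simps)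
  qed
qed

text \<open>
Two translates of a secant, by \<open>b\<close> and \<open>b'\<close>, that meet on the curve do so in points that the secant has in a common Singer
orbit; so \<open>b' / b\<close> is the ratio of two conjugate points of the secant, of which there are at most \<open>q + 1\<close>.  Greedily,
\<open>q - 2\<close> translates can be found since \<open>(q - 3) (q + 2) < q\<^sup>2 - q + 1\<close>.
\<close>

lemma exists_disjoint_secants:
  assumes y0: "y0 \<in> Dq"
  obtains S Z where "finite S" "card S = q - 2"
    "\<And>s. s \<in> S \<Longrightarrow> s ^ n2 = 1" "\<And>s. s \<in> S \<Longrightarrow> card (Z s) = q + 1"
    "\<And>s g. s \<in> S \<Longrightarrow> g \<in> Z s \<Longrightarrow> g ^ n2 = 1 \<and> \<tau> * g ^ (q^3 + 1) \<in> Dq \<and> \<tau> * g ^ (q^3 + 1) \<noteq> y0 \<and>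
        s * g + s ^ (q^2 + 1) * g ^ (q^2 + 1) + 1 = 0"
    "\<And>s s'. s \<in> S \<Longrightarrow> s' \<in> S \<Longrightarrow> s \<noteq> s' \<Longrightarrow> Z s \<inter> Z s' = {}"
proof -
  obtain \<kappa> where \<kappa>: "\<kappa> ^ n1 = 1" "\<kappa>^(q+1) + \<kappa> + 1 \<noteq> 0" "\<And>x. x \<in> Xk \<kappa> \<Longrightarrow> \<kappa> * x ^ (q^3 + 1) \<noteq> y0"
    using exists_external_secant[OF y0] by metis
  have \<kappa>0: "\<kappa> \<noteq> 0" using \<kappa>(1) by auto
  have \<tau>0: "\<tau> \<noteq> 0" using \<tau> by auto
  note cardX = card_Xk[OF \<kappa>0 \<kappa>(2)]
  note xp = Xk_point[OF \<kappa>(1,2)]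
  have x0: "x \<noteq> 0" if "x \<in> Xk \<kappa>" for x using xp(2)[OF that] by auto
  have "(\<tau> / \<kappa>) ^ n1 = 1" using \<tau> \<kappa>(1) by (simp add: power_divide)
  then obtain s0 where s0: "s0 ^ n1 = 1" "s0 ^ (q^3 + 1) = \<tau> / \<kappa>" by (rule root_of_unity_has_root)
  define U where "U = {b::'k. b ^ N = 1}"
  have U: "finite U" "card U = N" unfolding U_def using card_roots_of_unity[of N] of_nat_N by auto
  have U0: "b \<noteq> 0" if "b \<in> U" for b using that by (auto simp: U_def)
  \<comment> \<open>Ratios \<open>b' / b\<close> of translates that may meet on the curve; \<open>1\<close> is included to make the relation reflexive.\<close>
  define E where "E = insert 1 ((\<lambda>x. x ^ (q^3) / x) ` Xk \<kappa>)"
  define R where "R = (\<lambda>b b'::'k. b' / b \<in> E)"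
  have finE: "finite E" "card E \<le> q + 2"
  proof -
    have "card ((\<lambda>x. x ^ (q^3) / x) ` Xk \<kappa>) \<le> q + 1" using card_image_le[OF cardX(2)] cardX(1) by metis
    thus "finite E" "card E \<le> q + 2" unfolding E_def using cardX(2) card_insert_le_m1 by (auto intro!: card_insert_le_m1)
  qed
  have "\<exists>B\<subseteq>U. card B = q - 2 \<and> (\<forall>b\<in>B. \<forall>b'\<in>B. b \<noteq> b' \<longrightarrow> \<not> (R b b' \<and> R b' b))"
  proof (rule greedy_independent[OF U(1)])
    fix b assume b: "b \<in> U"
    thus "R b b" using U0 by (simp add: R_def E_def)
    have "{b'\<in>U. R b b'} \<subseteq> (\<lambda>e. b * e) ` E"
    proof
      fix b' assume "b' \<in> {b'\<in>U. R b b'}"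
      thus "b' \<in> (\<lambda>e. b * e) ` E" using U0[OF b] by (intro image_eqI[of _ _ "b' / b"]) (auto simp: R_def)
    qed
    hence "card {b'\<in>U. R b b'} \<le> card ((\<lambda>e. b * e) ` E)" by (rule card_mono[rotated]) (use finE in simp)
    also have "\<dots> \<le> card E" by (rule card_image_le[OF finE(1)])
    finally show "card {b'\<in>U. R b b'} \<le> q + 2" using finE by simp
  next
    obtain r where r: "q = r + 2" using q3 by (metis add.commute le_Suc_ex less_imp_le_nat)
    have "(q - 2) * (q + 2) + 4 = q^2" unfolding r by (simp add: power2_eq_square)
    thus "(q - 2) * (q + 2) < card U + (q + 2)" unfolding U(2) using N_add_q by linarith
  qed
  then obtain B where B: "B \<subseteq> U" "card B = q - 2" "\<And>b b'. b \<in> B \<Longrightarrow> b' \<in> B \<Longrightarrow> b \<noteq> b' \<Longrightarrow> \<not> (R b b' \<and> R b' b)"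
    by blast
  have finB: "finite B" by (rule finite_subset[OF B(1) U(1)])
  have s00: "s0 \<noteq> 0" using s0(1) by auto
  define S where "S = (\<lambda>b. s0 * b) ` B"
  define Z where "Z = (\<lambda>s. (\<lambda>x. x / s) ` Xk \<kappa>)"
  have Sb: "\<exists>b\<in>B. s = s0 * b \<and> b ^ N = 1 \<and> b \<noteq> 0" if "s \<in> S" for s
    using that B(1) U0 by (auto simp: S_def U_def)
  have Sn: "s \<noteq> 0" "s ^ (q^3 + 1) = \<tau> / \<kappa>" "s ^ n2 = 1" if "s \<in> S" for s
  proof -
    obtain b where b: "s = s0 * b" "b ^ N = 1" "b \<noteq> 0" using Sb[OF \<open>s \<in> S\<close>] by blast
    show "s \<noteq> 0" using b s00 by simp
    show "s ^ (q^3 + 1) = \<tau> / \<kappa>" unfolding b(1) power_mult_distrib s0(2) unity_N_cube[OF b(2)] by simp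
    show "s ^ n2 = 1" unfolding b(1) power_mult_distrib unity_n1_n2[OF s0(1)] unity_N_n2[OF b(2)] by simp
  qed
  show ?thesis
  proof (rule that[of S Z])
    show "finite S" unfolding S_def using finB by simp
    have "inj_on (\<lambda>b. s0 * b) B" using s00 by (auto simp: inj_on_def)
    thus "card S = q - 2" unfolding S_def using B(2) by (simp add: card_image)
    fix s assume s: "s \<in> S"
    show "s ^ n2 = 1" by (rule Sn(3)[OF s])
    have "inj_on (\<lambda>x. x / s) (Xk \<kappa>)" using Sn(1)[OF s] by (auto simp: inj_on_def)
    thus "card (Z s) = q + 1" unfolding Z_def using cardX by (simp add: card_image)
    {
      fix g assume "g \<in> Z s"
      then obtain x where x: "x \<in> Xk \<kappa>" "g = x / s" unfolding Z_def by blast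
      have sg: "s * g = x" using x Sn(1)[OF s] by simp
      have "\<tau> * g ^ (q^3 + 1) = \<kappa> * x ^ (q^3 + 1)"
        unfolding x(2) power_divide Sn(2)[OF s] using \<tau>0 \<kappa>0 by simp
      moreover have "g ^ n2 = 1" unfolding x(2) power_divide xp(2)[OF x(1)] Sn(3)[OF s] by simp
      moreover have "s * g + s ^ (q^2 + 1) * g ^ (q^2 + 1) + 1 = 0"
        using xp(1)[OF x(1)] unfolding power_mult_distrib[symmetric] sg by (simp add: add.commute)
      ultimately show "g ^ n2 = 1 \<and> \<tau> * g ^ (q^3 + 1) \<in> Dq \<and> \<tau> * g ^ (q^3 + 1) \<noteq> y0 \<and>
        s * g + s ^ (q^2 + 1) * g ^ (q^2 + 1) + 1 = 0" using xp(3)[OF x(1)] \<kappa>(3)[OF x(1)] by simp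
    }
    fix s' assume s': "s' \<in> S" "s \<noteq> s'"
    show "Z s \<inter> Z s' = {}"
    proof (rule ccontr)
      assume "Z s \<inter> Z s' \<noteq> {}"
      then obtain x x' where x: "x \<in> Xk \<kappa>" "x' \<in> Xk \<kappa>" "x / s = x' / s'" unfolding Z_def by auto
      obtain b b' where b: "b \<in> B" "s = s0 * b" "b \<noteq> 0" and b': "b' \<in> B" "s' = s0 * b'" "b' \<noteq> 0"
        using Sb s s'(1) by blast
      have "(x / s) ^ (q^3 + 1) = (x' / s') ^ (q^3 + 1)" unfolding x(3) ..
      hence eq: "x ^ (q^3 + 1) = x' ^ (q^3 + 1)"
        unfolding power_divide Sn(2)[OF s] Sn(2)[OF s'(1)] using \<tau>0 \<kappa>0 by simp
      have ratio: "b' / b = x' / x" "b / b' = x / x'"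
        using x(3) x0[OF x(1)] x0[OF x(2)] b b' s00 by (auto simp: field_simps)
      have "x' = x \<or> x' = x ^ (q^3)" by (rule Xk_same_orbit[OF \<kappa>(1,2) x(1,2) eq])
      hence "R b b'" unfolding R_def ratio E_def using x(1) x0[OF x(1)] by auto
      moreover have "x = x' \<or> x = x' ^ (q^3)" by (rule Xk_same_orbit[OF \<kappa>(1,2) x(2,1) eq[symmetric]])
      hence "R b' b" unfolding R_def ratio E_def using x(2) x0[OF x(2)] by auto
      moreover have "b \<noteq> b'" using s'(2) b b' by auto
      ultimately show False using B(3) b(1) b'(1) by blast
    qed
  qed
qed

text \<open>
Raising \<open>g\<close> to the exponents modulo its order \<open>n2\<close> turns the equation of the curve, up to a nonzero factor, into the
defining equation of \<open>Dq\<close> at \<open>t g\<^bsup>q\<^sup>3+1\<^esup>\<close>.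
\<close>

lemma Hform_point:
  assumes t: "t ^ n1 = 1" and g: "g ^ n2 = 1"
  shows "Hform q t (vector [g, g ^ (q^2 + 1), 1]) = 0 \<longleftrightarrow> t * g ^ (q^3 + 1) \<in> Dq"
proof -
  define \<delta> where "\<delta> = g ^ (q^3 + 1)"
  have nz: "t \<noteq> 0" "g \<noteq> 0" "\<delta> \<noteq> 0" using t g by (auto simp: \<delta>_def)
  have "q^4 + q + q^2 + 1 = n2 + q" by simp
  have e1: "g ^ (q^2 + 1) * \<delta> ^ q = g ^ q"
  proof -
    have "g ^ (q^2 + 1) * \<delta> ^ q = g ^ (n2 + q)"
      unfolding \<delta>_def by (simp add: algebra_simps power3_eq_cube power4_eq_xxxx flip: power_mult power_add)
    thus ?thesis unfolding power_add[of g n2 q] g by simp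
  qed
  have e2: "t ^ (q^2 + 1) * t ^ q = 1" using t by (simp add: power_add mult_ac)
  have e3: "g * (g ^ (q^2 + 1)) ^ q = g ^ q * \<delta>"
    unfolding \<delta>_def by (simp add: algebra_simps power2_eq_square power3_eq_cube flip: power_mult power_add power_Suc)
  have "(t * \<delta>) ^ q * Hform q t (vector [g, g ^ (q^2 + 1), 1])
     = (t * \<delta>) ^ q * (t * (g * (g ^ (q^2 + 1)) ^ q)) + (t ^ (q^2 + 1) * t ^ q) * (g ^ (q^2 + 1) * \<delta> ^ q) + (t * \<delta>) ^ q * g ^ q"
    unfolding Hform_def vector_3 by (simp add: algebra_simps power_mult_distrib)
  also have "\<dots> = g ^ q * ((t * \<delta>) ^ (q + 1) + (t * \<delta>) ^ q + 1)"
    unfolding e1 e2 e3 by (simp add: algebra_simps)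
  finally show ?thesis using nz unfolding Dq_def \<delta>_def by auto
qed

lemma fibre_coset:
  fixes g0 t :: 'k
  assumes "t \<noteq> 0" "g0 ^ n2 = 1"
  shows "{g. g ^ n2 = 1 \<and> t * g ^ (q^3 + 1) = t * g0 ^ (q^3 + 1)} = (\<lambda>u. g0 * u) ` {u. u ^ N = 1}"
proof (intro equalityI subsetI)
  have g0: "g0 \<noteq> 0" using assms(2) by auto
  fix g assume g: "g \<in> {g. g ^ n2 = 1 \<and> t * g ^ (q^3 + 1) = t * g0 ^ (q^3 + 1)}"
  have "(g / g0) ^ N = 1"
    by (rule unity_gcd) (use g assms g0 in \<open>auto simp: power_divide\<close>)
  thus "g \<in> (\<lambda>u. g0 * u) ` {u. u ^ N = 1}" using g0 by (intro image_eqI[of _ _ "g / g0"]) auto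
next
  fix g assume "g \<in> (\<lambda>u. g0 * u) ` {u. u ^ N = 1}"
  then obtain u where u: "u ^ N = 1" "g = g0 * u" by blast
  thus "g \<in> {g. g ^ n2 = 1 \<and> t * g ^ (q^3 + 1) = t * g0 ^ (q^3 + 1)}"
    unfolding u(2) mem_Collect_eq power_mult_distrib unity_N_cube[OF u(1)] unity_N_n2[OF u(1)] assms(2) by simp
qed

lemma card_hermitian_points:
  assumes t: "t ^ n1 = 1"
  shows "card {g. g ^ n2 = 1 \<and> t * g ^ (q^3 + 1) \<in> Dq} = N * (q + 1)"
    and "finite {g. g ^ n2 = 1 \<and> t * g ^ (q^3 + 1) \<in> Dq}"
proof -
  define A where "A = (\<lambda>y. {g::'k. g ^ n2 = 1 \<and> t * g ^ (q^3 + 1) = y})"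
  have t0: "t \<noteq> 0" using t by auto
  have A: "card (A y) = N \<and> finite (A y)" if "y \<in> Dq" for y
  proof -
    have "(y / t) ^ n1 = 1" using Dq_unity[OF that] t by (simp add: power_divide)
    then obtain g0 where g0: "g0 ^ n1 = 1" "g0 ^ (q^3 + 1) = y / t" by (rule root_of_unity_has_root)
    hence "A y = (\<lambda>u. g0 * u) ` {u. u ^ N = 1}"
      using fibre_coset[OF t0 unity_n1_n2[OF g0(1)]] t0 by (simp add: A_def g0(2) del: power_Suc)
    moreover have "inj_on (\<lambda>u. g0 * u) {u. u ^ N = 1}" using g0 by (auto simp: inj_on_def)
    ultimately show ?thesis using card_roots_of_unity[of N] of_nat_N by (simp add: card_image)
  qed
  have eq: "{g. g ^ n2 = 1 \<and> t * g ^ (q^3 + 1) \<in> Dq} = (\<Union>y\<in>Dq. A y)" by (auto simp: A_def)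
  have "card (\<Union>y\<in>Dq. A y) = (\<Sum>y\<in>Dq. card (A y))"
    by (rule card_UN_disjoint) (use A finite_Dq in \<open>auto simp: A_def\<close>)
  thus "card {g. g ^ n2 = 1 \<and> t * g ^ (q^3 + 1) \<in> Dq} = N * (q + 1)"
    unfolding eq using A card_Dq by simp
  show "finite {g. g ^ n2 = 1 \<and> t * g ^ (q^3 + 1) \<in> Dq}" unfolding eq using A finite_Dq by blast
qed

lemma exists_second_curve:
  assumes t: "t ^ n1 = 1" and g: "g ^ n2 = 1" "t * g ^ (q^3 + 1) \<in> Dq"
  obtains t' where "t' ^ n1 = 1" "t' \<noteq> t" "t' * g ^ (q^3 + 1) \<in> Dq"
proof -
  have "card (Dq - {t * g ^ (q^3 + 1)}) = q" using card_Dq finite_Dq g(2) by simp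
  hence "Dq - {t * g ^ (q^3 + 1)} \<noteq> {}" using q_pos by (metis card.empty less_irrefl)
  then obtain y where y: "y \<in> Dq" "y \<noteq> t * g ^ (q^3 + 1)" by blast
  have g0: "g ^ (q^3 + 1) \<noteq> 0" using g by auto
  show ?thesis
  proof (rule that[of "y / g ^ (q^3 + 1)"])
    show "(y / g ^ (q^3 + 1)) ^ n1 = 1"
      unfolding power_divide Dq_unity[OF y(1)] unity_n2_cube_n1[OF g(1)] by simp
  qed (use y g0 in \<open>auto simp: field_simps\<close>)
qed

end

section \<open>Straightening the plane\<close>

lemma matrix_image_span: "((*v) M) ` vec.span {v} = vec.span {M *v (v :: 'k::field^3)}"
  by (auto simp: vec.span_singleton image_iff vector_scalar_commute)

context singer_field
begin

text \<open>The Frobenius collineation of \<open>\<Pi>\<close>, on vectors.\<close>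

definition Phi :: "'k^3 \<Rightarrow> 'k^3" where
  "Phi v = vector [(v$3)^(q^2), (v$1)^(q^2), (v$2)^(q^2)]"

definition frob2 :: "'k^3 \<Rightarrow> 'k^3" where
  "frob2 v = vector [(v$1)^(q^2), (v$2)^(q^2), (v$3)^(q^2)]"

abbreviation pi_vec :: "'k \<Rightarrow> 'k^3" where
  "pi_vec g \<equiv> vector [g, g ^ (q^2 + 1), 1]"

lemma pi_vec_simps [simp]: "pi_vec g $ 1 = g" "pi_vec g $ 2 = g ^ (q^2 + 1)" "pi_vec g $ 3 = 1"
  by (simp_all add: vector_3)

lemma pi_vec_nonzero: "pi_vec g \<noteq> 0" by (simp add: vec3_eq_iff)

lemma Phi_simps [simp]: "Phi v $ 1 = (v$3)^(q^2)" "Phi v $ 2 = (v$1)^(q^2)" "Phi v $ 3 = (v$2)^(q^2)"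
  by (simp_all add: Phi_def vector_3)

lemma frob2_simps [simp]: "frob2 v $ 1 = (v$1)^(q^2)" "frob2 v $ 2 = (v$2)^(q^2)" "frob2 v $ 3 = (v$3)^(q^2)"
  by (simp_all add: frob2_def vector_3)

lemma frob2_add: "(x + y)^(q^2) = x^(q^2) + y^(q^2)" for x y :: 'k
  by (rule frob_power)

lemma frob2_fixed_iff: "frob2 v = v \<longleftrightarrow> (\<forall>i. v $ i \<in> GF (q^2))"
  by (auto simp: vec3_eq_iff GF_def forall_3)

lemma pow_q24: "x ^ (q^4) = (x ^ (q^2)) ^ (q^2)" "x ^ (q^6) = ((x ^ (q^2)) ^ (q^2)) ^ (q^2)" for x :: 'k
  by (simp_all flip: power_mult power_add)

lemma q2_factor: "x ^ (q^2) = x * x ^ (q^2 - 1)" for x :: 'k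
proof -
  have "q^2 = Suc (q^2 - 1)" using q_pos by simp
  thus ?thesis by (metis power_Suc)
qed

text \<open>By a Hilbert 90 argument a vector of a fixed point can be scaled to a fixed vector: take a \<open>(q\<^sup>2 - 1)\<close>-th root of \<open>g\<close>.\<close>

lemma pi_vec_normalize:
  assumes "g ^ n2 = 1"
  obtains x where "x \<noteq> 0" "Phi (x *s pi_vec g) = x *s pi_vec g"
proof -
  have g0: "g \<noteq> 0" using assms by auto
  have "q^2 - 1 > 0" using q3 one_less_power[of q 2] by simp
  then obtain x where x: "x ^ (q^2 - 1) = g" using nth_root_exists by blast
  have x0: "x \<noteq> 0" using x g0 \<open>q^2 - 1 > 0\<close> by (auto simp: power_0_left)
  have x2: "x ^ (q^2) = x * g" using q2_factor[of x] x by simp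
  have x4: "(x * g) ^ (q^2) = x * g ^ (q^2 + 1)" by (simp add: power_mult_distrib x2 power_add mult_ac)
  have "(x * g ^ (q^2 + 1)) ^ (q^2) = x * g * ((g ^ (q^2)) ^ (q^2) * g ^ (q^2))"
    by (simp add: power_mult_distrib x2 power_add mult_ac)
  also have "\<dots> = x * g ^ n2" by (simp add: power_add mult_ac flip: pow_q24)
  finally have "(x * g ^ (q^2 + 1)) ^ (q^2) = x" using assms by simp
  with x0 x2 x4 show ?thesis by (intro that[of x]) (simp_all add: vec3_eq_iff)
qed

lemma Phi_fixed_imp_pi_vec:
  assumes "Phi w = w" "w \<noteq> 0"
  obtains x g where "x \<noteq> 0" "g ^ n2 = 1" "w = x *s pi_vec g"
proof -
  define x where "x = w $ 3"
  have w: "w $ 1 = x ^ (q^2)" "w $ 2 = (x ^ (q^2)) ^ (q^2)" "((x ^ (q^2)) ^ (q^2)) ^ (q^2) = x"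
    using assms(1) by (simp_all add: vec3_eq_iff x_def)
  have x0: "x \<noteq> 0" using assms(2) w x_def q_pos by (auto simp: vec3_eq_iff power_0_left)
  define g where "g = x ^ (q^2 - 1)"
  have x2: "x ^ (q^2) = x * g" unfolding g_def by (rule q2_factor)
  have x4: "(x * g) ^ (q^2) = x * g ^ (q^2 + 1)" by (simp add: power_mult_distrib x2 power_add mult_ac)
  have "(x * g ^ (q^2 + 1)) ^ (q^2) = x * g * ((g ^ (q^2)) ^ (q^2) * g ^ (q^2))"
    by (simp add: power_mult_distrib x2 power_add mult_ac)
  also have "\<dots> = x * g ^ n2" by (simp add: power_add mult_ac flip: pow_q24)
  finally have "x * g ^ n2 = x" using w(3) unfolding x2 x4 by simp
  hence "g ^ n2 = 1" using x0 by simp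
  moreover have "w = x *s pi_vec g"
  proof -
    have "w $ 1 = x * g" using w(1) unfolding x2 .
    moreover have "w $ 2 = x * g ^ (q^2 + 1)" using w(2) unfolding x2 x4 .
    ultimately show ?thesis unfolding vec3_eq_iff using x_def by (simp del: power_Suc)
  qed
  ultimately show ?thesis using that x0 by blast
qed

lemma exists_theta:
  obtains \<theta> :: 'k where "\<theta> ^ (q^6) = \<theta>" "\<theta> ^ (q^2) \<noteq> \<theta>"
proof -
  have "card {u::'k. u ^ N = 1} = N" using card_roots_of_unity[of N] of_nat_N by simp
  moreover have "N \<noteq> 1" unfolding N_q[symmetric] using q3 by simp
  ultimately have "card {u::'k. u ^ N = 1} \<noteq> card {1::'k}" by simp
  hence "{u::'k. u ^ N = 1} \<noteq> {1}" by (rule contrapos_nn) simp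
  then obtain u :: 'k where u: "u ^ N = 1" "u \<noteq> 1" by auto
  obtain x where x: "x \<noteq> 0" "Phi (x *s pi_vec u) = x *s pi_vec u"
    by (rule pi_vec_normalize[OF unity_N_n2[OF u(1)]])
  have e: "x ^ (q^2) = x * u" "(x * u) ^ (q^2) = x * u ^ (q^2 + 1)" "(x * u ^ (q^2 + 1)) ^ (q^2) = x"
    using x(2) by (simp_all add: vec3_eq_iff)
  show ?thesis
  proof (rule that[of x])
    show "x ^ (q^6) = x" unfolding pow_q24 e ..
    show "x ^ (q^2) \<noteq> x" using e(1) u(2) x(1) by simp
  qed
qed

definition \<theta> :: 'k where "\<theta> = (SOME x. x ^ (q^6) = x \<and> x ^ (q^2) \<noteq> x)"

lemma theta: "\<theta> ^ (q^6) = \<theta>" "\<theta> ^ (q^2) \<noteq> \<theta>"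
  using someI_ex[of "\<lambda>x. x ^ (q^6) = x \<and> x ^ (q^2) \<noteq> x"] exists_theta unfolding \<theta>_def by blast+

abbreviation "\<theta>1 \<equiv> \<theta> ^ (q^2)"
abbreviation "\<theta>2 \<equiv> (\<theta> ^ (q^2)) ^ (q^2)"

lemma theta3: "\<theta>2 ^ (q^2) = \<theta>" using theta(1) by (simp only: pow_q24)

lemma frob2_inj:
  fixes x y :: 'k
  assumes "x ^ (q^2) = y ^ (q^2)"
  shows "x = y"
proof -
  have "(x ^ q) ^ q = (y ^ q) ^ q" using assms by (simp add: power2_eq_square power_mult)
  thus ?thesis by (rule frob_inj[OF frob_inj])
qed

lemma theta_distinct: "\<theta>1 \<noteq> \<theta>" "\<theta>2 \<noteq> \<theta>1" "\<theta>2 \<noteq> \<theta>"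
proof -
  show "\<theta>1 \<noteq> \<theta>" by (rule theta(2))
  thus "\<theta>2 \<noteq> \<theta>1" using frob2_inj by blast
  show "\<theta>2 \<noteq> \<theta>" using theta3 theta(2) by metis
qed

text \<open>The rows are the conjugates of the basis \<open>1, \<theta>, \<theta>\<^sup>2\<close> of the cubic extension.  Frobenius permutes them cyclically in the way \<open>Phi\<close> permutes coordinates.\<close>

definition Nmat :: "'k^3^3" where
  "Nmat = vector [vector [1, \<theta>1, \<theta>1 ^ 2], vector [1, \<theta>2, \<theta>2 ^ 2], vector [1, \<theta>, \<theta> ^ 2]]"

definition Mmat :: "'k^3^3" where "Mmat = matrix_inv Nmat"

lemma Nmat_mult: "(Nmat *v v) $ 1 = v$1 + \<theta>1 * v$2 + \<theta>1 ^ 2 * v$3"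
  "(Nmat *v v) $ 2 = v$1 + \<theta>2 * v$2 + \<theta>2 ^ 2 * v$3"
  "(Nmat *v v) $ 3 = v$1 + \<theta> * v$2 + \<theta> ^ 2 * v$3"
  by (simp_all add: matrix_vector_mult_def sum_3 Nmat_def vector_3)

lemma invertible_Nmat: "invertible Nmat"
proof -
  have "det Nmat = (\<theta>2 - \<theta>1) * (\<theta>2 - \<theta>) * (\<theta>1 - \<theta>)"
    by (simp add: det_3 Nmat_def vector_3 algebra_simps power2_eq_square)
  thus ?thesis using theta_distinct by (simp add: invertible_det_nz)
qed

lemma NM: "Nmat ** Mmat = mat 1" and MN: "Mmat ** Nmat = mat 1"
  unfolding Mmat_def using someI_ex[OF invertible_Nmat[unfolded invertible_def]] by (simp_all add: matrix_inv_def)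

lemma NM_vec [simp]: "Nmat *v (Mmat *v v) = v" and MN_vec [simp]: "Mmat *v (Nmat *v v) = v"
  by (simp_all add: matrix_vector_mul_assoc NM MN)

lemma invertible_Mmat: "invertible Mmat"
  unfolding invertible_def using NM MN by blast

lemma Nmat_frob2: "Nmat *v frob2 v = Phi (Nmat *v v)"
proof -
  have sw: "(x ^ 2) ^ (q^2) = (x ^ (q^2)) ^ 2" for x :: 'k by (simp add: mult.commute flip: power_mult)
  show ?thesis
    unfolding vec3_eq_iff Phi_simps Nmat_mult frob2_simps frob2_add power_mult_distrib sw theta3 by simp
qed

text \<open>Applying Frobenius to the entries of the inverse gives an inverse of the same matrix, whose entries it fixes.\<close>

lemma Mmat_entries: "Mmat $ i $ j \<in> GF (q^6)"
proof -
  define \<phi> where "\<phi> = (\<lambda>x::'k. x ^ (q^6))"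
  have \<phi>: "\<phi> (x + y) = \<phi> x + \<phi> y" "\<phi> (x * y) = \<phi> x * \<phi> y" "\<phi> 0 = 0" "\<phi> 1 = 1" for x y
    using q_pos by (simp_all add: \<phi>_def frob_power power_mult_distrib power_0_left)
  have N\<phi>: "\<phi> (Nmat $ i $ j) = Nmat $ i $ j" for i j
  proof -
    have "\<phi> \<theta> = \<theta>" using theta(1) by (simp add: \<phi>_def)
    moreover have "\<phi> (x ^ n) = \<phi> x ^ n" for x n by (simp add: \<phi>_def mult.commute flip: power_mult)
    ultimately show ?thesis
      using exhaust_3[of i] exhaust_3[of j] by (auto simp: Nmat_def vector_3 \<phi>)
  qed
  define M' :: "'k^3^3" where "M' = (\<chi> i j. \<phi> (Mmat $ i $ j))"
  have "(M' ** Nmat) $ i $ j = (mat 1 :: 'k^3^3) $ i $ j" for i j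
  proof -
    have "(M' ** Nmat) $ i $ j = \<phi> ((Mmat ** Nmat) $ i $ j)"
      by (simp add: matrix_matrix_mult_def sum_3 M'_def \<phi> N\<phi>)
    also have "\<dots> = (mat 1 :: 'k^3^3) $ i $ j" unfolding MN by (simp add: mat_def \<phi>)
    finally show ?thesis .
  qed
  hence "M' ** Nmat = mat 1" by (simp add: vec_eq_iff)
  hence "M' ** (Nmat ** Mmat) = Mmat" by (simp add: matrix_mul_assoc)
  hence "M' = Mmat" by (simp add: NM)
  hence "\<phi> (Mmat $ i $ j) = Mmat $ i $ j" by (metis M'_def vec_lambda_beta)
  thus ?thesis by (simp add: GF_def \<phi>_def)
qed

lemma pi_vec_rational:
  assumes "g ^ n2 = 1"
  obtains x w where "x \<noteq> 0" "w \<noteq> 0" "\<And>i. w $ i \<in> GF (q^2)" "Nmat *v w = x *s pi_vec g"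
proof -
  obtain x where x: "x \<noteq> 0" "Phi (x *s pi_vec g) = x *s pi_vec g" by (rule pi_vec_normalize[OF assms])
  define w where "w = Mmat *v (x *s pi_vec g)"
  have Nw: "Nmat *v w = x *s pi_vec g" by (simp add: w_def)
  have "Nmat *v frob2 w = Nmat *v w" unfolding Nmat_frob2 Nw by (rule x(2))
  hence "frob2 w = w" using MN_vec by metis
  moreover have "w \<noteq> 0"
  proof
    assume "w = 0"
    hence "(Nmat *v w) $ 3 = 0" by simp
    thus False using x(1) unfolding Nw by simp
  qed
  ultimately show ?thesis using that[OF x(1) _ _ Nw] frob2_fixed_iff by blast
qed

lemma span_scale: "x \<noteq> 0 \<Longrightarrow> vec.span {x *s v} = vec.span {v :: 'k^3}"
proof (intro equalityI subsetI)
  fix w assume x: "x \<noteq> 0"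
  show "w \<in> vec.span {v}" if "w \<in> vec.span {x *s v}"
    using that by (auto simp: mem_span_singleton)
  show "w \<in> vec.span {x *s v}" if "w \<in> vec.span {v}"
  proof -
    obtain s where "w = s *s v" using \<open>w \<in> vec.span {v}\<close> by (auto simp: mem_span_singleton)
    hence "w = (s / x) *s (x *s v)" using x by simp
    thus ?thesis unfolding mem_span_singleton by blast
  qed
qed

lemma Pi_plane_eq: "Pi_plane q = {vec.span {pi_vec g} | g. g ^ n2 = 1}"
  unfolding Pi_plane_def using unity_n2_frob6 by (auto simp: GF_def)

lemma span_pi_vec_eq_iff: "vec.span {pi_vec g} = vec.span {pi_vec h} \<longleftrightarrow> g = h"
proof
  assume "vec.span {pi_vec g} = vec.span {pi_vec h}"
  hence "pi_vec g \<in> vec.span {pi_vec h}" using vec.span_base[of "pi_vec g" "{pi_vec g}"] by simp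
  then obtain s where "pi_vec g = s *s pi_vec h" by (auto simp: mem_span_singleton)
  thus "g = h" by (simp add: vec3_eq_iff)
qed simp

lemma Mmat_straightens: "Mmat \<in> Pi_straightening q"
  unfolding Pi_straightening_def
proof (intro CollectI conjI allI)
  show "invertible Mmat" by (rule invertible_Mmat)
  show "Mmat $ i $ j \<in> GF (q^6)" for i j by (rule Mmat_entries)
  show "(\<lambda>P. ((*v) Mmat) ` P) ` Pi_plane q = PG2 (GF (q^2))"
  proof (intro equalityI subsetI)
    fix P assume "P \<in> (\<lambda>P. ((*v) Mmat) ` P) ` Pi_plane q"
    then obtain g where g: "g ^ n2 = 1" "P = ((*v) Mmat) ` vec.span {pi_vec g}" unfolding Pi_plane_eq by blast
    obtain x w where w: "x \<noteq> 0" "w \<noteq> 0" "\<And>i. w $ i \<in> GF (q^2)" "Nmat *v w = x *s pi_vec g"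
      using pi_vec_rational[OF g(1)] by blast
    have "P = ((*v) Mmat) ` vec.span {Nmat *v w}" unfolding g(2) w(4) using span_scale[OF w(1)] by simp
    hence "P = vec.span {w}" by (simp add: matrix_image_span)
    thus "P \<in> PG2 (GF (q^2))" unfolding PG2_def using w by blast
  next
    fix P :: "'k pt" assume "P \<in> PG2 (GF (q^2))"
    then obtain w :: "'k^3" where w: "w \<noteq> 0" "\<And>i. w $ i \<in> GF (q^2)" "P = vec.span {w}" unfolding PG2_def by blast
    have "frob2 w = w" using w(2) frob2_fixed_iff by blast
    hence "Phi (Nmat *v w) = Nmat *v w" using Nmat_frob2[of w] by simp
    moreover have "Nmat *v w \<noteq> 0" using w(1) MN_vec[of w] by (metis matrix_vector_mult_0_right)
    ultimately obtain x g where xg: "x \<noteq> 0" "g ^ n2 = 1" "Nmat *v w = x *s pi_vec g" by (rule Phi_fixed_imp_pi_vec)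
    have "P = ((*v) Mmat) ` vec.span {Nmat *v w}" by (simp add: matrix_image_span w(3))
    also have "vec.span {Nmat *v w} = vec.span {pi_vec g}" unfolding xg(3) by (rule span_scale[OF xg(1)])
    finally show "P \<in> (\<lambda>P. ((*v) Mmat) ` P) ` Pi_plane q" unfolding Pi_plane_eq using xg(2) by blast
  qed
qed

text \<open>Comparing coefficients, which is legitimate as every vector is in the image of \<open>frob2\<close>.\<close>

lemma is_form_over_GF:
  assumes A: "is_form UNIV d A" and inv: "\<And>v. A (frob2 v) = (A v) ^ (q^2)"
  shows "is_form (GF (q^2)) d A"
proof -
  obtain c where c: "\<And>v. A v = (\<Sum>i\<le>d. \<Sum>j\<le>d - i. c i j * (v$1)^i * (v$2)^j * (v$3)^(d - i - j))"
    using A unfolding is_form_def by blast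
  have q2_0: "(0::'k) ^ (q^2) = 0" using q_pos by (simp add: power_0_left)
  have sum_pow: "(\<Sum>x\<in>I. f x) ^ (q^2) = (\<Sum>x\<in>I. f x ^ (q^2))" for I :: "nat set" and f :: "nat \<Rightarrow> 'k"
    by (induction I rule: infinite_finite_induct) (simp_all add: frob2_add q2_0)
  have "c i j - c i j ^ (q^2) = 0" if "i + j \<le> d" for i j
  proof (rule form_coeffs_eq_0[where d = d and c = "\<lambda>i j. c i j - c i j ^ (q^2)", OF _ that])
    fix w :: "'k^3"
    have "\<exists>y. y ^ (q^2) = x" for x :: 'k using q_pos nth_root_exists[of "q^2" x] by auto
    then obtain y1 y2 y3 where y: "y1 ^ (q^2) = w$1" "y2 ^ (q^2) = w$2" "y3 ^ (q^2) = w$3" by metis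
    define v :: "'k^3" where "v = vector [y1, y2, y3]"
    have w: "w = frob2 v" by (simp add: vec3_eq_iff v_def vector_3 y)
    have "A w = (A v) ^ (q^2)" unfolding w by (rule inv)
    also have "\<dots> = (\<Sum>i\<le>d. \<Sum>j\<le>d - i. c i j ^ (q^2) * (w$1)^i * (w$2)^j * (w$3)^(d - i - j))"
      unfolding c w by (simp add: sum_pow power_mult_distrib mult.commute[of "q^2"] flip: power_mult)
    finally show "(\<Sum>i\<le>d. \<Sum>j\<le>d - i. (c i j - c i j ^ (q^2)) * (w$1)^i * (w$2)^j * (w$3)^(d - i - j)) = 0"
      using c[of w] by (simp add: left_diff_distrib sum_subtractf)
  qed
  hence fixed: "c i j \<in> GF (q^2)" if "i + j \<le> d" for i j using that by (simp add: GF_def)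
  define c' where "c' = (\<lambda>i j. if i + j \<le> d then c i j else 0)"
  have "A v = (\<Sum>i\<le>d. \<Sum>j\<le>d - i. c' i j * (v$1)^i * (v$2)^j * (v$3)^(d - i - j))" for v
    unfolding c by (intro sum.cong) (auto simp: c'_def)
  moreover have "c' i j \<in> GF (q^2)" for i j using fixed q2_0 by (auto simp: c'_def GF_def)
  ultimately show ?thesis unfolding is_form_def by blast
qed

lemma is_form_over_GF_Nmat:
  assumes A: "is_form UNIV d A" and inv: "\<And>v. A (Phi v) = (A v) ^ (q^2)"
  shows "is_form (GF (q^2)) d (\<lambda>v. A (Nmat *v v))"
  by (rule is_form_over_GF[OF is_form_compose_matrix[OF A]]) (simp add: Nmat_frob2 inv)

text \<open>The lines and curves in question are invariant up to a constant \<open>s\<close>; scaling with a \<open>(q\<^sup>2 - 1)\<close>-th root of \<open>s\<close> removes it.\<close>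

lemma absorb_constant:
  assumes "s \<noteq> (0::'k)" "\<And>v. B (Phi v) = s * (B v) ^ (q^2)"
  obtains \<mu> where "\<mu> \<noteq> 0" "\<And>v. \<mu> * B (Phi v) = (\<mu> * B v) ^ (q^2)"
proof -
  have pos: "q^2 - 1 > 0" using q3 one_less_power[of q 2] by simp
  then obtain \<mu> where \<mu>: "\<mu> ^ (q^2 - 1) = s" using nth_root_exists by blast
  have "\<mu> \<noteq> 0" using \<mu> assms(1) pos by (auto simp: power_0_left)
  moreover have "\<mu> * B (Phi v) = (\<mu> * B v) ^ (q^2)" for v
    unfolding assms(2) power_mult_distrib q2_factor[of \<mu>] \<mu> by simp
  ultimately show ?thesis by (rule that)
qed

lemma line_Phi:
  assumes "s ^ n2 = 1"
  shows "s * Phi v$1 + s ^ (q^2 + 1) * Phi v$2 + Phi v$3 = s * (s * v$1 + s ^ (q^2 + 1) * v$2 + v$3) ^ (q^2)"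
proof -
  have 1: "s * (s ^ (q^2 + 1)) ^ (q^2) = s ^ n2"
    by (simp add: power_add power_mult_distrib mult_ac flip: pow_q24)
  hence e: "s * ((s ^ (q^2 + 1)) ^ (q^2) * y) = y" for y
    unfolding mult.assoc[symmetric] 1 assms by simp
  show ?thesis
    unfolding frob2_add power_mult_distrib distrib_left e by (simp add: power_add mult_ac)
qed

lemma Hform_Phi:
  assumes t: "t ^ n1 = 1"
  shows "Hform q t (Phi v) = t * (Hform q t v) ^ (q^2)"
proof -
  have 1: "t * (t ^ (q^2 + 1)) ^ (q^2) = t ^ n2"
    by (simp add: power_add power_mult_distrib mult_ac flip: pow_q24)
  hence e: "t * ((t ^ (q^2 + 1)) ^ (q^2) * y) = y" for y
    unfolding mult.assoc[symmetric] 1 unity_n1_n2[OF t] by simp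
  have sw: "(y ^ q) ^ (q^2) = (y ^ (q^2)) ^ q" for y :: 'k by (simp add: mult.commute flip: power_mult)
  have "t * (Hform q t v) ^ (q^2) = t * (t ^ (q^2) * ((v$1)^(q^2) * ((v$2)^(q^2))^q))
      + t * ((t ^ (q^2 + 1)) ^ (q^2) * ((v$2)^(q^2) * ((v$3)^(q^2))^q)) + t * ((v$3)^(q^2) * ((v$1)^(q^2))^q)"
    unfolding Hform_def frob2_add power_mult_distrib sw by (simp only: distrib_left mult.assoc)
  also have "\<dots> = Hform q t (Phi v)"
    unfolding e Hform_def by (simp add: power_add mult_ac)
  finally show ?thesis ..
qed

end

section \<open>Functions with simple poles on a Singer orbit\<close>

lemma Hform_Kform: "Hform q t = Kform q t (t ^ (q^2 + 1)) 1"
  by (simp add: fun_eq_iff Hform_def Kform_def)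

lemma (in singer_field) GF_form_frob2:
  assumes "is_form (GF (q^2)) d A"
  shows "A (frob2 v) = (A v) ^ (q^2)"
proof -
  obtain c where c: "\<And>i j. c i j \<in> GF (q^2)" "\<And>v. A v = (\<Sum>i\<le>d. \<Sum>j\<le>d - i. c i j * (v$1)^i * (v$2)^j * (v$3)^(d - i - j))"
    using assms unfolding is_form_def by blast
  have c': "c i j ^ (q^2) = c i j" for i j using c(1)[of i j] by (simp add: GF_def)
  have sum_pow: "(\<Sum>x\<in>I. f x) ^ (q^2) = (\<Sum>x\<in>I. f x ^ (q^2))" for I :: "nat set" and f :: "nat \<Rightarrow> 'k"
    using q_pos by (induction I rule: infinite_finite_induct) (simp_all add: frob2_add power_0_left)
  show ?thesis
    unfolding c(2) by (simp add: sum_pow power_mult_distrib c' mult.commute[of "q^2"] flip: power_mult)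
qed

text \<open>Besides \<open>H\<^sub>\<tau>\<close>, a second curve \<open>H\<^sub>t\<close> through the point with parameter \<open>g0\<close>, and hence through its Singer orbit.\<close>

locale hermitian_pair = singer_field q \<tau>
  for q and \<tau> :: "'k::{alg_closed_field,factorial_ring_gcd,semiring_gcd_mult_normalize}" +
  fixes t g0 :: 'k
  assumes t: "t ^ (q^2 + q + 1) = 1" and t_neq: "t \<noteq> \<tau>" and g0: "g0 ^ (q^4 + q^2 + 1) = 1"
    and g0_on: "\<tau> * g0 ^ (q^3 + 1) \<in> Dq" "t * g0 ^ (q^3 + 1) \<in> Dq"
begin

lemma \<tau>0: "\<tau> \<noteq> 0" and t0: "t \<noteq> 0" and g00: "g0 \<noteq> 0"
  using \<tau> t g0 by auto

definition b :: 'k where "b = \<tau> ^ (q^2 + 1)"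
definition b' :: 'k where "b' = t ^ (q^2 + 1)"
abbreviation "\<delta> \<equiv> t - \<tau>"
abbreviation "\<epsilon> \<equiv> b' - b"

sublocale K: klein_curve q \<tau> b 1
  using q3 q0 frob \<tau>0 by unfold_locales (auto simp: b_def)

lemma KF: "K.F = Hform q \<tau>" unfolding b_def by (rule Hform_Kform[symmetric])

lemma Hform_t: "Hform q t v = t * v$1 * (v$2)^q + b' * v$2 * (v$3)^q + v$3 * (v$1)^q"
  by (simp add: Hform_def b'_def)

lemma b_q: "b * \<tau> ^ q = 1" "b' * t ^ q = 1"
  using \<tau> t by (simp_all add: b_def b'_def power_add mult_ac)

lemma \<delta>0: "\<delta> \<noteq> 0" using t_neq by simp

lemma \<epsilon>0: "\<epsilon> \<noteq> 0"
proof
  assume "\<epsilon> = 0"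
  hence "b * t ^ q = b * \<tau> ^ q" using b_q by simp
  hence "t ^ q = \<tau> ^ q" using K.b0 by simp
  thus False using frob_inj t_neq by blast
qed

lemma cross0: "b' * \<tau> - b * t \<noteq> 0"
proof
  assume "b' * \<tau> - b * t = 0"
  hence e: "b' * \<tau> = b * t" by simp
  have "(b' * t ^ q) * (\<tau> * \<tau> ^ q) = (b' * \<tau>) * (t ^ q * \<tau> ^ q)" by (simp add: mult_ac)
  also have "\<dots> = (b * \<tau> ^ q) * (t * t ^ q)" unfolding e by (simp add: mult_ac)
  finally have "\<tau> ^ (q + 1) = t ^ (q + 1)" unfolding b_q by simp
  hence r: "(t / \<tau>) ^ (q + 1) = 1" unfolding power_divide using t0 by simp
  have "n1 = (q + 1) * q + 1" by (simp add: power2_eq_square)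
  hence "(t / \<tau>) ^ n1 = ((t / \<tau>) ^ (q + 1)) ^ q * (t / \<tau>)" by (simp only: power_add power_mult power_one_right)
  hence "t / \<tau> = 1" unfolding r using \<tau> t by (simp add: power_divide)
  thus False using t_neq \<tau>0 by simp
qed

lemma q1: "x * x ^ (q - 1) = x ^ q" for x :: 'k
  using q_pos by (simp add: power_eq_if)

text \<open>
On \<open>H\<^sub>\<tau>\<close> the form of \<open>H\<^sub>t\<close> is congruent to a member of the pencil that lacks one of the three terms, and so is divisible by a coordinate.
The cofactors of the second, third and first coordinate are nonzero at the vertices \<open>(0 : 0 : 1)\<close>, \<open>(1 : 0 : 0)\<close> and \<open>(0 : 1 : 0)\<close>
respectively, and provide regular representatives there.
\<close>

definition cof2 :: "'k^3 \<Rightarrow> 'k" where "cof2 v = \<delta> * (v$1 * v$2 ^ (q - 1)) + \<epsilon> * v$3 ^ q"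
definition cof3 :: "'k^3 \<Rightarrow> 'k" where "cof3 v = - ((b' * \<tau> - b * t) * (v$2 * v$3 ^ (q - 1))) + \<delta> * v$1 ^ q"
definition cof1 :: "'k^3 \<Rightarrow> 'k" where "cof1 v = (b' * \<tau> - b * t) * v$2 ^ q + \<epsilon> * (v$3 * v$1 ^ (q - 1))"

lemma cof2: "K.F v = 0 \<Longrightarrow> Hform q t v = v$2 * cof2 v"
proof -
  have "Hform q t v - K.F v = v$2 * cof2 v"
    unfolding Hform_t Kform_def cof2_def q1[of "v$2", symmetric] by (simp add: algebra_simps)
  thus "K.F v = 0 \<Longrightarrow> Hform q t v = v$2 * cof2 v" by simp
qed

lemma cof3: "K.F v = 0 \<Longrightarrow> - \<tau> * Hform q t v = v$3 * cof3 v"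
proof -
  have "t * K.F v - \<tau> * Hform q t v = v$3 * cof3 v"
    unfolding Hform_t Kform_def cof3_def q1[of "v$3", symmetric] by (simp add: algebra_simps)
  thus "K.F v = 0 \<Longrightarrow> - \<tau> * Hform q t v = v$3 * cof3 v" by simp
qed

lemma cof1: "K.F v = 0 \<Longrightarrow> - b * Hform q t v = v$1 * cof1 v"
proof -
  have "b' * K.F v - b * Hform q t v = v$1 * cof1 v"
    unfolding Hform_t Kform_def cof1_def q1[of "v$1", symmetric] by (simp add: algebra_simps)
  thus "K.F v = 0 \<Longrightarrow> - b * Hform q t v = v$1 * cof1 v" by simp
qed

lemma is_form_pow: "is_form UNIV 1 f \<Longrightarrow> is_form UNIV n (\<lambda>v::'k^3. f v ^ n)"
  using is_form_power[of 1 f n] by simp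

lemma is_form_cof: "is_form UNIV q cof2" "is_form UNIV q cof3" "is_form UNIV q cof1"
proof -
  have p: "is_form UNIV q (\<lambda>v::'k^3. v$i * v$j ^ (q - 1))" for i j
    by (rule is_form_mult'[OF is_form_coord is_form_pow[OF is_form_coord]]) (use q3 in simp)
  show "is_form UNIV q cof2" "is_form UNIV q cof3" "is_form UNIV q cof1"
    unfolding cof2_def[abs_def] cof3_def[abs_def] cof1_def[abs_def]
    by (intro is_form_add is_form_uminus is_form_scale p is_form_pow is_form_coord)+
qed

lemma is_form_Hform: "is_form UNIV (q + 1) (Hform q s)"
  unfolding Hform_Kform by (rule is_form_Kform)

definition elim_coeff :: 'k where "elim_coeff = \<delta> ^ (q - 1) * (b * \<delta> - \<tau> * \<epsilon>)"

definition elim_cof :: "'k^3 \<Rightarrow> 'k" where "elim_cof v = v$3 * cof2 v ^ (q - 1) + \<delta> ^ (q - 1) * \<tau> * v$2 ^ N"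

lemma elim_coeff_nonzero: "elim_coeff \<noteq> 0"
proof -
  have "b * \<delta> - \<tau> * \<epsilon> = - (b' * \<tau> - b * t)" by (simp add: algebra_simps)
  thus ?thesis using cross0 \<delta>0 by (simp add: elim_coeff_def)
qed

text \<open>
Solving for \<open>v$1\<close> in the cofactor and substituting the result in the equation of the curve leaves, modulo the cofactor, a binary form
in \<open>v$2\<close> and \<open>v$3\<close>; apart from powers of \<open>v$3\<close>, its zeros are the \<open>N\<close> values of \<open>v$2 / v$3\<close> on the common orbit.
\<close>

lemma eliminate_x:
  assumes "K.F v = 0"
  shows "cof2 v * elim_cof v = v$3 ^ q * (\<epsilon> ^ q * v$3 ^ N - elim_coeff * v$2 ^ N)"
proof -
  define e x y z P where "e = cof2 v" and "x = v$1" and "y = v$2" and "z = v$3" and "P = y ^ (q - 1)"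
  have e: "\<delta> * (x * P) = e - \<epsilon> * z ^ q" by (simp add: e_def cof2_def x_def y_def z_def P_def)
  have "(\<delta> * (x * P)) ^ q = e ^ q - \<epsilon> ^ q * (z ^ q) ^ q" unfolding e frob_diff power_mult_distrib ..
  hence eq: "\<delta> ^ q * (x ^ q * P ^ q) = e ^ q - \<epsilon> ^ q * (z ^ q) ^ q" by (simp only: power_mult_distrib)
  have yN: "y ^ N = P ^ q * y"
    unfolding N_q[symmetric] P_def by (simp add: mult.commute[of q] flip: power_mult)
  have zN: "z ^ q * z ^ N = z * (z ^ q) ^ q"
  proof -
    have "z ^ q * z ^ N = z ^ (N + q)" by (simp only: power_add mult.commute)
    also have "\<dots> = z * (z ^ q) ^ q" unfolding N_add_q by (simp add: power2_eq_square power_mult)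
    finally show ?thesis .
  qed
  have yq: "y ^ q = y * P" unfolding P_def by (rule q1[symmetric])
  have dq: "\<delta> ^ q = \<delta> * \<delta> ^ (q - 1)" by (rule q1[symmetric])
  have F: "\<tau> * x * (y * P) + b * y * z ^ q + z * x ^ q = 0"
    using assms unfolding Kform_def x_def[symmetric] y_def[symmetric] z_def[symmetric] yq by simp
  have "0 = \<delta> ^ q * P ^ q * (\<tau> * x * (y * P) + b * y * z ^ q + z * x ^ q)" unfolding F by simp
  also have "\<dots> = \<delta> ^ (q - 1) * (P ^ q * y) * (\<tau> * (\<delta> * (x * P)) + b * \<delta> * z ^ q) + z * (\<delta> ^ q * (x ^ q * P ^ q))"
    unfolding dq by (simp add: algebra_simps)
  also have "\<dots> = \<delta> ^ (q - 1) * y ^ N * (\<tau> * (e - \<epsilon> * z ^ q) + b * \<delta> * z ^ q) + z * (e ^ q - \<epsilon> ^ q * (z ^ q) ^ q)"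
    unfolding e eq yN ..
  also have "\<dots> = (z * e ^ q + \<delta> ^ (q - 1) * \<tau> * y ^ N * e) - (\<epsilon> ^ q * (z * (z ^ q) ^ q) - elim_coeff * y ^ N * z ^ q)"
    unfolding elim_coeff_def by (simp add: algebra_simps)
  finally have "z * e ^ q + \<delta> ^ (q - 1) * \<tau> * y ^ N * e = \<epsilon> ^ q * (z ^ q * z ^ N) - elim_coeff * y ^ N * z ^ q"
    unfolding zN by simp
  moreover have "cof2 v * elim_cof v = z * (e * e ^ (q - 1)) + \<delta> ^ (q - 1) * \<tau> * y ^ N * e"
    unfolding elim_cof_def e_def[symmetric] y_def[symmetric] z_def[symmetric] by (simp add: algebra_simps)
  ultimately show ?thesis unfolding q1 y_def z_def by (simp add: algebra_simps)
qed

definition Gset :: "'k set" where "Gset = (\<lambda>u. g0 * u) ` {u. u ^ N = 1}"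

lemma GsetD:
  assumes "g \<in> Gset"
  shows "g ^ n2 = 1" "\<tau> * g ^ (q^3 + 1) = \<tau> * g0 ^ (q^3 + 1)" "t * g ^ (q^3 + 1) = t * g0 ^ (q^3 + 1)"
    "K.F (pi_vec g) = 0" "Hform q t (pi_vec g) = 0" "g ^ (q^2 + 1) \<noteq> 0" "cof2 (pi_vec g) = 0"
    "\<epsilon> ^ q = elim_coeff * (g ^ (q^2 + 1)) ^ N"
proof -
  show g: "g ^ n2 = 1" and a: "\<tau> * g ^ (q^3 + 1) = \<tau> * g0 ^ (q^3 + 1)"
    using assms fibre_coset[OF \<tau>0 g0] unfolding Gset_def by blast+
  show b: "t * g ^ (q^3 + 1) = t * g0 ^ (q^3 + 1)"
    using assms fibre_coset[OF t0 g0] unfolding Gset_def by blast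
  show F: "K.F (pi_vec g) = 0" unfolding KF Hform_point[OF \<tau> g] a by (rule g0_on(1))
  show H: "Hform q t (pi_vec g) = 0" unfolding Hform_point[OF t g] b by (rule g0_on(2))
  show nz: "g ^ (q^2 + 1) \<noteq> 0" using g by auto
  have "pi_vec g $ 2 * cof2 (pi_vec g) = 0" using cof2[OF F] H by simp
  thus c: "cof2 (pi_vec g) = 0" using nz by simp
  show "\<epsilon> ^ q = elim_coeff * (g ^ (q^2 + 1)) ^ N" using eliminate_x[OF F] unfolding c by simp
qed

lemma g0_Gset: "g0 \<in> Gset" unfolding Gset_def by (rule image_eqI[of _ _ 1]) auto

text \<open>
The values of \<open>v$2 / v$3\<close> allowed by \<open>eliminate_x\<close> form one coset of the roots of unity of order \<open>N\<close>, and the cofactor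
then determines \<open>v$1\<close>.  As \<open>q\<^sup>2 + 1 = N + q\<close>, the matching factor of \<open>g0\<close> is a \<open>q\<close>-th root, found by inverting Frobenius.
\<close>

lemma common_point_in_orbit:
  assumes F: "K.F v = 0" and H: "Hform q t v = 0" and nz: "v$2 \<noteq> 0" "v$3 \<noteq> 0"
  obtains g where "g \<in> Gset" "v = v$3 *s pi_vec g"
proof -
  define y0 where "y0 = g0 ^ (q^2 + 1)"
  define x y where "x = v$1 / v$3" and "y = v$2 / v$3"
  define w :: "'k^3" where "w = vector [x, y, 1]"
  have vw: "v = v$3 *s w" unfolding w_def x_def y_def by (rule affine_normalize[OF nz(2)])
  have Fw: "K.F w = 0" using F K.Kform_zero_scale[of "v$3" w] vw nz by simp
  have Hw: "Hform q t w = 0" using H form_homogeneous[OF is_form_Hform[of t], of "v$3" w] vw nz by simp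
  have y: "y \<noteq> 0" using nz by (simp add: y_def)
  have w: "w$1 = x" "w$2 = y" "w$3 = 1" by (simp_all add: w_def vector_3)
  have c: "cof2 w = 0" using cof2[OF Fw] Hw y w by simp
  have "\<epsilon> ^ q = elim_coeff * y ^ N" using eliminate_x[OF Fw] unfolding c w by simp
  hence "y ^ N = y0 ^ N" using GsetD(8)[OF g0_Gset] elim_coeff_nonzero by (simp add: y0_def)
  moreover have y00: "y0 \<noteq> 0" using GsetD(6)[OF g0_Gset] by (simp add: y0_def)
  ultimately have u: "(y / y0) ^ N = 1" by (simp add: power_divide)
  \<comment> \<open>The exponent \<open>q\<^sup>5\<close> inverts Frobenius on the field of \<open>q\<^sup>6\<close> elements.\<close>
  define s where "s = (y / y0) ^ (q^5)"
  have "s ^ q = (y / y0) ^ (q^6)" by (simp add: s_def mult.commute flip: power_mult power_Suc)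
  hence sq: "s ^ q = y / y0" using unity_n2_frob6[OF unity_N_n2[OF u]] by simp
  have sN: "s ^ N = 1"
  proof -
    have "s ^ N = ((y / y0) ^ N) ^ (q^5)" unfolding s_def by (simp only: mult.commute flip: power_mult)
    thus ?thesis unfolding u by simp
  qed
  define g where "g = g0 * s"
  have g: "g \<in> Gset" unfolding Gset_def g_def using sN by blast
  have "s ^ (q^2 + 1) = s ^ N * s ^ q" unfolding N_add_q[symmetric] by (simp only: power_add)
  hence gy: "g ^ (q^2 + 1) = y"
    unfolding g_def power_mult_distrib y0_def[symmetric] using sN sq y00 by simp
  have "\<delta> * (g * y ^ (q - 1)) + \<epsilon> = 0"
    using GsetD(7)[OF g] unfolding cof2_def pi_vec_simps gy by simp
  moreover have "\<delta> * (x * y ^ (q - 1)) + \<epsilon> = 0" using c unfolding cof2_def w by simp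
  ultimately have "\<delta> * (g * y ^ (q - 1)) = \<delta> * (x * y ^ (q - 1))" by (simp add: eq_neg_iff_add_eq_0[symmetric])
  hence "g = x" using \<delta>0 y by simp
  hence "w = pi_vec g" unfolding w_def gy by simp
  thus ?thesis using that[OF g] vw by simp
qed

definition orbit_pts :: "'k pt set" where "orbit_pts = {vec.span {pi_vec g} | g. g \<in> Gset}"

definition num :: "('k^3 \<Rightarrow> 'k) \<Rightarrow> 'k^3 \<Rightarrow> 'k" where "num A v = A v * (v$1 * v$2 * v$3)"
definition den :: "'k \<Rightarrow> 'k^3 \<Rightarrow> 'k" where "den \<mu> v = \<mu> * Hform q t v"

lemma is_form_den: "is_form UNIV (q + 1) (den \<mu>)"
  unfolding den_def[abs_def] by (intro is_form_scale is_form_Hform)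

lemma is_form_num:
  assumes "is_form UNIV (q - 2) A"
  shows "is_form UNIV (q + 1) (num A)"
proof -
  have "is_form UNIV (1 + 1 + 1) (\<lambda>v::'k^3. v$1 * v$2 * v$3)" by (intro is_form_mult is_form_coord)
  thus ?thesis unfolding num_def[abs_def] by (rule is_form_mult'[OF assms]) (use q3 in simp)
qed

lemma nz_den: assumes "\<mu> \<noteq> 0" shows "K.nz (den \<mu>)"
proof (rule ccontr)
  assume "\<not> K.nz (den \<mu>)"
  hence z: "Hform q t v = 0" if "K.F v = 0" for v using that assms by (auto simp: K.nz_def den_def)
  have "v$2 * cof2 v = 0" if "K.F v = 0" for v using cof2[OF that] z[OF that] by simp
  hence "(\<forall>v. K.F v = 0 \<longrightarrow> v$2 = 0) \<or> (\<forall>v. K.F v = 0 \<longrightarrow> cof2 v = 0)"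
    by (rule K.forms_mult_vanish[OF is_form_coord is_form_cof(1)])
  moreover have "K.F (vector [0, 1, 0]) = 0" "(vector [0, 1, 0] :: 'k^3)$2 \<noteq> 0"
    using q_pos by (simp_all add: Kform_def vector_3 power_0_left)
  moreover have "K.F (vector [0, 0, 1]) = 0" "cof2 (vector [0, 0, 1]) \<noteq> 0"
    using q_pos \<epsilon>0 by (simp_all add: Kform_def cof2_def vector_3 power_0_left)
  ultimately show False by blast
qed

lemma quots_num_den:
  assumes "is_form UNIV (q - 2) A" "\<mu> \<noteq> 0"
  shows "(num A, den \<mu>) \<in> quots K.Y"
  unfolding K.quots_iff using is_form_num[OF assms(1)] is_form_den nz_den[OF assms(2)] by blast

lemma ord_at_regular:
  assumes A: "is_form UNIV (q - 2) A" and \<mu>: "\<mu> \<noteq> 0" and nz: "K.nz (num A)"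
    and p: "K.F p = 0" "p \<noteq> 0"
    and CD: "is_form UNIV d C1" "is_form UNIV d D1" "D1 p \<noteq> 0"
    and eq: "\<And>v. K.F v = 0 \<Longrightarrow> num A v * D1 v = den \<mu> v * C1 v"
  shows "ord_at K.Y (vec.span {p}) (K.frac (num A) (den \<mu>)) \<ge> 0"
proof -
  obtain l m where lm: "local_param K.F p l m" using K.ex_local_param[OF p] by blast
  have "ord_at K.Y (vec.span {p}) (K.frac (num A) (den \<mu>)) \<ge> - int 0"
    by (rule K.ord_at_ge[OF p(1) lm quots_num_den[OF A \<mu>] nz CD]) (use eq in simp)
  thus ?thesis by simp
qed

text \<open>The binary form in \<open>eliminate_x\<close> has the uniformizer \<open>v$2 - y v$3\<close> as a simple factor, so \<open>H\<^sub>t\<close> vanishes there to order at most one.\<close>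

lemma ord_at_orbit:
  assumes A: "is_form UNIV (q - 2) A" and \<mu>: "\<mu> \<noteq> 0" and nz: "K.nz (num A)" and g: "g \<in> Gset"
  shows "ord_at K.Y (vec.span {pi_vec g}) (K.frac (num A) (den \<mu>)) \<ge> - 1"
proof -
  define y where "y = g ^ (q^2 + 1)"
  define l where "l = (\<lambda>v::'k^3. v$2 - y * v$3)"
  \<comment> \<open>The cofactor of \<open>l\<close> in \<open>v$2\<^sup>N - (y v$3)\<^sup>N\<close>; at the point its value is \<open>N y\<^bsup>N-1\<^esup>\<close>, and \<open>N = 1\<close> in the field.\<close>
  define S where "S = (\<lambda>v::'k^3. \<Sum>i<N. (y * v$3) ^ (N - Suc i) * v$2 ^ i)"
  have y: "y \<noteq> 0" using GsetD(6)[OF g] by (simp add: y_def)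
  have F: "K.F (pi_vec g) = 0" by (rule GsetD(4)[OF g])
  have lm: "local_param K.F (pi_vec g) l (\<lambda>v. v$3)"
    using K.local_param_affine[of g y] F y unfolding y_def l_def by blast
  have "is_form UNIV (N - 1) (\<lambda>v::'k^3. (y * v$3) ^ (N - Suc i) * v$2 ^ i)" if "i < N" for i
    by (rule is_form_mult'[OF is_form_pow[OF is_form_scale[OF is_form_coord]] is_form_pow[OF is_form_coord]]) (use that in simp)
  hence S: "is_form UNIV (N - 1) S" unfolding S_def by (intro is_form_sum) auto
  have S_factor: "v$2 ^ N - (y * v$3) ^ N = l v * S v" for v
    unfolding l_def S_def by (rule power_diff_sumr2)
  have elim_cof: "is_form UNIV N elim_cof"
  proof -
    have "is_form UNIV (q * (q - 1)) (\<lambda>v. cof2 v ^ (q - 1))" by (rule is_form_power[OF is_form_cof(1)])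
    hence "is_form UNIV N (\<lambda>v. v$3 * cof2 v ^ (q - 1))"
      using is_form_coord_mult N_q by (metis Suc_eq_plus1)
    thus ?thesis unfolding elim_cof_def[abs_def] by (intro is_form_add is_form_scale is_form_pow is_form_coord)
  qed
  define C1 where "C1 = (\<lambda>v. - (A v * v$1 * elim_cof v))"
  define D1 where "D1 = (\<lambda>v. \<mu> * elim_coeff * (v$3 ^ q * S v))"
  have "- int 1 \<le> ord_at K.Y (vec.span {pi_vec g}) (K.frac (num A) (den \<mu>))"
  proof (rule K.ord_at_ge[OF F lm quots_num_den[OF A \<mu>] nz])
    have "is_form UNIV (q - 2 + 1 + N) (\<lambda>v. A v * v$1 * elim_cof v)"
      by (intro is_form_mult A is_form_coord elim_cof)
    thus "is_form UNIV (q - 2 + 1 + N) C1" unfolding C1_def by (rule is_form_uminus)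
    have "q + (N - 1) = q - 2 + 1 + N" using q3 by simp
    thus "is_form UNIV (q - 2 + 1 + N) D1"
      unfolding D1_def using is_form_scale[OF is_form_mult[OF is_form_pow[OF is_form_coord] S]] by metis
    have "(y * 1) ^ (N - Suc i) * y ^ i = y ^ (N - 1)" if "i < N" for i
    proof -
      have "N - Suc i + i = N - 1" using that by arith
      thus ?thesis by (metis power_add mult_1_right)
    qed
    hence "S (pi_vec g) = (\<Sum>i<N. y ^ (N - 1))"
      unfolding S_def pi_vec_simps y_def[symmetric] by (intro sum.cong) auto
    also have "\<dots> = y ^ (N - 1)" using of_nat_N by simp
    finally show "D1 (pi_vec g) \<noteq> 0" using y \<mu> elim_coeff_nonzero by (simp add: D1_def)
    fix v assume v: "K.F v = 0"
    have "cof2 v * elim_cof v = v$3 ^ q * (\<epsilon> ^ q * v$3 ^ N - elim_coeff * v$2 ^ N)" by (rule eliminate_x[OF v])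
    also have "\<dots> = - (elim_coeff * v$3 ^ q * (v$2 ^ N - (y * v$3) ^ N))"
      unfolding GsetD(8)[OF g] y_def power_mult_distrib by (simp add: algebra_simps)
    finally have e: "elim_coeff * v$3 ^ q * (l v * S v) = - (cof2 v * elim_cof v)" unfolding S_factor by simp
    have "l v ^ 1 * num A v * D1 v = A v * (v$1 * v$2 * v$3) * \<mu> * (elim_coeff * v$3 ^ q * (l v * S v))"
      by (simp add: num_def D1_def)
    also have "\<dots> = v$3 ^ 1 * den \<mu> v * C1 v"
      unfolding e den_def cof2[OF v] C1_def by simp
    finally show "l v ^ 1 * num A v * D1 v = v$3 ^ 1 * den \<mu> v * C1 v" .
  qed
  thus ?thesis by simp
qed

text \<open>
At each vertex one of the three cofactors is nonzero, and dividing by the corresponding coordinate yields a representative with a denominator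
that does not vanish there.
\<close>

lemma num_den_divisor:
  assumes A: "is_form UNIV (q - 2) A" and \<mu>: "\<mu> \<noteq> 0" and nz: "K.nz (num A)"
  shows "principal_divisor K.Y (K.frac (num A) (den \<mu>)) P + set_divisor orbit_pts P \<ge> 0"
proof (cases "P \<in> K.Y")
  case False
  thus ?thesis by (simp add: principal_divisor_def set_divisor_def)
next
  case True
  then obtain p where p: "p \<noteq> 0" "K.F p = 0" "P = vec.span {p}" by (rule K.curve_pointE)
  have pd: "principal_divisor K.Y f P = ord_at K.Y (vec.span {p}) f" for f
    using True p by (simp add: principal_divisor_def)
  note reg = ord_at_regular[OF A \<mu> nz p(2,1)]
  have deg: "is_form UNIV q (\<lambda>v. A v * (v$i * v$j))" for i j
    by (rule is_form_mult'[OF A is_form_mult[OF is_form_coord is_form_coord]]) (use q3 in simp)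
  have "ord_at K.Y (vec.span {p}) (K.frac (num A) (den \<mu>)) \<ge> 0 \<or>
    (P \<in> orbit_pts \<and> ord_at K.Y (vec.span {p}) (K.frac (num A) (den \<mu>)) \<ge> - 1)"
    using p(2,1)
  proof (cases rule: K.curve_point_cases)
    case affine
    show ?thesis
    proof (cases "Hform q t p = 0")
      case False
      hence "den \<mu> p \<noteq> 0" using \<mu> by (simp add: den_def)
      from reg[OF is_form_num[OF A] is_form_den this] show ?thesis by simp
    next
      case True
      then obtain g where g: "g \<in> Gset" "p = p$3 *s pi_vec g"
        using common_point_in_orbit[OF p(2) True affine(2,1)] by blast
      have "vec.span {p} = vec.span {pi_vec g}" using g(2) span_scale[OF affine(1), of "pi_vec g"] by simp
      thus ?thesis using ord_at_orbit[OF A \<mu> nz g(1)] g(1) p(3) unfolding orbit_pts_def by auto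
    qed
  next
    case vertex3
    have "\<mu> * cof2 p \<noteq> 0" using vertex3 \<mu> \<epsilon>0 by (simp add: cof2_def)
    from reg[OF deg[of 1 3] is_form_scale[OF is_form_cof(1)] this]
    show ?thesis by (auto simp: num_def den_def cof2)
  next
    case vertex1
    have nz1: "\<mu> * cof3 p \<noteq> 0" using vertex1 \<mu> \<delta>0 by (simp add: cof3_def)
    have "num A v * (\<mu> * cof3 v) = den \<mu> v * (- \<tau> * (A v * (v$1 * v$2)))" if "K.F v = 0" for v
    proof -
      have "num A v * (\<mu> * cof3 v) = A v * (v$1 * v$2) * \<mu> * (v$3 * cof3 v)" by (simp add: num_def)
      also have "\<dots> = den \<mu> v * (- \<tau> * (A v * (v$1 * v$2)))" unfolding cof3[OF that, symmetric] by (simp add: den_def)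
      finally show ?thesis .
    qed
    from reg[OF is_form_scale[OF deg] is_form_scale[OF is_form_cof(2)] nz1 this] show ?thesis by simp
  next
    case vertex2
    have nz2: "\<mu> * cof1 p \<noteq> 0" using vertex2 \<mu> cross0 by (simp add: cof1_def)
    have "num A v * (\<mu> * cof1 v) = den \<mu> v * (- b * (A v * (v$2 * v$3)))" if "K.F v = 0" for v
    proof -
      have "num A v * (\<mu> * cof1 v) = A v * (v$2 * v$3) * \<mu> * (v$1 * cof1 v)" by (simp add: num_def)
      also have "\<dots> = den \<mu> v * (- b * (A v * (v$2 * v$3)))" unfolding cof1[OF that, symmetric] by (simp add: den_def)
      finally show ?thesis .
    qed
    from reg[OF is_form_scale[OF deg] is_form_scale[OF is_form_cof(3)] nz2 this] show ?thesis by simp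
  qed
  thus ?thesis unfolding pd by (auto simp: set_divisor_def)
qed

lemma exists_den_constant:
  obtains \<mu> where "\<mu> \<noteq> 0" "\<And>v. den \<mu> (Phi v) = (den \<mu> v) ^ (q^2)"
  using absorb_constant[where B = "Hform q t" and s = t, OF t0 Hform_Phi[OF t]] unfolding den_def by blast

text \<open>
The product of the coordinates and the scaled denominator commute with the Frobenius collineation, so after straightening all
coefficients lie in the ground field.
\<close>

lemma num_in_RR_space:
  assumes A: "is_form (GF (q^2)) (q - 2) A" and \<mu>: "\<mu> \<noteq> 0" "\<And>v. den \<mu> (Phi v) = (den \<mu> v) ^ (q^2)"
  shows "K.frac (num (\<lambda>v. A (Mmat *v v))) (den \<mu>) \<in> RR_space q K.Y (set_divisor orbit_pts)"
proof -
  let ?A = "\<lambda>v. A (Mmat *v v)"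
  let ?f = "K.frac (num ?A) (den \<mu>)"
  have A': "is_form UNIV (q - 2) A" using A unfolding is_form_def by blast
  have AM: "is_form UNIV (q - 2) ?A" by (rule is_form_compose_matrix[OF A'])
  note qd = quots_num_den[OF AM \<mu>(1)]
  define pr where "pr = (\<lambda>v::'k^3. v$1 * v$2 * v$3)"
  have pr: "is_form UNIV 3 pr"
    unfolding pr_def by (rule is_form_mult'[OF is_form_mult[OF is_form_coord is_form_coord] is_form_coord]) simp
  have prN: "is_form (GF (q^2)) 3 (\<lambda>v. pr (Nmat *v v))"
    by (rule is_form_over_GF_Nmat[OF pr]) (simp add: pr_def power_mult_distrib mult_ac)
  have AF: "A (frob2 v) = A v ^ (q^2)" for v
    by (rule GF_form_frob2[OF A])
  have num_form: "is_form (GF (q^2)) (q + 1) (\<lambda>v. A v * pr (Nmat *v v))"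
  proof (rule is_form_over_GF)
    show "is_form UNIV (q + 1) (\<lambda>v. A v * pr (Nmat *v v))"
      by (rule is_form_mult'[OF A' is_form_compose_matrix[OF pr]]) (use q3 in simp)
    show "A (frob2 v) * pr (Nmat *v frob2 v) = (A v * pr (Nmat *v v)) ^ (q^2)" for v
      unfolding AF GF_form_frob2[OF prN] power_mult_distrib ..
  qed
  have den_form: "is_form (GF (q^2)) (q + 1) (\<lambda>v. den \<mu> (Nmat *v v))"
    by (rule is_form_over_GF_Nmat[OF is_form_den \<mu>(2)])
  have "(num ?A, den \<mu>) \<in> ?f" using qd by (simp add: K.mem_frac_iff)
  moreover have "(\<lambda>v. A (Mmat *v v) * pr (Nmat *v (Mmat *v v))) = num ?A" "(\<lambda>v. den \<mu> (Nmat *v (Mmat *v v))) = den \<mu>"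
    by (simp_all add: num_def[abs_def] pr_def)
  ultimately have "(\<lambda>v. A (Mmat *v v) * pr (Nmat *v (Mmat *v v)), \<lambda>v. den \<mu> (Nmat *v (Mmat *v v))) \<in> ?f" by simp
  hence "defined_over_Pi q ?f"
    unfolding defined_over_Pi_def using num_form den_form
    by (intro bexI[OF _ Mmat_straightens] exI[of _ "\<lambda>v. A v * pr (Nmat *v v)"] exI[of _ "\<lambda>v. den \<mu> (Nmat *v v)"] exI[of _ "q + 1"] conjI)
  moreover have "?f = rat_zero K.Y \<or> (\<forall>P. principal_divisor K.Y ?f P + set_divisor orbit_pts P \<ge> 0)"
    using num_den_divisor[OF AM \<mu>(1)] K.frac_eq_zero_iff[OF qd] by blast
  ultimately show ?thesis unfolding RR_space_def using K.frac_in_rat_funs[OF qd] by blast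
qed

end

section \<open>Finite fields\<close>

text \<open>Translation by \<open>1\<close> permutes the field and so preserves the sum of all elements.\<close>

lemma of_nat_CARD_finite_field: "of_nat CARD('f) = (0 :: 'f::{field,finite})"
proof -
  have "(\<Sum>x\<in>UNIV. x) = (\<Sum>x\<in>UNIV. x + (1::'f))"
    by (rule sum.reindex_bij_betw[symmetric]) (rule bij_betwI[of _ _ _ "\<lambda>x. x - 1"], auto)
  thus ?thesis by (simp add: sum.distrib)
qed

text \<open>Multiplication by \<open>x \<noteq> 0\<close> permutes the nonzero elements and so preserves their product.\<close>

lemma power_CARD_finite_field: "x ^ CARD('f) = (x :: 'f::{field,finite})"
proof (cases "x = 0")
  case True
  thus ?thesis by (simp add: power_0_left)
next
  case False
  define U where "U = UNIV - {0::'f}"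
  have "(\<Prod>y\<in>U. y) = (\<Prod>y\<in>U. x * y)"
    by (rule prod.reindex_bij_betw[symmetric]) (rule bij_betwI[of _ _ _ "\<lambda>y. y / x"], use False in \<open>auto simp: U_def\<close>)
  also have "\<dots> = x ^ card U * (\<Prod>y\<in>U. y)" by (simp add: prod.distrib)
  finally have "x ^ card U = 1" by (simp add: U_def)
  moreover have "CARD('f) = Suc (card U)"
    unfolding U_def by (metis card_Suc_Diff1 finite_class.finite_UNIV UNIV_I)
  ultimately show ?thesis by simp
qed

lemma prime_power_field:
  assumes "primepow q" "CARD('f::{field,finite}) = q^2"
  shows "of_nat q = (0 :: 'f alg_closure)" "(x + y) ^ q = x ^ q + (y :: 'f alg_closure) ^ q"
    "GF (q^2) = range (to_ac :: 'f \<Rightarrow> 'f alg_closure)"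
proof -
  obtain p e where p: "prime p" "e > 0" "q = p ^ e" using assms(1) by (auto simp: primepow_def)
  have pc: "prime CHAR('f)" by (rule prime_CHAR_semidom) (rule finite_imp_CHAR_pos, simp)
  have "CHAR('f) dvd q^2"
    using of_nat_CARD_finite_field[where 'f = 'f] unfolding assms(2) of_nat_eq_0_iff_char_dvd .
  hence "CHAR('f) dvd p" using pc p(3) by (metis prime_dvd_power)
  hence char: "CHAR('f alg_closure) = p" using pc p(1) by (simp add: primes_dvd_imp_eq)
  show "of_nat q = (0 :: 'f alg_closure)"
    unfolding of_nat_eq_0_iff_char_dvd char using p by simp
  show "(x + y) ^ q = x ^ q + (y :: 'f alg_closure) ^ q"
    by (rule freshmans_dream'[where n = e]) (use char p in simp_all)
  show "GF (q^2) = range (to_ac :: 'f \<Rightarrow> 'f alg_closure)"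
  proof (rule card_seteq[symmetric])
    define P :: "'f alg_closure poly" where "P = monom 1 (q^2) - monom 1 1"
    have "card {0, 1 :: 'f} \<le> CARD('f)" by (rule card_mono) simp_all
    hence q2: "q^2 > 1" unfolding assms(2) by simp
    have "coeff P (q^2) = 1" using q2 by (simp add: P_def)
    hence P0: "P \<noteq> 0" by auto
    have GF: "GF (q^2) = {x. poly P x = 0}" by (auto simp: GF_def P_def poly_monom)
    show "finite (GF (q^2) :: 'f alg_closure set)" unfolding GF by (rule poly_roots_finite[OF P0])
    show "range (to_ac :: 'f \<Rightarrow> 'f alg_closure) \<subseteq> GF (q^2)"
      using power_CARD_finite_field[where 'f = 'f] unfolding GF_def assms(2) by (auto simp flip: to_ac_power)
    have "card (GF (q^2) :: 'f alg_closure set) \<le> degree P" unfolding GF by (rule card_poly_roots_bound[OF P0])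
    also have "\<dots> \<le> q^2" unfolding P_def
      by (rule degree_diff_le) (use q2 in \<open>auto intro: degree_monom_le order.trans[OF degree_monom_le]\<close>)
    also have "q^2 = card (range (to_ac :: 'f \<Rightarrow> 'f alg_closure))" by (simp add: card_image inj_to_ac assms(2))
    finally show "card (GF (q^2) :: 'f alg_closure set) \<le> card (range (to_ac :: 'f \<Rightarrow> 'f alg_closure))" .
  qed
qed

section \<open>The subcode\<close>

lemma form_zero_if_chart_zero:
  fixes A :: "'k::alg_closed_field^3 \<Rightarrow> 'k"
  assumes "is_form UNIV d A" "\<And>x y. A (vector [x, y, 1]) = 0"
  shows "A v = 0"
proof -
  obtain c where c: "\<And>v. A v = (\<Sum>i\<le>d. \<Sum>j\<le>d - i. c i j * (v$1)^i * (v$2)^j * (v$3)^(d - i - j))"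
    using assms(1) unfolding is_form_def by blast
  define g where "g = (\<Sum>i\<le>d. monom (\<Sum>j\<le>d-i. monom (c i j) j) i)"
  have "eval2 g x y = 0" for x y
    using assms(2)[of x y] by (simp add: g_def dehomogenize_coeffs c vector_3)
  hence "g = 0" by (rule eq_0_if_eval2_eq_0)
  hence "coeff (coeff g i) j = 0" for i j by simp
  hence "c i j = 0" if "i + j \<le> d" for i j using that unfolding g_def dehomogenize_coeffs by metis
  thus ?thesis unfolding c by (intro sum.neutral ballI) auto
qed

lemma card_monomials: "2 * card (Sigma {..d} (\<lambda>i. {..d - i})) = (d + 1) * (d + 2)"
proof -
  have "card (Sigma {..d} (\<lambda>i. {..d - i})) = (\<Sum>i<Suc d. Suc (Suc d - Suc i))"
    by (simp add: lessThan_Suc_atMost)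
  also have "\<dots> = (\<Sum>i<Suc d. Suc i)" by (rule sum.nat_diff_reindex)
  finally have "card (Sigma {..d} (\<lambda>i. {..d - i})) = (\<Sum>i<Suc d. Suc i)" .
  moreover have "2 * (\<Sum>i<Suc d. Suc i) = (d + 1) * (d + 2)" by (induction d) auto
  ultimately show ?thesis by simp
qed

locale hermitian_code = hermitian_pair q \<tau> t g0
  for q and \<tau> t g0 :: "'f::{field,finite} alg_closure" +
  fixes Q :: "'n::finite \<Rightarrow> 'f alg_closure pt"
  assumes GF_range: "GF (q^2) = range (to_ac :: 'f \<Rightarrow> 'f alg_closure)"
    and Q: "bij_betw Q UNIV {vec.span {pi_vec g} | g. g \<in> {g. g ^ (q^4 + q^2 + 1) = 1 \<and> \<tau> * g ^ (q^3 + 1) \<in> Dq} - Gset}"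
begin

text \<open>The parameters \<open>g\<close> of the evaluation points.\<close>

definition pts :: "'f alg_closure set" where
  "pts = {g. g ^ n2 = 1 \<and> \<tau> * g ^ (q^3 + 1) \<in> Dq} - Gset"

lemma pts_not_Gset: "g \<in> pts \<Longrightarrow> g ^ n2 = 1 \<and> K.F (pi_vec g) = 0 \<and> Hform q t (pi_vec g) \<noteq> 0"
proof -
  assume g: "g \<in> pts"
  hence F: "K.F (pi_vec g) = 0" and n: "g ^ n2 = 1" unfolding KF pts_def using Hform_point[OF \<tau>, of g] by auto
  have "g \<noteq> 0" using n by auto
  moreover have False if H: "Hform q t (pi_vec g) = 0"
  proof -
    obtain h where h: "h \<in> Gset" "pi_vec g = pi_vec g $ 3 *s pi_vec h"
      using common_point_in_orbit[OF F H] \<open>g \<noteq> 0\<close> by (auto simp del: power_Suc)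
    have "pi_vec g $ 1 = pi_vec h $ 1" using h(2) by (simp add: vec3_eq_iff)
    hence "g = h" by simp
    thus False using h(1) g by (simp add: pts_def)
  qed
  ultimately show ?thesis using F n by blast
qed

lemma card_Gset: "card Gset = N" "finite Gset"
proof -
  have "inj_on (\<lambda>u. g0 * u) {u. u ^ N = 1}" using g00 by (auto simp: inj_on_def)
  thus "card Gset = N" unfolding Gset_def using card_roots_of_unity[of N] of_nat_N by (simp add: card_image)
  show "finite Gset" unfolding Gset_def using card_roots_of_unity[of N] of_nat_N by simp
qed

lemma card_pts: "card pts = q * N" "finite pts"
proof -
  have "Gset \<subseteq> {g. g ^ n2 = 1 \<and> \<tau> * g ^ (q^3 + 1) \<in> Dq}"
  proof
    fix g assume g: "g \<in> Gset"
    show "g \<in> {g. g ^ n2 = 1 \<and> \<tau> * g ^ (q^3 + 1) \<in> Dq}"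
      unfolding mem_Collect_eq GsetD(2)[OF g] using GsetD(1)[OF g] g0_on(1) by blast
  qed
  hence "card pts = N * (q + 1) - N"
    unfolding pts_def by (simp only: card_Diff_subset[OF card_Gset(2)] card_hermitian_points(1)[OF \<tau>] card_Gset(1))
  thus "card pts = q * N" by (simp add: mult.commute)
  show "finite pts" unfolding pts_def using card_hermitian_points(2)[OF \<tau>] by simp
qed

definition gam :: "'n \<Rightarrow> 'f alg_closure" where
  "gam i = (SOME g. g \<in> pts \<and> Q i = vec.span {pi_vec g})"

lemma gam: "gam i \<in> pts" "Q i = vec.span {pi_vec (gam i)}"
proof -
  have "Q i \<in> {vec.span {pi_vec g} | g. g \<in> pts}" using bij_betwE[OF Q] by (simp add: pts_def)
  hence "\<exists>g. g \<in> pts \<and> Q i = vec.span {pi_vec g}" by blast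
  from someI_ex[OF this] show "gam i \<in> pts" "Q i = vec.span {pi_vec (gam i)}" unfolding gam_def by blast+
qed

lemma bij_gam: "bij_betw gam UNIV pts"
  unfolding bij_betw_def
proof
  show "inj gam"
  proof (rule injI)
    fix i j assume "gam i = gam j"
    hence "Q i = Q j" using gam(2) by metis
    thus "i = j" using bij_betw_imp_inj_on[OF Q] by (simp add: inj_eq)
  qed
  show "range gam = pts"
  proof (intro equalityI subsetI)
    fix g assume g: "g \<in> pts"
    hence "vec.span {pi_vec g} \<in> range Q"
      unfolding bij_betw_imp_surj_on[OF Q] pts_def[symmetric] by blast
    then obtain i where "Q i = vec.span {pi_vec g}" by auto
    hence "gam i = g" using gam(2)[of i] span_pi_vec_eq_iff by metis
    thus "g \<in> range gam" by blast
  qed (use gam in auto)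
qed

lemma card_n: "CARD('n) = q * N"
  using bij_betw_same_card[OF bij_gam] card_pts by simp

text \<open>Coordinates in the ground field of the \<open>i\<close>-th evaluation point, after straightening.\<close>

definition wv :: "'n \<Rightarrow> 'f alg_closure^3" where
  "wv i = (SOME w. (\<forall>j. w $ j \<in> GF (q^2)) \<and> (\<exists>x. x \<noteq> 0 \<and> Nmat *v w = x *s pi_vec (gam i)))"

lemma wv: "wv i $ j \<in> GF (q^2)" "\<exists>x. x \<noteq> 0 \<and> Nmat *v wv i = x *s pi_vec (gam i)"
proof -
  have "gam i ^ n2 = 1" using pts_not_Gset[OF gam(1)] by blast
  then obtain x w where "x \<noteq> 0" "w \<noteq> 0" "\<And>j. w $ j \<in> GF (q^2)" "Nmat *v w = x *s pi_vec (gam i)"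
    by (rule pi_vec_rational) (rule that)
  hence "\<exists>w. (\<forall>j. w $ j \<in> GF (q^2)) \<and> (\<exists>x. x \<noteq> 0 \<and> Nmat *v w = x *s pi_vec (gam i))"
    by (intro exI[of _ w] conjI allI exI[of _ x])
  from someI_ex[OF this, folded wv_def] show "wv i $ j \<in> GF (q^2)" "\<exists>x. x \<noteq> 0 \<and> Nmat *v wv i = x *s pi_vec (gam i)"
    by simp_all
qed

lemma wv_scale:
  obtains x where "x \<noteq> 0" "Nmat *v wv i = x *s pi_vec (gam i)"
proof -
  from wv(2)[of i] obtain x where x: "x \<noteq> 0 \<and> Nmat *v wv i = x *s pi_vec (gam i)" by (rule exE)
  show ?thesis by (rule that[OF conjunct1[OF x] conjunct2[OF x]])
qed

lemma span_wv: "Q i = vec.span {Nmat *v wv i}"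
proof -
  obtain x where x: "x \<noteq> 0" "Nmat *v wv i = x *s pi_vec (gam i)" by (rule wv_scale)
  have "vec.span {Nmat *v wv i} = vec.span {pi_vec (gam i)}" by (subst x(2)) (rule span_scale[OF x(1)])
  thus ?thesis by (rule trans[OF gam(2) sym])
qed

text \<open>The constant that makes the denominator commute with the Frobenius collineation.\<close>

definition mu :: "'f alg_closure" where
  "mu = (SOME \<mu>. \<mu> \<noteq> 0 \<and> (\<forall>v. den \<mu> (Phi v) = (den \<mu> v) ^ (q^2)))"

lemma mu: "mu \<noteq> 0" "den mu (Phi v) = (den mu v) ^ (q^2)"
proof -
  have "\<exists>\<mu>. \<mu> \<noteq> 0 \<and> (\<forall>v. den \<mu> (Phi v) = (den \<mu> v) ^ (q^2))"
  proof -
    obtain \<mu> where "\<mu> \<noteq> 0" "\<And>v. den \<mu> (Phi v) = (den \<mu> v) ^ (q^2)"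
      by (rule exists_den_constant) (rule that)
    thus ?thesis by (intro exI[of _ \<mu>] conjI allI)
  qed
  from someI_ex[OF this, folded mu_def] show "mu \<noteq> 0" "den mu (Phi v) = (den mu v) ^ (q^2)" by simp_all
qed

text \<open>The value of \<open>X\<^sub>1 X\<^sub>2 X\<^sub>0 / H\<^sub>t\<close> at the chosen coordinates; it has degree \<open>2 - q\<close> in them, which balances the degree of the forms.\<close>

definition ratio :: "'n \<Rightarrow> 'f alg_closure" where
  "ratio i = (let v = Nmat *v wv i in v$1 * v$2 * v$3 / den mu v)"

lemma ratio: "ratio i \<noteq> 0" "ratio i \<in> GF (q^2)" "den mu (Nmat *v wv i) \<noteq> 0"
proof -
  obtain x where x: "x \<noteq> 0" "Nmat *v wv i = x *s pi_vec (gam i)" by (rule wv_scale)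
  have g: "gam i ^ n2 = 1" "Hform q t (pi_vec (gam i)) \<noteq> 0" using pts_not_Gset[OF gam(1)] by blast+
  hence gn: "gam i \<noteq> 0" by auto
  have "den mu (pi_vec (gam i)) \<noteq> 0" using g mu by (simp add: den_def)
  thus d: "den mu (Nmat *v wv i) \<noteq> 0"
    unfolding x(2) form_homogeneous[OF is_form_den] using x(1) by simp
  show "ratio i \<noteq> 0" using d x(1) gn unfolding ratio_def Let_def x(2) by simp
  have "frob2 (wv i) = wv i" using wv(1) frob2_fixed_iff by blast
  hence P: "Phi (Nmat *v wv i) = Nmat *v wv i" using Nmat_frob2[of "wv i"] by simp
  define v where "v = Nmat *v wv i"
  have "(v$1 * v$2 * v$3) ^ (q^2) = Phi v$1 * Phi v$2 * Phi v$3" by (simp add: power_mult_distrib mult_ac)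
  hence "(v$1 * v$2 * v$3) ^ (q^2) = v$1 * v$2 * v$3" using P by (simp add: v_def)
  moreover have "den mu v ^ (q^2) = den mu v" using mu(2)[of v] P by (simp add: v_def)
  ultimately show "ratio i \<in> GF (q^2)" by (simp add: GF_def ratio_def Let_def power_divide flip: v_def)
qed

lemma to_ac_of_ac_GF: "x \<in> GF (q^2) \<Longrightarrow> to_ac (of_ac x :: 'f) = x"
  unfolding GF_range by (rule to_ac_of_ac)

text \<open>
The word of the function whose numerator has the coefficients \<open>c\<close> in straightened coordinates, written over the
finite field.
\<close>

definition word :: "(nat \<times> nat \<Rightarrow> 'f) \<Rightarrow> 'f^'n" where
  "word c = (\<chi> i. of_ac (ratio i) * (\<Sum>a\<le>q-2. \<Sum>b\<le>q-2-a. c (a, b) *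
      of_ac (wv i $ 1) ^ a * of_ac (wv i $ 2) ^ b * of_ac (wv i $ 3) ^ (q-2-a-b)))"

definition wform :: "(nat \<times> nat \<Rightarrow> 'f) \<Rightarrow> 'f alg_closure^3 \<Rightarrow> 'f alg_closure" where
  "wform c v = (\<Sum>a\<le>q-2. \<Sum>b\<le>q-2-a. to_ac (c (a, b)) * (v$1)^a * (v$2)^b * (v$3)^(q-2-a-b))"

abbreviation "Ind \<equiv> Sigma {..q-2} (\<lambda>a. {..q-2-a})"

lemma wform_form: "is_form (GF (q^2)) (q - 2) (wform c)" "is_form UNIV (q - 2) (wform c)"
  unfolding is_form_def wform_def GF_range by (rule exI[of _ "\<lambda>i j. to_ac (c (i, j))"], simp)+

lemma word_value: "to_ac (word c $ i) = ratio i * wform c (wv i)"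
  by (simp add: word_def wform_def to_ac_sum to_ac_of_ac_GF wv ratio)

lemma word_add: "word (\<lambda>x. c x + d x) = word c + word d"
  by (simp add: word_def vec_eq_iff algebra_simps sum.distrib)

lemma word_scale: "word (\<lambda>x. s * c x) = s *s word c"
  by (simp add: word_def vec_eq_iff sum_distrib_left mult_ac)

lemma word_diff: "word (\<lambda>x. c x - d x) = word c - word d"
  by (simp add: word_def vec_eq_iff algebra_simps sum_subtractf)

lemma word_cong: "(\<And>x. x \<in> Ind \<Longrightarrow> c x = d x) \<Longrightarrow> word c = word d"
  unfolding word_def vec_eq_iff by (auto intro!: sum.cong)

lemma word_in_code: "word c \<in> functional_code q K.Y Q (set_divisor orbit_pts)"
proof -
  let ?f = "K.frac (num (\<lambda>v. wform c (Mmat *v v))) (den mu)"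
  have f: "?f \<in> RR_space q K.Y (set_divisor orbit_pts)"
    by (rule num_in_RR_space[OF wform_form(1) mu])
  moreover have "to_ac (word c $ i) = rat_value ?f (Q i)" for i
  proof -
    let ?p = "Nmat *v wv i"
    obtain x where x: "x \<noteq> 0" "?p = x *s pi_vec (gam i)" by (rule wv_scale)
    have "K.F (pi_vec (gam i)) = 0" using pts_not_Gset[OF gam(1)] by blast
    hence "K.F ?p = 0" unfolding x(2) K.Kform_zero_scale by simp
    hence "rat_value ?f (vec.span {?p}) = num (\<lambda>v. wform c (Mmat *v v)) ?p / den mu ?p"
      by (rule K.rat_value_frac[OF quots_num_den[OF is_form_compose_matrix[OF wform_form(2)] mu(1)] ratio(3)])
    hence "rat_value ?f (Q i) = num (\<lambda>v. wform c (Mmat *v v)) ?p / den mu ?p"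
      by (simp only: span_wv[of i, symmetric])
    also have "\<dots> = ratio i * wform c (wv i)" by (simp add: num_def ratio_def Let_def)
    finally show ?thesis by (simp add: word_value)
  qed
  ultimately show ?thesis unfolding functional_code_def by blast
qed

text \<open>
This holds because \<open>n2 = (q\<^sup>2 + 1) q\<^sup>2 + 1\<close> is coprime to \<open>q\<^sup>2 + 1\<close>; so projection to the second coordinate separates the points of \<open>\<Pi>\<close>, as
\<open>bezout_bound\<close> demands.
\<close>

lemma gam_second_inj:
  assumes "g ^ n2 = 1" "h ^ n2 = 1" "g ^ (q^2 + 1) = h ^ (q^2 + 1)"
  shows "g = (h :: 'f alg_closure)"
proof -
  define r where "r = g / h"
  have h0: "h \<noteq> 0" using assms(2) by auto
  have 1: "r ^ n2 = 1" using assms by (simp add: r_def power_divide)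
  have 2: "r ^ (q^2 + 1) = 1" unfolding r_def power_divide assms(3) using h0 by simp
  have "n2 = (q^2 + 1) * q^2 + 1" by (simp add: power2_eq_square power4_eq_xxxx algebra_simps)
  hence "r ^ n2 = (r ^ (q^2 + 1)) ^ (q^2) * r" by (simp only: power_add power_mult power_one_right)
  hence "r = 1" unfolding 1 2 by simp
  thus ?thesis using h0 by (simp add: r_def)
qed

text \<open>
The factor \<open>ratio\<close> has no zeros, so the zeros of a word are common zeros of a form of degree \<open>q - 2\<close> and the curve, with distinct second
coordinates.
\<close>

lemma word_zeros:
  assumes "x \<in> Ind" "c x \<noteq> 0"
  shows "card {i. word c $ i = 0} \<le> (q + 1) * (q - 2)"
proof -
  define A where "A = (\<lambda>v. wform c (Mmat *v v))"
  have A: "is_form UNIV (q - 2) A" unfolding A_def by (rule is_form_compose_matrix[OF wform_form(2)])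
  obtain g where g: "\<And>x y. eval2 g x y = A (vector [x, y, 1])" "total_degree_le (q - 2) g"
    using form_dehomogenize[OF A] by blast
  have "g \<noteq> 0"
  proof
    assume "g = 0"
    hence "A (vector [x, y, 1]) = 0" for x y using g(1)[of x y] by simp
    hence "A v = 0" for v by (rule form_zero_if_chart_zero[OF A])
    hence "wform c v = 0" for v using MN_vec[of v] unfolding A_def by metis
    hence "to_ac (c (fst x, snd x)) = 0"
      by (intro form_coeffs_eq_0[where d = "q - 2" and c = "\<lambda>i j. to_ac (c (i, j))"])
         (use assms(1) in \<open>auto simp: wform_def\<close>)
    thus False using assms(2) by simp
  qed
  define Z where "Z = (\<lambda>i. (gam i, gam i ^ (q^2 + 1))) ` {i. word c $ i = 0}"
  have gn: "gam i ^ n2 = 1" for i using pts_not_Gset[OF gam(1)] by blast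
  have inj: "inj gam" using bij_gam by (simp add: bij_betw_def)
  have "card Z \<le> (q + 1) * (q - 2)"
  proof (rule K.bezout_bound[OF \<open>g \<noteq> 0\<close> g(2)])
    show "q - 2 < q - 1" using q3 by simp
    show "finite Z" unfolding Z_def by simp
    show "inj_on snd Z" unfolding Z_def by (auto simp: inj_on_def simp del: power_Suc intro: gam_second_inj[OF gn gn])
    fix x y assume "(x, y) \<in> Z"
    then obtain i where i: "x = gam i" "y = gam i ^ (q^2 + 1)" "word c $ i = 0" unfolding Z_def by blast
    have v: "vector [x, y, 1] = pi_vec (gam i)" using i by simp
    obtain s where s: "s \<noteq> 0" "Nmat *v wv i = s *s pi_vec (gam i)" by (rule wv_scale)
    have "ratio i * wform c (wv i) = 0" using i(3) word_value[of c i] by simp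
    hence "A (Nmat *v wv i) = 0" using ratio(1) by (simp add: A_def)
    hence "A (pi_vec (gam i)) = 0" unfolding s(2) form_homogeneous[OF A] using s(1) by simp
    thus "eval2 K.Kpoly x y = 0 \<and> eval2 g x y = 0"
      unfolding K.eval2_Kpoly_Kform g(1) v using pts_not_Gset[OF gam(1)] by blast
  qed
  moreover have "inj_on (\<lambda>i. (gam i, gam i ^ (q^2 + 1))) {i. word c $ i = 0}"
    using inj by (auto simp: inj_on_def)
  ultimately show ?thesis unfolding Z_def by (simp add: card_image)
qed

lemma zeros_lt_length: "(q + 1) * (q - 2) < q * N"
proof -
  obtain r where r: "q = r + 2" using q3 by (metis add.commute le_Suc_ex less_imp_le_nat)
  have "(q + 1) * (q - 2) < q * (q * (q - 1) + 1)" unfolding r by (simp add: algebra_simps)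
  thus ?thesis by (simp only: N_q)
qed

lemma word_nonzero:
  assumes "word c = 0" "x \<in> Ind"
  shows "c x = 0"
proof (rule ccontr)
  assume "c x \<noteq> 0"
  hence "card {i. word c $ i = 0} \<le> (q + 1) * (q - 2)" by (rule word_zeros[OF assms(2)])
  moreover have "{i. word c $ i = 0} = UNIV" using assms(1) by auto
  ultimately show False using zeros_lt_length card_n by simp
qed

text \<open>A product of \<open>q - 2\<close> scaled secants from \<open>exists_disjoint_secants\<close> is a form over \<open>\<Pi>\<close>, and it vanishes at the \<open>q + 1\<close> points of each.\<close>

lemma exists_minimum_word:
  obtains c where "word c \<noteq> 0" "(q + 1) * (q - 2) \<le> card {i. word c $ i = 0}"
proof -
  obtain S Z where S: "finite S" "card S = q - 2"
    and Sn: "\<And>s. s \<in> S \<Longrightarrow> s ^ n2 = 1" and Zc: "\<And>s. s \<in> S \<Longrightarrow> card (Z s) = q + 1"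
    and Z: "\<And>s g. s \<in> S \<Longrightarrow> g \<in> Z s \<Longrightarrow> g ^ n2 = 1 \<and> \<tau> * g ^ (q^3 + 1) \<in> Dq \<and>
        \<tau> * g ^ (q^3 + 1) \<noteq> \<tau> * g0 ^ (q^3 + 1) \<and> s * g + s ^ (q^2 + 1) * g ^ (q^2 + 1) + 1 = 0"
    and disj: "\<And>s s'. s \<in> S \<Longrightarrow> s' \<in> S \<Longrightarrow> s \<noteq> s' \<Longrightarrow> Z s \<inter> Z s' = {}"
    by (rule exists_disjoint_secants[OF g0_on(1)]) (rule that)
  define line where "line = (\<lambda>s (v::'f alg_closure^3). s * v$1 + s ^ (q^2 + 1) * v$2 + v$3)"
  have ex: "\<exists>\<nu>. \<nu> \<noteq> 0 \<and> (\<forall>v. \<nu> * line s (Phi v) = (\<nu> * line s v) ^ (q^2))" if "s \<in> S" for s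
  proof -
    have "s \<noteq> 0" using Sn[OF that] by auto
    moreover have "line s (Phi v) = s * (line s v) ^ (q^2)" for v
      unfolding line_def by (rule line_Phi[OF Sn[OF that]])
    ultimately obtain \<nu> where "\<nu> \<noteq> 0" "\<And>v. \<nu> * line s (Phi v) = (\<nu> * line s v) ^ (q^2)"
      by (rule absorb_constant[where B = "line s"]) (rule that)
    thus ?thesis by blast
  qed
  then obtain \<nu> where \<nu>: "\<And>s. s \<in> S \<Longrightarrow> \<nu> s \<noteq> 0"
    "\<And>s v. s \<in> S \<Longrightarrow> \<nu> s * line s (Phi v) = (\<nu> s * line s v) ^ (q^2)" by metis
  define A where "A = (\<lambda>v. \<Prod>s\<in>S. \<nu> s * line s v)"
  have "is_form UNIV 1 (line s)" for s
    unfolding line_def by (intro is_form_add is_form_scale is_form_coord)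
  hence "is_form UNIV (card S) A"
    unfolding A_def by (intro is_form_prod is_form_scale S)
  hence Af: "is_form UNIV (q - 2) A" by (simp add: S)
  have "A (Phi v) = (A v) ^ (q^2)" for v
    unfolding A_def by (simp add: prod_power_distrib \<nu>(2))
  hence "is_form (GF (q^2)) (q - 2) (\<lambda>v. A (Nmat *v v))" by (rule is_form_over_GF_Nmat[OF Af])
  then obtain c where c: "\<And>i j. c i j \<in> GF (q^2)"
    "\<And>v. A (Nmat *v v) = (\<Sum>i\<le>q-2. \<Sum>j\<le>q-2 - i. c i j * (v$1)^i * (v$2)^j * (v$3)^(q-2 - i - j))"
    unfolding is_form_def by blast
  define c' :: "nat \<times> nat \<Rightarrow> 'f" where "c' = (\<lambda>(i, j). of_ac (c i j))"
  have wA: "wform c' v = A (Nmat *v v)" for v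
    unfolding c(2) wform_def by (simp add: c'_def to_ac_of_ac_GF c(1))
  have "word c' \<noteq> 0"
  proof
    assume "word c' = 0"
    hence "c' x = 0" if "x \<in> Ind" for x using word_nonzero that by blast
    hence "wform c' v = 0" for v unfolding wform_def by (intro sum.neutral ballI) auto
    hence "A (Nmat *v (Mmat *v vector [0, 0, 1])) = 0" using wA by metis
    moreover have "A (vector [0, 0, 1]) = (\<Prod>s\<in>S. \<nu> s)"
      unfolding A_def line_def by (simp add: vector_3)
    ultimately show False using \<nu>(1) S(1) by simp
  qed
  moreover have "(q + 1) * (q - 2) \<le> card {i. word c' $ i = 0}"
  proof -
    have finZ: "finite (Z s)" if "s \<in> S" for s using Zc[OF that] by (metis card.infinite add_is_0 one_neq_zero)
    have ZU: "card (\<Union>s\<in>S. Z s) = (q + 1) * (q - 2)"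
      using card_UN_disjoint[OF S(1), of Z] finZ disj Zc S(2) by (simp add: mult.commute)
    have "(\<Union>s\<in>S. Z s) \<subseteq> gam ` {i. word c' $ i = 0}"
    proof
      fix g assume "g \<in> (\<Union>s\<in>S. Z s)"
      then obtain s where s: "s \<in> S" "g \<in> Z s" by blast
      note Zg = Z[OF s]
      have "g \<notin> Gset" using Zg GsetD(2) by blast
      hence "g \<in> pts" using Zg by (simp add: pts_def)
      then obtain i where i: "g = gam i" using bij_gam by (auto simp: bij_betw_def)
      obtain x where "x \<noteq> 0" and x: "Nmat *v wv i = x *s pi_vec (gam i)" by (rule wv_scale)
      have "line s (pi_vec g) = 0" using Zg by (simp add: line_def del: power_Suc)
      hence "A (pi_vec g) = 0" unfolding A_def using s(1) S(1) by (auto simp: prod_zero_iff)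
      hence "wform c' (wv i) = x ^ (q - 2) * 0" unfolding wA x form_homogeneous[OF Af] i by simp
      hence "to_ac (word c' $ i) = 0" by (simp add: word_value)
      thus "g \<in> gam ` {i. word c' $ i = 0}" using i by simp
    qed
    hence "card (\<Union>s\<in>S. Z s) \<le> card (gam ` {i. word c' $ i = 0})" by (rule card_mono[rotated]) simp
    also have "\<dots> \<le> card {i. word c' $ i = 0}" by (rule card_image_le) simp
    finally show ?thesis unfolding ZU .
  qed
  ultimately show ?thesis by (rule that)
qed

definition code :: "('f^'n) set" where "code = range word"

lemma subspace_code: "vec.subspace code"
proof (rule vec.subspaceI)
  have "word (\<lambda>_. 0) = 0" by (simp add: word_def vec_eq_iff)
  thus "0 \<in> code" unfolding code_def using rangeI[of word "\<lambda>_. 0"] by simp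
  fix x y assume "x \<in> code" "y \<in> code"
  then obtain c d where "x = word c" "y = word d" unfolding code_def by blast
  thus "x + y \<in> code" unfolding code_def by (simp flip: word_add)
next
  fix s x assume "x \<in> code"
  then obtain c where "x = word c" unfolding code_def by blast
  thus "s *s x \<in> code" unfolding code_def by (simp flip: word_scale)
qed

text \<open>The words of the monomials form a basis, because a nonzero form has a nonzero word.\<close>

lemma dim_code: "vec.dim code = (q^2 - q) div 2"
proof -
  define e :: "nat \<times> nat \<Rightarrow> nat \<times> nat \<Rightarrow> 'f" where "e = (\<lambda>x y. if y = x then 1 else 0)"
  define B where "B = (\<lambda>x. word (e x)) ` Ind"
  have word_sum: "word (\<lambda>y. \<Sum>x\<in>J. u x * e x y) = (\<Sum>x\<in>J. u x *s word (e x))" for J and u :: "nat \<times> nat \<Rightarrow> 'f"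
  proof (induction J rule: infinite_finite_induct)
    case (insert x J)
    thus ?case by (simp add: word_add word_scale)
  qed (simp_all add: word_def vec_eq_iff)
  have comb: "(\<Sum>x\<in>Ind. u x * e x y) = u y" if "y \<in> Ind" for y and u :: "nat \<times> nat \<Rightarrow> 'f"
  proof -
    have "(\<Sum>x\<in>Ind. u x * e x y) = (\<Sum>x\<in>Ind. if x = y then u x else 0)"
      by (rule sum.cong) (auto simp: e_def)
    thus ?thesis using that by (simp add: sum.delta)
  qed
  have inj: "inj_on (\<lambda>x. word (e x)) Ind"
  proof (rule inj_onI)
    fix x y assume xy: "x \<in> Ind" "y \<in> Ind" "word (e x) = word (e y)"
    have "word (\<lambda>z. e x z - e y z) = 0" using xy(3) by (simp add: word_diff)
    hence "e x x - e y x = 0" using word_nonzero xy(1) by blast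
    thus "x = y" by (simp add: e_def split: if_splits)
  qed
  have "vec.independent B"
  proof (rule vec.independent_if_scalars_zero)
    show "finite B" by (simp add: B_def)
    fix f w assume f: "(\<Sum>x\<in>B. f x *s x) = 0" and w: "w \<in> B"
    obtain x where x: "x \<in> Ind" "w = word (e x)" using w by (auto simp: B_def)
    have "word (\<lambda>y. \<Sum>x\<in>Ind. f (word (e x)) * e x y) = 0"
      unfolding word_sum using f unfolding B_def sum.reindex[OF inj] o_def .
    hence "(\<Sum>z\<in>Ind. f (word (e z)) * e z x) = 0" using word_nonzero x(1) by blast
    thus "f w = 0" using comb[OF x(1), of "\<lambda>z. f (word (e z))"] x(2) by simp
  qed
  moreover have "B \<subseteq> code" unfolding B_def code_def by blast
  moreover have "code \<subseteq> vec.span B"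
  proof
    fix w assume "w \<in> code"
    then obtain c where c: "w = word c" unfolding code_def by blast
    have "w = word (\<lambda>y. \<Sum>x\<in>Ind. c x * e x y)" unfolding c by (rule word_cong) (simp only: comb)
    also have "\<dots> = (\<Sum>x\<in>Ind. c x *s word (e x))" by (rule word_sum)
    also have "\<dots> \<in> vec.span B"
      by (intro vec.span_sum vec.span_scale vec.span_base) (auto simp: B_def)
    finally show "w \<in> vec.span B" .
  qed
  moreover have "card B = (q^2 - q) div 2"
  proof -
    have "card B = card Ind" unfolding B_def by (rule card_image[OF inj])
    moreover have "2 * card Ind = (q - 2 + 1) * (q - 2 + 2)" by (rule card_monomials)
    moreover have "(q - 2 + 1) * (q - 2 + 2) = q^2 - q"
    proof -
      obtain r where r: "q = r + 2" using q3 by (metis add.commute le_Suc_ex less_imp_le_nat)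
      show ?thesis unfolding r by (simp add: power2_eq_square)
    qed
    ultimately have "2 * card B = q^2 - q" by (simp only:)
    thus ?thesis by presburger
  qed
  ultimately show ?thesis by (intro vec.dim_unique)
qed

lemma min_distance_code: "min_distance code = q * N - (q + 1) * (q - 2)"
  unfolding min_distance_def
proof (rule Min_eqI)
  have card_split: "card {i. w $ i \<noteq> 0} = q * N - card {i. w $ i = 0}" for w :: "'f^'n"
  proof -
    have "{i. w $ i \<noteq> 0} = UNIV - {i. w $ i = 0}" by auto
    thus ?thesis by (simp add: card_Diff_subset card_n)
  qed
  have "{hamming_distance x y |x y. x \<in> code \<and> y \<in> code \<and> x \<noteq> y} \<subseteq> (\<lambda>(x, y). hamming_distance x y) ` (code \<times> code)"
    by auto
  thus "finite {hamming_distance x y |x y. x \<in> code \<and> y \<in> code \<and> x \<noteq> y}" by (rule finite_subset) simp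
  have ham: "hamming_distance (word c) (word d) = q * N - card {i. word (\<lambda>x. c x - d x) $ i = 0}" for c d
    unfolding hamming_distance_def word_diff card_split[symmetric] by simp
  fix k assume "k \<in> {hamming_distance x y |x y. x \<in> code \<and> y \<in> code \<and> x \<noteq> y}"
  then obtain v w where vw: "k = hamming_distance v w" "v \<in> code" "w \<in> code" "v \<noteq> w" by blast
  obtain c where c: "v = word c" using vw(2) unfolding code_def by (rule rangeE)
  obtain d where d: "w = word d" using vw(3) unfolding code_def by (rule rangeE)
  note cd = vw(1,4)[unfolded c d]
  have "\<not> (\<forall>x\<in>Ind. c x = d x)"
  proof
    assume "\<forall>x\<in>Ind. c x = d x"
    hence "word c = word d" by (intro word_cong) (rule bspec)
    with cd(2) show False by (rule notE)
  qed
  then obtain x where x: "x \<in> Ind" "c x \<noteq> d x" unfolding ball_simps(10) by (rule bexE)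
  have "card {i. word (\<lambda>x. c x - d x) $ i = 0} \<le> (q + 1) * (q - 2)"
    by (rule word_zeros[of x "\<lambda>x. c x - d x", OF x(1)]) (use x(2) in simp)
  thus "q * N - (q + 1) * (q - 2) \<le> k" unfolding cd(1) ham by (rule diff_le_mono2)
next
  obtain c where c: "word c \<noteq> 0" "(q + 1) * (q - 2) \<le> card {i. word c $ i = 0}" by (rule exists_minimum_word)
  have w0: "word (\<lambda>_. 0) = 0" by (simp add: word_def vec_eq_iff)
  obtain x where x: "x \<in> Ind" "c x \<noteq> 0"
  proof (rule ccontr)
    assume "\<not> thesis"
    hence "c x = 0" if "x \<in> Ind" for x using that \<open>\<And>x. x \<in> Ind \<Longrightarrow> c x \<noteq> 0 \<Longrightarrow> thesis\<close> by metis
    hence "word c = word (\<lambda>_. 0)" by (rule word_cong)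
    thus False using c(1) w0 by simp
  qed
  have "card {i. word c $ i = 0} \<le> (q + 1) * (q - 2)" by (rule word_zeros[of x c, OF x])
  hence eq: "card {i. word c $ i = 0} = (q + 1) * (q - 2)" using c(2) by simp
  have "{i. word c $ i \<noteq> 0} = UNIV - {i. word c $ i = 0}" by auto
  hence "hamming_distance (word c) 0 = q * N - (q + 1) * (q - 2)"
    unfolding hamming_distance_def by (simp add: card_Diff_subset card_n eq del: power_Suc)
  moreover have "0 \<in> code" unfolding code_def using w0 rangeI[of word "\<lambda>_. 0"] by simp
  moreover have "word c \<in> code" unfolding code_def by simp
  ultimately show "q * N - (q + 1) * (q - 2) \<in> {hamming_distance x y |x y. x \<in> code \<and> y \<in> code \<and> x \<noteq> y}"
    using c(1) by (intro CollectI exI[of _ "word c"] exI[of _ 0]) simp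
qed

lemma div_degree_orbit: "div_degree (set_divisor orbit_pts) = int N"
proof -
  have "orbit_pts = (\<lambda>g. vec.span {pi_vec g}) ` Gset" by (auto simp: orbit_pts_def)
  moreover have "inj_on (\<lambda>g. vec.span {pi_vec g}) Gset" by (rule inj_onI) (simp only: span_pi_vec_eq_iff)
  ultimately have "card orbit_pts = N" using card_Gset by (simp add: card_image)
  moreover have "{P. set_divisor orbit_pts P \<noteq> 0} = orbit_pts" by (auto simp: set_divisor_def)
  ultimately show ?thesis unfolding div_degree_def by (simp add: set_divisor_def)
qed

end

section \<open>Singer orbits as cosets of roots of unity\<close>

context singer_field
begin

lemma singer_span:
  assumes "\<beta> ^ N = 1"
  shows "singer q \<beta> (vec.span {pi_vec g}) = vec.span {pi_vec (\<beta> * g)}"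
proof -
  have "\<beta> ^ (q^2 + 1) = \<beta> ^ N * \<beta> ^ q" unfolding N_add_q[symmetric] by (simp only: power_add)
  hence "(\<beta> * g) ^ (q^2 + 1) = \<beta> ^ q * g ^ (q^2 + 1)" unfolding power_mult_distrib assms by simp
  hence eq: "vector [\<beta> * (s *s pi_vec g)$1, \<beta> ^ q * (s *s pi_vec g)$2, (s *s pi_vec g)$3] = s *s pi_vec (\<beta> * g)" for s
    unfolding vec3_eq_iff by (simp add: vector_3 mult_ac del: power_Suc)
  show ?thesis unfolding singer_def vec.span_singleton image_image eq ..
qed

lemma singer_orbit_span:
  assumes "\<beta> ^ N = 1"
  shows "singer_orbit q \<beta> (vec.span {pi_vec g}) = {vec.span {pi_vec (g * \<beta> ^ k)} | k. True}"
proof -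
  have "(singer q \<beta> ^^ k) (vec.span {pi_vec g}) = vec.span {pi_vec (g * \<beta> ^ k)}" for k
  proof (induction k)
    case (Suc k)
    have "\<beta> * (g * \<beta> ^ k) = g * \<beta> ^ Suc k" by (simp add: mult_ac)
    with Suc show ?case unfolding funpow.simps o_apply by (simp only: singer_span[OF assms])
  qed simp
  thus ?thesis unfolding singer_orbit_def by simp
qed

lemma primitive_root_powers:
  fixes \<beta> :: 'k
  assumes "primitive_root_of_unity N \<beta>"
  shows "{u. u ^ N = 1} = {\<beta> ^ k | k. True}"
proof (rule card_seteq[symmetric])
  have \<beta>: "\<beta> ^ N = 1" "\<And>j. 0 < j \<Longrightarrow> j < N \<Longrightarrow> \<beta> ^ j \<noteq> 1" using assms by (auto simp: primitive_root_of_unity_def)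
  have \<beta>0: "\<beta> \<noteq> 0" using \<beta>(1) by auto
  note c = card_roots_of_unity[of N]
  show fin: "finite {u::'k. u ^ N = 1}" using c of_nat_N by simp
  show sub: "{\<beta> ^ k | k. True} \<subseteq> {u. u ^ N = 1}"
  proof clarify
    fix k show "(\<beta> ^ k) ^ N = 1" using \<beta>(1) by (metis mult.commute power_mult power_one)
  qed
  have "inj_on (\<lambda>k. \<beta> ^ k) {..<N}"
  proof (rule linorder_inj_onI)
    fix i j assume ij: "i < j" "i \<in> {..<N}" "j \<in> {..<N}"
    have "\<beta> ^ j = \<beta> ^ i * \<beta> ^ (j - i)" using ij(1) by (simp flip: power_add)
    moreover have "\<beta> ^ (j - i) \<noteq> 1" using \<beta>(2)[of "j - i"] ij by auto
    ultimately show "\<beta> ^ i \<noteq> \<beta> ^ j" using \<beta>0 by simp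
  qed auto
  hence "card ((\<lambda>k. \<beta> ^ k) ` {..<N}) = N" by (simp add: card_image)
  moreover have "(\<lambda>k. \<beta> ^ k) ` {..<N} \<subseteq> {\<beta> ^ k | k. True}" by auto
  ultimately have "N \<le> card {\<beta> ^ k | k. True}" using card_mono finite_subset[OF sub fin] by metis
  thus "card {u::'k. u ^ N = 1} \<le> card {\<beta> ^ k | k. True}" using c(1) of_nat_N by simp
qed

end

theorem theorem4p2:
  fixes q :: nat
    and \<tau> \<beta> :: "'f::{field,finite} alg_closure"
    and P :: "'f alg_closure pt"
    and H G D :: "'f alg_closure pt set"
    and Q :: "'n::finite \<Rightarrow> 'f alg_closure pt"
  assumes "primepow q" and "q > 2" and "CARD('f) = q^2"
    and "\<tau> ^ (q^2 + q + 1) = 1"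
    and "\<beta> \<in> GF (q^6)" and "primitive_root_of_unity (q^2 - q + 1) \<beta>"
    and "H = curve (Hform q \<tau>)"
    and "P \<in> H \<inter> Pi_plane q"
    and "G = singer_orbit q \<beta> P"
    and "D = (H \<inter> Pi_plane q) - G"
    and "bij_betw Q UNIV D"
  shows "\<exists>C :: ('f ^ 'n) set.
      C \<subseteq> functional_code q H Q (set_divisor G) \<and>
      vec.subspace C \<and>
      CARD('n) = q * (q^2 - q + 1) \<and>
      vec.dim C = (q^2 - q) div 2 \<and>
      int (min_distance C) = int q ^ 3 - 2 * (int q ^ 2 - int q - 1) \<and>
      int CARD('n) - div_degree (set_divisor G) = int q ^ 3 + 1 - 2 * (int q ^ 2 - int q + 1) \<and>
      int (min_distance C) = (int CARD('n) - div_degree (set_divisor G)) + 3"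
proof -
  note field = prime_power_field[OF assms(1,3)]
  interpret S: singer_field q \<tau>
    using assms(2,4) field(1,2) by unfold_locales
  have on_H: "vec.span {S.pi_vec g} \<in> H \<longleftrightarrow> Hform q \<tau> (S.pi_vec g) = 0" for g
    unfolding assms(7) by (rule curve_span_iff[OF is_form_Kform[of q \<tau> "\<tau> ^ (q^2 + 1)" 1, folded Hform_Kform] _ S.pi_vec_nonzero]) simp
  define pts0 where "pts0 = {g. g ^ (q^4 + q^2 + 1) = 1 \<and> \<tau> * g ^ (q^3 + 1) \<in> S.Dq}"
  have HPi: "H \<inter> Pi_plane q = {vec.span {S.pi_vec g} | g. g \<in> pts0}"
    unfolding S.Pi_plane_eq pts0_def using on_H S.Hform_point[OF S.\<tau>] by blast
  then obtain g0 where g0: "P = vec.span {S.pi_vec g0}" "g0 \<in> pts0" using assms(8) by blast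
  hence g0': "g0 ^ (q^4 + q^2 + 1) = 1" "\<tau> * g0 ^ (q^3 + 1) \<in> S.Dq" by (simp_all add: pts0_def)
  obtain t where t: "t ^ (q^2 + q + 1) = 1" "t \<noteq> \<tau>" "t * g0 ^ (q^3 + 1) \<in> S.Dq"
    by (rule S.exists_second_curve[OF S.\<tau> g0'])
  interpret HP: hermitian_pair q \<tau> t g0
    using t g0' by unfold_locales
  have \<beta>N: "\<beta> ^ (q^2 - q + 1) = 1" using assms(6) by (simp add: primitive_root_of_unity_def)
  have Gset: "HP.Gset = {g0 * \<beta> ^ k | k. True}"
    unfolding HP.Gset_def S.primitive_root_powers[OF assms(6)] by auto
  have G: "G = HP.orbit_pts"
  proof -
    have "G = {vec.span {S.pi_vec (g0 * \<beta> ^ k)} | k. True}"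
      using assms(9) unfolding g0(1) S.singer_orbit_span[OF \<beta>N] .
    also have "\<dots> = HP.orbit_pts" unfolding HP.orbit_pts_def Gset by auto
    finally show ?thesis .
  qed
  have D: "D = {vec.span {S.pi_vec g} | g. g \<in> pts0 - HP.Gset}"
  proof -
    have "D = (\<lambda>g. vec.span {S.pi_vec g}) ` pts0 - (\<lambda>g. vec.span {S.pi_vec g}) ` HP.Gset"
      unfolding assms(10) HPi G HP.orbit_pts_def image_def by auto
    also have "\<dots> = (\<lambda>g. vec.span {S.pi_vec g}) ` (pts0 - HP.Gset)"
      by (rule inj_on_image_set_diff[of _ UNIV, symmetric])
         (auto intro!: inj_onI simp only: S.span_pi_vec_eq_iff)
    finally show ?thesis by auto
  qed
  interpret HC: hermitian_code q \<tau> t g0 Q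
    using field(3) assms(11) by unfold_locales (simp_all add: D pts0_def)
  have H: "H = HP.K.Y" unfolding assms(7) HP.KF ..
  have N: "int (q^2 - q + 1) = int q ^ 2 - int q + 1"
  proof -
    have "q \<le> q^2" by (simp add: power2_eq_square)
    thus ?thesis by (simp add: of_nat_diff)
  qed
  have n: "int CARD('n) = int q * (int q ^ 2 - int q + 1)" unfolding HC.card_n of_nat_mult N ..
  have deg: "div_degree (set_divisor G) = int q ^ 2 - int q + 1"
    unfolding G HC.div_degree_orbit N ..
  have md: "int (min_distance HC.code) = int q * (int q ^ 2 - int q + 1) - (int q + 1) * (int q - 2)"
  proof -
    have "int (q * (q^2 - q + 1) - (q + 1) * (q - 2)) = int (q * (q^2 - q + 1)) - int ((q + 1) * (q - 2))"
      using HC.zeros_lt_length by (intro of_nat_diff) simp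
    also have "\<dots> = int q * (int q ^ 2 - int q + 1) - (int q + 1) * (int q - 2)"
      unfolding of_nat_mult N using assms(2) by (simp add: of_nat_diff)
    finally show ?thesis unfolding HC.min_distance_code .
  qed
  show ?thesis
  proof (intro exI[of _ HC.code] conjI)
    show "HC.code \<subseteq> functional_code q H Q (set_divisor G)"
      unfolding HC.code_def H G using HC.word_in_code by blast
    show "vec.subspace HC.code" by (rule HC.subspace_code)
    show "CARD('n) = q * (q^2 - q + 1)" by (rule HC.card_n)
    show "vec.dim HC.code = (q^2 - q) div 2" by (rule HC.dim_code)
    show "int (min_distance HC.code) = int q ^ 3 - 2 * (int q ^ 2 - int q - 1)"
      unfolding md by (simp add: algebra_simps power2_eq_square power3_eq_cube)
    show "int CARD('n) - div_degree (set_divisor G) = int q ^ 3 + 1 - 2 * (int q ^ 2 - int q + 1)"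
      unfolding n deg by (simp add: algebra_simps power2_eq_square power3_eq_cube)
    show "int (min_distance HC.code) = (int CARD('n) - div_degree (set_divisor G)) + 3"
      unfolding md n deg by (simp add: algebra_simps power2_eq_square power3_eq_cube)
  qed
qed

end
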